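(* Let $A\subset\mathbb R^n$ be arbitrary, let $(U_k)_{k\in\mathbb N}$ be an increasing sequence of universally measurable subsets of $\mathbb R^n$ with $\bigcup_k U_k=\mathbb R^n$, and set $A_k:=A\cap U_k$. Then for every $\mu\in\mathfrak M^+$: $\mu^{A_k}\to\mu^A$ vaguely, and $\kappa_\alpha\mu^{A_k}\uparrow\kappa_\alpha\mu^A$ pointwise on $\mathbb R^n$ as $k\to\infty$. If moreover $\mu$ has finite energy, then also $\lim_{k\to\infty}\|\mu^{A_k}-\mu^A\|_\alpha=0$.
   Context: Standing assumptions: $n\ge3$, $\alpha\in(0,2]$, and $\kappa_\alpha(x,y)=|x-y|^{\alpha-n}$ is the Riesz kernel on $\mathbb R^n$. $\mathfrak M^+$ denotes the cone of positive Radon measures $\mu$ on $\mathbb R^n$ whose potential $\kappa_\alpha\mu(x)=\int|x-z|^{\alpha-n}d\mu(z)$ is not identically $+\infty$. The vague topology is that of pointwise convergence on continuous compactly supported functions. $\mathcal E_\alpha$ is the pre-Hilbert space of signed Radon measures of finite energy with inner product $\kappa_\alpha(\mu,\nu)=\iint\kappa_\alpha\,d\mu\,d\nu$ and norm $\|\mu\|_\alpha$; $\mathcal E^+_\alpha(A)$ is the set of positive measures of finite energy concentrated on $A$. The inner capacity of $A\subset\mathbb R^n$ is defined by $1/c_\alpha(A)=\inf\{\|\mu\|_\alpha^2:\ \mu\in\mathcal E^+_\alpha(A),\ \mu(\mathbb R^n)=1\}$. "n.e. on $A$" means: for all points of $A$ except a subset of inner capacity zero. Inner balayage: for $\mu\in\mathfrak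 M^+$ and arbitrary $A$, $\mu^A$ is the unique measure in $\mathfrak M^+$ with $\kappa_\alpha\mu^A=\inf\{\kappa_\alpha\nu:\ \nu\in\mathfrak M^+,\ \kappa_\alpha\nu\ge\kappa_\alpha\mu \text{ n.e. on }A\}$ pointwise. *)

theory Defs
  imports "HOL-Analysis.Analysis"
begin

definition riesz_kernel :: "real \<Rightarrow> 'a::euclidean_space \<Rightarrow> 'a \<Rightarrow> ennreal" where
  "riesz_kernel \<alpha> x y =
     (if x = y then \<infinity> else ennreal (dist x y powr (\<alpha> - real DIM('a))))"

definition radon_pos :: "'a::euclidean_space measure \<Rightarrow> bool" where
  "radon_pos \<mu> \<longleftrightarrow> sets \<mu> = sets borel \<and> (\<forall>K. compact K \<longrightarrow> emeasure \<mu> K < \<infinity>)"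

definition potential :: "real \<Rightarrow> 'a::euclidean_space measure \<Rightarrow> 'a \<Rightarrow> ennreal" where
  "potential \<alpha> \<mu> x = (\<integral>\<^sup>+ z. riesz_kernel \<alpha> x z \<partial>\<mu>)"

definition Mplus :: "real \<Rightarrow> 'a::euclidean_space measure set" where
  "Mplus \<alpha> = {\<mu>. radon_pos \<mu> \<and> \<not> (\<forall>x. potential \<alpha> \<mu> x = \<infinity>)}"

definition mutual_energy :: "real \<Rightarrow> 'a::euclidean_space measure \<Rightarrow> 'a measure \<Rightarrow> ennreal" where
  "mutual_energy \<alpha> \<mu> \<nu> = (\<integral>\<^sup>+ x. (\<integral>\<^sup>+ y. riesz_kernel \<alpha> x y \<partial>\<nu>) \<partial>\<mu>)"

definition energy :: "real \<Rightarrow> 'a::euclidean_space measure \<Rightarrow> ennreal" where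
  "energy \<alpha> \<mu> = mutual_energy \<alpha> \<mu> \<mu>"

text \<open>Energy norm of the signed measure mu - nu for positive mu, nu of finite energy:
  ||mu - nu||^2 = kappa(mu,mu) + kappa(nu,nu) - 2 kappa(mu,nu).\<close>
definition energy_dist :: "real \<Rightarrow> 'a::euclidean_space measure \<Rightarrow> 'a measure \<Rightarrow> real" where
  "energy_dist \<alpha> \<mu> \<nu> =
     sqrt (enn2real (energy \<alpha> \<mu>) + enn2real (energy \<alpha> \<nu>) - 2 * enn2real (mutual_energy \<alpha> \<mu> \<nu>))"

definition concentrated_on :: "'a::euclidean_space measure \<Rightarrow> 'a set \<Rightarrow> bool" where
  "concentrated_on \<mu> A \<longleftrightarrow> (\<exists>N \<in> null_sets \<mu>. UNIV - A \<subseteq> N)"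

definition inner_cap :: "real \<Rightarrow> 'a::euclidean_space set \<Rightarrow> ennreal" where
  "inner_cap \<alpha> A = inverse (INF \<mu> \<in> {\<mu>. radon_pos \<mu> \<and> energy \<alpha> \<mu> < \<infinity> \<and> concentrated_on \<mu> A
                                           \<and> emeasure \<mu> UNIV = 1}. energy \<alpha> \<mu>)"

definition nearly_everywhere_on :: "real \<Rightarrow> 'a::euclidean_space set \<Rightarrow> ('a \<Rightarrow> bool) \<Rightarrow> bool" where
  "nearly_everywhere_on \<alpha> A P \<longleftrightarrow> (\<exists>N. N \<subseteq> A \<and> inner_cap \<alpha> N = 0 \<and> (\<forall>x \<in> A - N. P x))"

definition is_balayage :: "real \<Rightarrow> 'a::euclidean_space measure \<Rightarrow> 'a set \<Rightarrow> 'a measure \<Rightarrow> bool" where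
  "is_balayage \<alpha> \<mu> A \<nu> \<longleftrightarrow> \<nu> \<in> Mplus \<alpha> \<and>
     (\<forall>x. potential \<alpha> \<nu> x =
        (INF \<eta> \<in> {\<eta> \<in> Mplus \<alpha>. nearly_everywhere_on \<alpha> A (\<lambda>y. potential \<alpha> \<eta> y \<ge> potential \<alpha> \<mu> y)}.
           potential \<alpha> \<eta> x))"

definition vague_conv :: "(nat \<Rightarrow> 'a::euclidean_space measure) \<Rightarrow> 'a measure \<Rightarrow> bool" where
  "vague_conv \<mu>s \<mu> \<longleftrightarrow> (\<forall>f :: 'a \<Rightarrow> real. continuous_on UNIV f \<and> compact (closure {x. f x \<noteq> 0}) \<longrightarrow>
       (\<lambda>k. integral\<^sup>L (\<mu>s k) f) \<longlonglongrightarrow> integral\<^sup>L \<mu> f)"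

definition universally_measurable :: "'a::euclidean_space set \<Rightarrow> bool" where
  "universally_measurable U \<longleftrightarrow> (\<forall>\<mu>. radon_pos \<mu> \<longrightarrow> U \<in> sets (completion \<mu>))"

end

theory Submission
  imports Defs "HOL-Probability.Probability"
begin

text \<open>
  Subordination writes the Riesz kernel as a mixture of heat kernels, \<open>K = C \<integral>\<^sub>0\<^sup>\<infinity> t\<^bsup>\<alpha>/2-1\<^esup> h\<^sub>t dt\<close>.
  Because \<open>\<alpha>/2 \<le> 1\<close>, the law of the \<open>\<alpha>/2\<close>-stable subordinator at its first passage above \<open>T\<close> gives a mixture
  \<open>\<rho>\<^sub>T\<close> of mass one such that \<open>K * \<rho>\<^sub>T\<close> is the part of the mixture with \<open>t > T\<close>: it is bounded and
  \<open>\<le> K\<close>, and \<open>K - K * \<rho>\<^sub>T\<close> is a multiple of an approximate identity. The densities \<open>\<rho>\<^sub>T\<close> replace the spherical means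
  of classical potential theory: a potential \<open>u = K * \<eta>\<close> satisfies \<open>\<rho>\<^sub>T * u \<le> u\<close>, with convergence as \<open>T \<rightarrow> 0\<close>.

  By Choquet's lemma the potential of a balayage is the regularization of a countable infimum of
  potentials. For a measure \<open>\<nu>\<close> of finite energy, the positive definiteness of \<open>K\<close> bounds
  \<open>\<integral>(v - \<rho>\<^sub>T * v) d\<nu>\<close> by the energy norm of \<open>\<nu> - \<rho>\<^sub>T * \<nu>\<close>, uniformly over minima \<open>v\<close> of finitely many
  potentials, so that infimum and regularization agree \<open>\<nu>\<close>-almost everywhere; hence the
  potential of the balayage on \<open>A\<close> dominates that of \<open>\<mu>\<close> nearly everywhere on \<open>A\<close>.

  The potentials of the balayages on \<open>A \<inter> U k\<close> increase, and by vague compactness their supremum is the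
  potential of a measure. It dominates the potential of \<open>\<mu>\<close> nearly everywhere on \<open>A\<close>, because sets of inner
  capacity zero can be glued along universally measurable sets; so it is the potential of the
  balayage on \<open>A\<close>. Since \<open>K - K * \<rho>\<^sub>T\<close> is an approximate identity, a measure is determined by its potential,
  so every vaguely convergent subsequence has the same limit; strong convergence follows
  from monotone convergence of the mutual energies.
\<close>

section \<open>Convolution of functions and measures\<close>

definition conv :: "('a::euclidean_space \<Rightarrow> ennreal) \<Rightarrow> ('a \<Rightarrow> ennreal) \<Rightarrow> 'a \<Rightarrow> ennreal" where
  "conv f h x = (\<integral>\<^sup>+ y. f (x - y) * h y \<partial>lborel)"

definition conv_measure :: "('a::euclidean_space \<Rightarrow> ennreal) \<Rightarrow> 'a measure \<Rightarrow> 'a \<Rightarrow> ennreal" where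
  "conv_measure f \<eta> x = (\<integral>\<^sup>+ y. f (x - y) \<partial>\<eta>)"

lemma nn_integral_lborel_shift:
  fixes f :: "'a::euclidean_space \<Rightarrow> ennreal"
  assumes [measurable]: "f \<in> borel_measurable borel"
  shows "(\<integral>\<^sup>+ y. f (y + z) \<partial>lborel) = (\<integral>\<^sup>+ y. f y \<partial>lborel)"
proof -
  have "(\<integral>\<^sup>+ y. f y \<partial>lborel) = (\<integral>\<^sup>+ y. f y \<partial>(distr lborel borel ((+) z)))"
    by (simp add: lborel_distr_plus)
  also have "\<dots> = (\<integral>\<^sup>+ y. f (z + y) \<partial>lborel)"
    by (subst nn_integral_distr) auto
  finally show ?thesis by (simp add: add.commute)
qed

lemma nn_integral_lborel_scale:
  fixes f :: "'a::euclidean_space \<Rightarrow> ennreal"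
  assumes [measurable]: "f \<in> borel_measurable borel" and c: "c \<noteq> 0"
  shows "(\<integral>\<^sup>+ y. f y \<partial>lborel) = ennreal (\<bar>c\<bar> ^ DIM('a)) * (\<integral>\<^sup>+ y. f (c *\<^sub>R y) \<partial>lborel)"
proof -
  have "(\<integral>\<^sup>+ y. f y \<partial>lborel) =
    (\<integral>\<^sup>+ y. f y \<partial>(density (distr lborel borel (\<lambda>x. 0 + c *\<^sub>R x)) (\<lambda>_. \<bar>c\<bar>^DIM('a))))"
    using lborel_affine[OF c, of "0::'a"] by simp
  also have "\<dots> = ennreal (\<bar>c\<bar> ^ DIM('a)) * (\<integral>\<^sup>+ y. f (c *\<^sub>R y) \<partial>lborel)"
    by (subst nn_integral_density) (auto simp: nn_integral_cmult nn_integral_distr)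
  finally show ?thesis .
qed

lemma nn_integral_lborel_minus:
  fixes f :: "'a::euclidean_space \<Rightarrow> ennreal"
  assumes [measurable]: "f \<in> borel_measurable borel"
  shows "(\<integral>\<^sup>+ y. f (x - y) \<partial>lborel) = (\<integral>\<^sup>+ y. f y \<partial>lborel)"
proof -
  have "(\<integral>\<^sup>+ y. f y \<partial>lborel) = (\<integral>\<^sup>+ y. f (- y) \<partial>lborel)"
    using nn_integral_lborel_scale[of f "-1"] by simp
  also have "\<dots> = (\<integral>\<^sup>+ y. f (- (y + (- x))) \<partial>lborel)"
    by (rule nn_integral_lborel_shift[symmetric]) simp
  finally show ?thesis by simp
qed

lemma conv_commute:
  assumes [measurable]: "f \<in> borel_measurable borel" "h \<in> borel_measurable borel"
  shows "conv f h = conv h f"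
proof
  fix x
  have "conv f h x = (\<integral>\<^sup>+ y. f (x - y) * h (x - (x - y)) \<partial>lborel)"
    by (simp add: conv_def)
  also have "\<dots> = (\<integral>\<^sup>+ y. f y * h (x - y) \<partial>lborel)"
    by (rule nn_integral_lborel_minus) simp
  finally show "conv f h x = conv h f x" by (simp add: conv_def mult.commute)
qed

lemma conv_eq_conv_measure:
  assumes [measurable]: "f \<in> borel_measurable borel" "h \<in> borel_measurable borel"
  shows "conv f h = conv_measure f (density lborel h)"
  by (auto simp: conv_def conv_measure_def nn_integral_density mult.commute fun_eq_iff)

lemma measurable_conv_measure [measurable]:
  fixes f :: "'a::euclidean_space \<Rightarrow> ennreal"
  assumes [measurable]: "f \<in> borel_measurable borel" and "sigma_finite_measure \<eta>"
    and [measurable_cong]: "sets \<eta> = sets borel"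
  shows "conv_measure f \<eta> \<in> borel_measurable borel"
proof -
  interpret sigma_finite_measure \<eta> by fact
  have "(\<lambda>x. \<integral>\<^sup>+ y. f (x - y) \<partial>\<eta>) \<in> borel_measurable borel"
    by measurable
  then show ?thesis by (simp add: conv_measure_def[abs_def])
qed

lemma measurable_conv [measurable]:
  fixes f :: "'a::euclidean_space \<Rightarrow> ennreal"
  assumes [measurable]: "f \<in> borel_measurable borel" "h \<in> borel_measurable borel"
  shows "conv f h \<in> borel_measurable borel"
  unfolding conv_def[abs_def] by measurable

lemma nn_integral_conv_nested:
  fixes f :: "'a::euclidean_space \<Rightarrow> ennreal"
  assumes [measurable]: "f \<in> borel_measurable borel" "h \<in> borel_measurable borel" "w \<in> borel_measurable borel"
    and "sigma_finite_measure \<eta>" and [measurable_cong]: "sets \<eta> = sets borel"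
  shows "(\<integral>\<^sup>+ y. f (x - y) * (\<integral>\<^sup>+ z. h (y - z) * w z \<partial>\<eta>) \<partial>lborel) = (\<integral>\<^sup>+ z. conv f h (x - z) * w z \<partial>\<eta>)"
proof -
  interpret sigma_finite_measure \<eta> by fact
  interpret pair_sigma_finite lborel \<eta> ..
  have "(\<integral>\<^sup>+ y. f (x - y) * (\<integral>\<^sup>+ z. h (y - z) * w z \<partial>\<eta>) \<partial>lborel) =
      (\<integral>\<^sup>+ y. (\<integral>\<^sup>+ z. f (x - y) * h (y - z) * w z \<partial>\<eta>) \<partial>lborel)"
    by (simp add: nn_integral_cmult mult.assoc)
  also have "\<dots> = (\<integral>\<^sup>+ z. (\<integral>\<^sup>+ y. f (x - y) * h (y - z) * w z \<partial>lborel) \<partial>\<eta>)"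
    by (rule Fubini'[symmetric]) measurable
  also have "\<dots> = (\<integral>\<^sup>+ z. (\<integral>\<^sup>+ y. f (x - (y + z)) * h ((y + z) - z) * w z \<partial>lborel) \<partial>\<eta>)"
    by (intro nn_integral_cong nn_integral_lborel_shift[symmetric]) simp
  also have "\<dots> = (\<integral>\<^sup>+ z. conv f h (x - z) * w z \<partial>\<eta>)"
    by (simp add: conv_def nn_integral_multc diff_diff_add add.commute)
  finally show ?thesis .
qed

lemma conv_conv_measure:
  fixes f :: "'a::euclidean_space \<Rightarrow> ennreal"
  assumes "f \<in> borel_measurable borel" "h \<in> borel_measurable borel"
    and "sigma_finite_measure \<eta>" "sets \<eta> = sets borel"
  shows "conv f (conv_measure h \<eta>) = conv_measure (conv f h) \<eta>"
proof
  show "conv f (conv_measure h \<eta>) x = conv_measure (conv f h) \<eta> x" for x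
    using nn_integral_conv_nested[OF assms(1,2) _ assms(3,4), of "\<lambda>_. 1" x]
    by (simp add: conv_measure_def conv_def)
qed

lemma conv_assoc:
  fixes f :: "'a::euclidean_space \<Rightarrow> ennreal"
  assumes "f \<in> borel_measurable borel" "h \<in> borel_measurable borel" "k \<in> borel_measurable borel"
  shows "conv f (conv h k) = conv (conv f h) k"
proof
  show "conv f (conv h k) x = conv (conv f h) k x" for x
    using nn_integral_conv_nested[OF assms sigma_finite_lborel, of x] by (simp add: conv_def)
qed

lemma nn_integral_conv:
  fixes f :: "'a::euclidean_space \<Rightarrow> ennreal"
  assumes [measurable]: "f \<in> borel_measurable borel" "h \<in> borel_measurable borel"
  shows "(\<integral>\<^sup>+ x. conv f h x \<partial>lborel) = (\<integral>\<^sup>+ x. f x \<partial>lborel) * (\<integral>\<^sup>+ x. h x \<partial>lborel)"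
proof -
  have "(\<integral>\<^sup>+ x. conv f h x \<partial>lborel) = (\<integral>\<^sup>+ y. (\<integral>\<^sup>+ x. f (x - y) * h y \<partial>lborel) \<partial>lborel)"
    unfolding conv_def by (rule lborel_pair.Fubini'[symmetric]) measurable
  also have "\<dots> = (\<integral>\<^sup>+ y. (\<integral>\<^sup>+ x. f x \<partial>lborel) * h y \<partial>lborel)"
    using nn_integral_lborel_shift[of f "- y" for y] by (simp add: nn_integral_multc)
  finally show ?thesis by (simp add: nn_integral_cmult)
qed

definition kernel_energy :: "('a::euclidean_space \<Rightarrow> ennreal) \<Rightarrow> 'a measure \<Rightarrow> 'a measure \<Rightarrow> ennreal" where
  "kernel_energy f \<eta> \<nu> = (\<integral>\<^sup>+ x. conv_measure f \<eta> x \<partial>\<nu>)"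

lemma kernel_energy_commute:
  fixes f :: "'a::euclidean_space \<Rightarrow> ennreal"
  assumes [measurable]: "f \<in> borel_measurable borel" and even: "\<And>x. f (- x) = f x"
    and "sigma_finite_measure \<eta>" and [measurable_cong]: "sets \<eta> = sets borel"
    and "sigma_finite_measure \<nu>" and [measurable_cong]: "sets \<nu> = sets borel"
  shows "kernel_energy f \<eta> \<nu> = kernel_energy f \<nu> \<eta>"
proof -
  interpret E: sigma_finite_measure \<eta> by fact
  interpret N: sigma_finite_measure \<nu> by fact
  interpret pair_sigma_finite \<nu> \<eta> ..
  have "f (x - y) = f (y - x)" for x y using even[of "x - y"] by simp
  then show ?thesis unfolding kernel_energy_def conv_measure_def
    by (subst Fubini'[symmetric]) (auto cong: nn_integral_cong)
qed

lemma nn_integral_conv_dual: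
  fixes f :: "'a::euclidean_space \<Rightarrow> ennreal"
  assumes [measurable]: "f \<in> borel_measurable borel" "v \<in> borel_measurable borel" and even: "\<And>x. f (- x) = f x"
    and "sigma_finite_measure \<nu>" and [measurable_cong]: "sets \<nu> = sets borel"
  shows "(\<integral>\<^sup>+ x. conv f v x \<partial>\<nu>) = (\<integral>\<^sup>+ x. conv_measure f \<nu> x * v x \<partial>lborel)"
proof -
  interpret N: sigma_finite_measure \<nu> by fact
  interpret P: pair_sigma_finite \<nu> lborel ..
  have e: "f (x - y) = f (y - x)" for x y using even[of "x - y"] by simp
  have "(\<integral>\<^sup>+ x. conv f v x \<partial>\<nu>) = (\<integral>\<^sup>+ y. (\<integral>\<^sup>+ x. f (x - y) * v y \<partial>\<nu>) \<partial>lborel)"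
    unfolding conv_def by (subst P.Fubini'[symmetric]) auto
  also have "\<dots> = (\<integral>\<^sup>+ x. conv_measure f \<nu> x * v x \<partial>lborel)"
    by (intro nn_integral_cong) (simp add: nn_integral_multc conv_measure_def, subst e, simp)
  finally show ?thesis .
qed

lemma conv_add_left:
  assumes [measurable]: "f \<in> borel_measurable borel" "f' \<in> borel_measurable borel" "h \<in> borel_measurable borel"
  shows "conv (\<lambda>x. f x + f' x) h x = conv f h x + conv f' h x"
  by (simp add: conv_def distrib_right nn_integral_add)

lemma conv_add_right:
  assumes [measurable]: "f \<in> borel_measurable borel" "h \<in> borel_measurable borel" "h' \<in> borel_measurable borel"
  shows "conv f (\<lambda>x. h x + h' x) x = conv f h x + conv f h' x"
  by (simp add: conv_def distrib_left nn_integral_add)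

lemma conv_cmult_right:
  assumes [measurable]: "f \<in> borel_measurable borel" "h \<in> borel_measurable borel"
  shows "conv f (\<lambda>x. c * h x) x = c * conv f h x"
  by (simp add: conv_def mult.left_commute nn_integral_cmult)

lemma conv_cmult_left:
  assumes [measurable]: "f \<in> borel_measurable borel" "h \<in> borel_measurable borel"
  shows "conv (\<lambda>x. c * f x) h x = c * conv f h x"
  by (simp add: conv_def mult.assoc nn_integral_cmult)

lemma conv_left_commute:
  assumes [measurable]: "f \<in> borel_measurable borel" "h \<in> borel_measurable borel" "k \<in> borel_measurable borel"
  shows "conv f (conv h k) = conv h (conv f k)"
  by (simp add: conv_assoc conv_commute[of f h])

lemma conv_mono: "(\<And>x. f x \<le> f' x) \<Longrightarrow> (\<And>x. h x \<le> h' x) \<Longrightarrow> conv f h x \<le> conv f' h' x"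
  unfolding conv_def by (intro nn_integral_mono mult_mono) auto

lemma conv_const:
  fixes f :: "'a::euclidean_space \<Rightarrow> ennreal"
  assumes [measurable]: "f \<in> borel_measurable borel"
  shows "conv f (\<lambda>_. M) x = (\<integral>\<^sup>+ y. f y \<partial>lborel) * M"
  by (simp add: conv_def nn_integral_multc nn_integral_lborel_minus)

lemma conv_le_const:
  fixes f :: "'a::euclidean_space \<Rightarrow> ennreal"
  assumes "f \<in> borel_measurable borel" and "\<And>x. h x \<le> M"
  shows "conv f h x \<le> (\<integral>\<^sup>+ y. f y \<partial>lborel) * M"
  using conv_mono[of f f h "\<lambda>_. M" x] assms by (simp add: conv_const)

lemma conv_SUP:
  fixes h :: "'a::euclidean_space \<Rightarrow> ennreal" and v :: "nat \<Rightarrow> 'a \<Rightarrow> ennreal"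
  assumes [measurable]: "h \<in> borel_measurable borel" "\<And>k. v k \<in> borel_measurable borel"
    and inc: "\<And>x. incseq (\<lambda>k. v k x)"
  shows "conv h (\<lambda>x. SUP k. v k x) x = (SUP k. conv h (v k) x)"
proof -
  have "incseq (\<lambda>k y. h (x - y) * v k y)"
    by (intro incseq_SucI le_funI mult_left_mono incseq_SucD[OF inc]) auto
  then show ?thesis
    unfolding conv_def SUP_mult_left_ennreal by (intro nn_integral_monotone_convergence_SUP) auto
qed

section \<open>Lower semicontinuous functions\<close>

definition lsc :: "('a::topological_space \<Rightarrow> ennreal) \<Rightarrow> bool" where
  "lsc v \<longleftrightarrow> (\<forall>a. open {x. a < v x})"

lemma borel_measurable_lsc: "lsc v \<Longrightarrow> v \<in> borel_measurable borel"
  by (rule borel_measurableI_greater) (simp add: lsc_def)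

lemma lsc_le_Liminf:
  assumes "lsc v" "(X \<longlongrightarrow> x) F" shows "v x \<le> Liminf F (\<lambda>k. v (X k))"
  unfolding le_Liminf_iff
proof safe
  fix a assume "a < v x"
  then have "open {x. a < v x}" "x \<in> {x. a < v x}" using assms(1) by (auto simp: lsc_def)
  from topological_tendstoD[OF assms(2) this] show "\<forall>\<^sub>F k in F. a < v (X k)" by simp
qed

lemma lsc_sequentiallyI:
  fixes v :: "'a::first_countable_topology \<Rightarrow> ennreal"
  assumes "\<And>X x. X \<longlonglongrightarrow> x \<Longrightarrow> v x \<le> liminf (\<lambda>k. v (X k))"
  shows "lsc v"
  unfolding lsc_def
proof
  fix a
  have "closed {x. v x \<le> a}" unfolding closed_sequential_limits
  proof safe
    fix X x assume "\<forall>k. X k \<in> {x. v x \<le> a}" and X: "X \<longlonglongrightarrow> x"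
    then have "liminf (\<lambda>k. v (X k)) \<le> liminf (\<lambda>k::nat. a)" by (intro Liminf_mono) auto
    then show "v x \<le> a" using assms[OF X] by (simp add: Liminf_const)
  qed
  then show "open {x. a < v x}" by (simp add: closed_def Compl_eq not_le)
qed

lemma liminf_cmult_ennreal:
  fixes a :: "nat \<Rightarrow> ennreal"
  assumes "c < \<infinity>" shows "liminf (\<lambda>k. c * a k) = c * liminf a"
  using assms by (intro Liminf_compose_continuous_mono ennreal_continuous_on_cmult)
    (auto simp: mono_def intro: mult_left_mono continuous_on_id)

lemma lsc_cmult:
  fixes v :: "'a::first_countable_topology \<Rightarrow> ennreal"
  assumes "lsc v" "c < \<infinity>" shows "lsc (\<lambda>x. c * v x)"
proof (rule lsc_sequentiallyI)
  fix X x assume X: "X \<longlonglongrightarrow> (x :: 'a)"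
  have "c * v x \<le> c * liminf (\<lambda>k. v (X k))"
    by (intro mult_left_mono lsc_le_Liminf[OF assms(1) X]) simp
  also have "\<dots> = liminf (\<lambda>k. c * v (X k))"
    using assms(2) by (simp add: liminf_cmult_ennreal)
  finally show "c * v x \<le> liminf (\<lambda>k. c * v (X k))" .
qed

lemma lsc_min: "lsc u \<Longrightarrow> lsc v \<Longrightarrow> lsc (\<lambda>x. min (u x) (v x))"
  unfolding lsc_def by (auto simp: Collect_conj_eq)

lemma lsc_SUP:
  fixes v :: "'i \<Rightarrow> 'a::topological_space \<Rightarrow> ennreal"
  assumes "\<And>i. i \<in> I \<Longrightarrow> lsc (v i)" shows "lsc (\<lambda>x. SUP i\<in>I. v i x)"
proof -
  have "{x. a < (SUP i\<in>I. v i x)} = (\<Union>i\<in>I. {x. a < v i x})" for a by (auto simp: less_SUP_iff)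
  then show ?thesis using assms by (auto simp: lsc_def)
qed

lemma lsc_conv_measure:
  fixes f :: "'a::euclidean_space \<Rightarrow> ennreal"
  assumes "lsc f" and [measurable_cong]: "sets \<eta> = sets borel"
  shows "lsc (conv_measure f \<eta>)"
proof (rule lsc_sequentiallyI)
  fix x :: 'a and X assume X: "X \<longlonglongrightarrow> x"
  note borel_measurable_lsc[OF assms(1), measurable]
  have "conv_measure f \<eta> x \<le> (\<integral>\<^sup>+ y. liminf (\<lambda>k. f (X k - y)) \<partial>\<eta>)"
    unfolding conv_measure_def using X
    by (intro nn_integral_mono lsc_le_Liminf[OF assms(1)] tendsto_intros)
  also have "\<dots> \<le> liminf (\<lambda>k. conv_measure f \<eta> (X k))"
    unfolding conv_measure_def by (rule nn_integral_liminf) measurable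
  finally show "conv_measure f \<eta> x \<le> liminf (\<lambda>k. conv_measure f \<eta> (X k))" .
qed

lemma lsc_conv:
  assumes "lsc f" "h \<in> borel_measurable borel" shows "lsc (conv f h)"
  using assms lsc_conv_measure[OF assms(1), of "density lborel h"]
  by (simp add: conv_eq_conv_measure borel_measurable_lsc)

lemma tendsto_of_liminf_complement:
  fixes a b :: "nat \<Rightarrow> ennreal"
  assumes sum: "\<And>k. a k + b k = C" "l + m = C" "C \<noteq> \<infinity>"
    and liminf: "l \<le> liminf a" "m \<le> liminf b"
  shows "a \<longlonglongrightarrow> l"
proof -
  have fin: "a k \<noteq> \<infinity>" "l \<noteq> \<infinity>" for k using sum(1)[of k] sum(2,3) by auto
  have le: "a k \<le> C" for k using sum(1)[of k] by (metis le_iff_add)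
  have "b = (\<lambda>k. C - a k)"
    unfolding sum(1)[of 0, symmetric] using fin sum(1) by (metis ennreal_add_diff_cancel_left infinity_ennreal_def)
  then have "liminf b = C - limsup a" using ennreal_liminf_minus[of a C] le by simp
  moreover have "m = C - l" unfolding sum(2)[symmetric] using fin by simp
  ultimately have "C - l \<le> C - limsup a" using liminf(2) by simp
  moreover have "limsup a \<le> C" using le by (intro Limsup_bounded always_eventually) simp
  ultimately have "limsup a \<le> l"
    using sum(3) by (metis diff_diff_ennreal ennreal_minus_mono infinity_ennreal_def order_refl sum(2) le_iff_add)
  with liminf(1) show ?thesis
    using Liminf_le_Limsup[of sequentially a] by (auto simp: tendsto_iff_Liminf_eq_Limsup)
qed

lemma tendsto_conv_bounded:
  fixes h :: "'a::euclidean_space \<Rightarrow> ennreal"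
  assumes h: "lsc h" "(\<integral>\<^sup>+ y. h y \<partial>lborel) < \<infinity>"
    and [measurable]: "v \<in> borel_measurable borel" and v: "\<And>x. v x \<le> C" "C < \<infinity>" and X: "X \<longlonglongrightarrow> x"
  shows "(\<lambda>k. conv h v (X k)) \<longlonglongrightarrow> conv h v x"
proof (rule tendsto_of_liminf_complement[where b="\<lambda>k. conv h (\<lambda>x. C - v x) (X k)" and m="conv h (\<lambda>x. C - v x) x"])
  note borel_measurable_lsc[OF h(1), measurable]
  have "conv h v y + conv h (\<lambda>x. C - v x) y = conv h (\<lambda>_. C) y" for y
    using v(1) by (subst conv_add_right[symmetric]) (auto simp: add_diff_inverse_ennreal)
  then have split: "conv h v y + conv h (\<lambda>x. C - v x) y = (\<integral>\<^sup>+ y. h y \<partial>lborel) * C" for y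
    by (simp add: conv_const)
  show "conv h v (X k) + conv h (\<lambda>x. C - v x) (X k) = (\<integral>\<^sup>+ y. h y \<partial>lborel) * C" for k
    by (rule split)
  show "conv h v x + conv h (\<lambda>x. C - v x) x = (\<integral>\<^sup>+ y. h y \<partial>lborel) * C" by (rule split)
  show "(\<integral>\<^sup>+ y. h y \<partial>lborel) * C \<noteq> \<infinity>" using h(2) v(2) by (auto simp: ennreal_mult_eq_top_iff)
qed (auto intro!: lsc_le_Liminf[OF lsc_conv X] h)

section \<open>The heat kernel and its mixtures\<close>

definition heat :: "real \<Rightarrow> 'a::euclidean_space \<Rightarrow> real" where
  "heat t x = (if t \<le> 0 then 0 else (\<Prod>b\<in>Basis. normal_density 0 (sqrt (2 * t)) (x \<bullet> b)))"

lemma heat_eq: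
  fixes x :: "'a::euclidean_space"
  assumes t: "t > 0"
  shows "heat t x = (4 * pi * t) powr (- (real DIM('a) / 2)) * exp (- (norm x)\<^sup>2 / (4 * t))"
proof -
  have "(\<Prod>b\<in>Basis. exp (- (x \<bullet> b)\<^sup>2 / (4 * t))) = exp (- (norm x)\<^sup>2 / (4 * t))"
    unfolding power2_norm_eq_inner euclidean_inner[of x x]
    by (simp add: exp_sum[symmetric] sum_divide_distrib[symmetric] sum_negf power2_eq_square)
  moreover have "(1 / sqrt (4 * pi * t)) ^ DIM('a) = (4 * pi * t) powr (- (real DIM('a) / 2))"
    using t by (simp add: powr_half_sqrt[symmetric] powr_minus_divide[symmetric] powr_realpow[symmetric] powr_powr)
  moreover have "normal_density 0 (sqrt (2 * t)) u = 1 / sqrt (4 * pi * t) * exp (- u\<^sup>2 / (4 * t))" for u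
    using t by (simp add: normal_density_def)
  ultimately show ?thesis using t by (simp add: heat_def prod.distrib del: times_divide_eq_left)
qed

lemma heat_nonpos [simp]: "t \<le> 0 \<Longrightarrow> heat t x = 0"
  by (simp add: heat_def)

lemma heat_pos: "t > 0 \<Longrightarrow> heat t x > 0"
  by (simp add: heat_eq)

lemma heat_nonneg [simp]: "heat t x \<ge> 0"
  using heat_pos[of t x] by (cases "t > 0") auto

lemma heat_minus: "heat t (- x) = heat t x"
  by (cases "t > 0") (simp_all add: heat_eq)

lemma heat_antimono: "norm x \<le> norm y \<Longrightarrow> heat t y \<le> heat t x"
  for x y :: "'a::euclidean_space"
  by (cases "t > 0") (simp_all add: heat_eq divide_right_mono power_mono)

lemma heat_le:
  assumes "t > 0" shows "heat t (x :: 'a::euclidean_space) \<le> (4 * pi * t) powr (- (real DIM('a) / 2))"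
  using assms by (simp add: heat_eq mult_left_le)

lemma heat_scale:
  assumes "r > 0"
  shows "heat (r\<^sup>2 * t) (r *\<^sub>R x :: 'a::euclidean_space) = r powr (- real DIM('a)) * heat t x"
proof (cases "t > 0")
  case True
  have "(4 * pi * (r\<^sup>2 * t)) powr p = r powr (2 * p) * (4 * pi * t) powr p" for p
    using assms True by (simp add: powr_mult powr_powr[symmetric])
  then show ?thesis
    using assms True by (simp add: heat_eq power_mult_distrib)
qed (use assms in \<open>simp add: mult_le_0_iff\<close>)

lemma measurable_heat [measurable (raw)]:
  assumes [measurable]: "f \<in> borel_measurable M" "g \<in> borel_measurable M"
  shows "(\<lambda>w. heat (f w) (g w :: 'a::euclidean_space)) \<in> borel_measurable M"
proof -
  have "(\<lambda>w. heat (f w) (g w)) = (\<lambda>w. if f w \<le> 0 then 0 else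
      (4 * pi * f w) powr (- (real DIM('a) / 2)) * exp (- (norm (g w))\<^sup>2 / (4 * f w)))"
    by (auto simp: fun_eq_iff heat_eq)
  then show ?thesis by simp
qed

lemma tendsto_heat:
  assumes "(X \<longlongrightarrow> x) F" shows "((\<lambda>k. heat t (X k)) \<longlongrightarrow> heat t x) F"
proof (cases "t > 0")
  case True
  then show ?thesis unfolding heat_eq[OF True] by (intro tendsto_intros assms) simp
qed simp

lemma nn_integral_heat:
  assumes "t > 0" shows "(\<integral>\<^sup>+ y. ennreal (heat t (y::'a::euclidean_space)) \<partial>lborel) = 1"
proof -
  have "prob_space (density lborel (normal_density 0 (sqrt (2 * t))))"
    using assms by (intro prob_space_normal_density) simp
  from prob_space.emeasure_space_1[OF this]
  have "(\<integral>\<^sup>+ u. ennreal (normal_density 0 (sqrt (2 * t)) u) \<partial>lborel) = 1"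
    by (simp add: emeasure_density)
  then show ?thesis
    using assms nn_integral_lborel_prod[of "\<lambda>(_::'a) u. ennreal (normal_density 0 (sqrt (2 * t)) u)"]
    by (simp add: heat_def prod_ennreal)
qed

lemma conv_heat:
  assumes s: "s > 0" and t: "t > 0"
  shows "conv (\<lambda>x. ennreal (heat s x)) (\<lambda>x. ennreal (heat t x)) x
      = ennreal (heat (s + t) (x::'a::euclidean_space))"
proof -
  let ?n = "\<lambda>r u. normal_density 0 (sqrt (2 * r)) u"
  have "conv (\<lambda>x. ennreal (heat s x)) (\<lambda>x. ennreal (heat t x)) x
      = (\<integral>\<^sup>+ y. (\<Prod>b\<in>Basis. ennreal (?n s (x \<bullet> b - y \<bullet> b) * ?n t (y \<bullet> b))) \<partial>lborel)"
    using s t by (simp add: conv_def heat_def prod_ennreal prod.distrib ennreal_mult' inner_diff_left prod_nonneg)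
  also have "\<dots> = (\<Prod>b\<in>Basis. (\<integral>\<^sup>+ u. ennreal (?n s (x \<bullet> b - u) * ?n t u) \<partial>lborel))"
    by (rule nn_integral_lborel_prod) auto
  also have "\<dots> = (\<Prod>b\<in>Basis. ennreal (?n (s + t) (x \<bullet> b)))"
    using s t fun_cong[OF conv_normal_density_zero_mean[of "sqrt (2 * s)" "sqrt (2 * t)"]]
    by (simp add: distrib_left)
  also have "\<dots> = ennreal (heat (s + t) x)" using s t by (simp add: heat_def prod_ennreal)
  finally show ?thesis .
qed

lemma nn_integral_heat_scale:
  fixes f :: "'a::euclidean_space \<Rightarrow> ennreal"
  assumes [measurable]: "f \<in> borel_measurable borel" and t: "t > 0"
  shows "(\<integral>\<^sup>+ y. f y * ennreal (heat t y) \<partial>lborel) = (\<integral>\<^sup>+ y. f (sqrt t *\<^sub>R y) * ennreal (heat 1 y) \<partial>lborel)"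
proof -
  have "sqrt t ^ DIM('a) * heat t (sqrt t *\<^sub>R y) = heat 1 y" for y :: 'a
    using t heat_scale[of "sqrt t" 1 y] by (simp add: powr_minus powr_realpow)
  then have "ennreal (sqrt t ^ DIM('a)) * (f (sqrt t *\<^sub>R y) * ennreal (heat t (sqrt t *\<^sub>R y)))
      = f (sqrt t *\<^sub>R y) * ennreal (heat 1 y)" for y
    using t by (metis ennreal_mult' heat_nonneg mult.left_commute real_sqrt_ge_zero zero_le_power less_imp_le)
  then show ?thesis
    using t by (subst nn_integral_lborel_scale[of _ "sqrt t"]) (simp_all add: nn_integral_cmult[symmetric])
qed

definition heat_mixture :: "real measure \<Rightarrow> 'a::euclidean_space \<Rightarrow> ennreal" where
  "heat_mixture Q x = (\<integral>\<^sup>+ t. ennreal (heat t x) \<partial>Q)"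

lemma heat_mixture_minus: "heat_mixture Q (- x) = heat_mixture Q x"
  by (simp add: heat_mixture_def heat_minus)

lemma heat_mixture_antimono: "norm x \<le> norm y \<Longrightarrow> heat_mixture Q y \<le> heat_mixture Q x"
  for x y :: "'a::euclidean_space"
  unfolding heat_mixture_def by (intro nn_integral_mono ennreal_leI heat_antimono)

lemma lsc_heat_mixture:
  assumes [measurable_cong]: "sets Q = sets borel"
  shows "lsc (heat_mixture Q :: 'a::euclidean_space \<Rightarrow> ennreal)"
proof (rule lsc_sequentiallyI)
  fix X and x :: 'a assume X: "X \<longlonglongrightarrow> x"
  have "heat_mixture Q x = (\<integral>\<^sup>+ t. liminf (\<lambda>k. ennreal (heat t (X k))) \<partial>Q)"
    unfolding heat_mixture_def
    by (intro nn_integral_cong lim_imp_Liminf[symmetric] tendsto_ennrealI tendsto_heat X) simp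
  also have "\<dots> \<le> liminf (\<lambda>k. heat_mixture Q (X k))"
    unfolding heat_mixture_def by (rule nn_integral_liminf) measurable
  finally show "heat_mixture Q x \<le> liminf (\<lambda>k. heat_mixture Q (X k))" .
qed

lemma measurable_heat_mixture [measurable]:
  "sets Q = sets borel \<Longrightarrow> heat_mixture Q \<in> borel_measurable borel"
  by (intro borel_measurable_lsc lsc_heat_mixture)

lemma heat_mixture_neq_0:
  assumes [measurable_cong]: "sets Q = sets borel" and "AE t in Q. t > 0" "emeasure Q (space Q) \<noteq> 0"
  shows "heat_mixture Q x \<noteq> 0"
proof
  assume "heat_mixture Q x = 0"
  then have "AE t in Q. ennreal (heat t x) = 0"
    unfolding heat_mixture_def by (subst (asm) nn_integral_0_iff_AE) auto
  with assms(2) have "AE t in Q. False" 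
    by eventually_elim (use heat_pos[of _ x] in \<open>simp add: ennreal_eq_0_iff not_le[symmetric]\<close>)
  then show False using assms(3) by (simp add: AE_iff_null null_setsD1)
qed

lemma nn_integral_heat_mixture:
  assumes "sigma_finite_measure Q" and [measurable_cong]: "sets Q = sets borel" and pos: "AE t in Q. t > 0"
  shows "(\<integral>\<^sup>+ x. heat_mixture Q (x::'a::euclidean_space) \<partial>lborel) = emeasure Q (space Q)"
proof -
  interpret sigma_finite_measure Q by fact
  interpret pair_sigma_finite Q "lborel :: 'a measure" ..
  have "(\<integral>\<^sup>+ x. heat_mixture Q (x::'a) \<partial>lborel) = (\<integral>\<^sup>+ t. (\<integral>\<^sup>+ x. ennreal (heat t (x::'a)) \<partial>lborel) \<partial>Q)"
    unfolding heat_mixture_def by (rule Fubini') measurable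
  also have "\<dots> = (\<integral>\<^sup>+ t. 1 \<partial>Q)"
    by (rule nn_integral_cong_AE, use pos in eventually_elim) (simp add: nn_integral_heat)
  finally show ?thesis by simp
qed

lemma conv_heat_mixture:
  fixes v :: "'a::euclidean_space \<Rightarrow> ennreal"
  assumes "sigma_finite_measure Q" and [measurable_cong]: "sets Q = sets borel"
    and [measurable]: "v \<in> borel_measurable borel"
  shows "conv (heat_mixture Q) v x = (\<integral>\<^sup>+ t. conv (\<lambda>x. ennreal (heat t x)) v x \<partial>Q)"
proof -
  interpret sigma_finite_measure Q by fact
  interpret pair_sigma_finite Q "lborel :: 'a measure" ..
  have "conv (heat_mixture Q) v x = (\<integral>\<^sup>+ y. (\<integral>\<^sup>+ t. ennreal (heat t (x - y)) * v y \<partial>Q) \<partial>lborel)"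
    by (simp add: conv_def heat_mixture_def nn_integral_multc)
  also have "\<dots> = (\<integral>\<^sup>+ t. (\<integral>\<^sup>+ y. ennreal (heat t (x - y)) * v y \<partial>lborel) \<partial>Q)"
    by (rule Fubini') measurable
  finally show ?thesis by (simp add: conv_def)
qed

lemma conv_heat_mixtures:
  fixes x :: "'a::euclidean_space"
  assumes Q: "sigma_finite_measure Q" and sQ [measurable_cong]: "sets Q = sets borel" and "AE t in Q. t > 0"
    and P: "sigma_finite_measure P" and sP [measurable_cong]: "sets P = sets borel" and pos: "AE t in P. t > 0"
  shows "conv (heat_mixture Q) (heat_mixture P) x = (\<integral>\<^sup>+ s. (\<integral>\<^sup>+ t. ennreal (heat (s + t) x) \<partial>P) \<partial>Q)"
proof -
  have "conv (heat_mixture Q) (heat_mixture P) x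
      = (\<integral>\<^sup>+ s. conv (heat_mixture P) (\<lambda>x. ennreal (heat s x)) x \<partial>Q)"
    by (subst conv_heat_mixture[OF Q sQ]) (auto simp: conv_commute[of "heat_mixture P"] sP)
  also have "\<dots> = (\<integral>\<^sup>+ s. (\<integral>\<^sup>+ t. conv (\<lambda>x. ennreal (heat t x)) (\<lambda>x. ennreal (heat s x)) x \<partial>P) \<partial>Q)"
    by (simp add: conv_heat_mixture[OF P sP])
  also have "\<dots> = (\<integral>\<^sup>+ s. (\<integral>\<^sup>+ t. ennreal (heat (s + t) x) \<partial>P) \<partial>Q)"
  proof (rule nn_integral_cong_AE, use assms(3) in eventually_elim)
    fix s :: real assume "s > 0"
    with pos show "(\<integral>\<^sup>+ t. conv (\<lambda>x. ennreal (heat t x)) (\<lambda>x. ennreal (heat s x)) x \<partial>P)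
        = (\<integral>\<^sup>+ t. ennreal (heat (s + t) x) \<partial>P)"
      by (intro nn_integral_cong_AE) (auto simp: conv_heat add.commute)
  qed
  finally show ?thesis .
qed

lemma conv_heat_mixture_dilated:
  fixes v :: "'a::euclidean_space \<Rightarrow> ennreal"
  assumes "prob_space Q" and [measurable_cong]: "sets Q = sets borel" and pos: "AE t in Q. t > 0"
    and [measurable]: "v \<in> borel_measurable borel" and T: "T > 0"
  shows "conv (heat_mixture (distr Q borel ((*) T))) v x =
    (\<integral>\<^sup>+ t. (\<integral>\<^sup>+ y. v (x - sqrt (T * t) *\<^sub>R y) * ennreal (heat 1 y) \<partial>lborel) \<partial>Q)"
proof -
  interpret Q: prob_space Q by fact
  interpret D: prob_space "distr Q borel ((*) T)" by (rule Q.prob_space_distr) simp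
  have "conv (heat_mixture (distr Q borel ((*) T))) v x
      = (\<integral>\<^sup>+ t. conv (\<lambda>x. ennreal (heat t x)) v x \<partial>distr Q borel ((*) T))"
    by (rule conv_heat_mixture) (auto intro: D.sigma_finite_measure_axioms)
  also have "\<dots> = (\<integral>\<^sup>+ t. conv v (\<lambda>x. ennreal (heat t x)) x \<partial>distr Q borel ((*) T))"
    by (simp add: conv_commute[of v])
  also have "\<dots> = (\<integral>\<^sup>+ t. conv v (\<lambda>x. ennreal (heat (T * t) x)) x \<partial>Q)"
    unfolding conv_def by (rule nn_integral_distr) measurable
  also have "\<dots> = (\<integral>\<^sup>+ t. (\<integral>\<^sup>+ y. v (x - sqrt (T * t) *\<^sub>R y) * ennreal (heat 1 y) \<partial>lborel) \<partial>Q)"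
  proof (rule nn_integral_cong_AE, use pos in eventually_elim)
    show "conv v (\<lambda>x. ennreal (heat (T * t) x)) x
        = (\<integral>\<^sup>+ y. v (x - sqrt (T * t) *\<^sub>R y) * ennreal (heat 1 y) \<partial>lborel)"
      if "t > 0" for t
      unfolding conv_def using that T by (intro nn_integral_heat_scale) auto
  qed
  finally show ?thesis .
qed

lemma AE_distr_mult_pos:
  fixes Q :: "real measure"
  assumes [measurable_cong]: "sets Q = sets borel" and "AE t in Q. t > 0" "T > 0"
  shows "AE t in distr Q borel ((*) T). t > 0"
  using assms(2,3) by (subst AE_distr_iff) auto

lemma nn_integral_heat_mixture_dilated:
  assumes "prob_space Q" and [measurable_cong]: "sets Q = sets borel" and pos: "AE t in Q. t > 0" and T: "T > 0"
  shows "(\<integral>\<^sup>+ x. heat_mixture (distr Q borel ((*) T)) (x::'a::euclidean_space) \<partial>lborel) = 1"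
proof -
  interpret Q: prob_space Q by fact
  interpret D: prob_space "distr Q borel ((*) T)" by (rule Q.prob_space_distr) simp
  show ?thesis
    using D.emeasure_space_1 AE_distr_mult_pos[OF assms(2) pos T]
    by (subst nn_integral_heat_mixture) (auto intro: D.sigma_finite_measure_axioms)
qed

lemma lsc_le_liminf_conv_heat_mixture:
  fixes v :: "'a::euclidean_space \<Rightarrow> ennreal"
  assumes Q: "prob_space Q" and sQ [measurable_cong]: "sets Q = sets borel" and pos: "AE t in Q. t > 0"
    and v: "lsc v" and T: "\<And>k. T k > 0" "T \<longlonglongrightarrow> 0"
  shows "v x \<le> liminf (\<lambda>k. conv (heat_mixture (distr Q borel ((*) (T k)))) v x)"
proof -
  interpret prob_space Q by fact
  note borel_measurable_lsc[OF v, measurable]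
  let ?w = "\<lambda>k t y. v (x - sqrt (T k * t) *\<^sub>R y)"
  have "v x \<le> liminf (\<lambda>k. ?w k t y)" for t y
  proof (rule lsc_le_Liminf[OF v])
    have "(\<lambda>k. x - sqrt (T k * t) *\<^sub>R y) \<longlonglongrightarrow> x - sqrt (0 * t) *\<^sub>R y" by (intro tendsto_intros T)
    then show "(\<lambda>k. x - sqrt (T k * t) *\<^sub>R y) \<longlonglongrightarrow> x" by simp
  qed
  then have "v x * ennreal (heat 1 y) \<le> liminf (\<lambda>k. ?w k t y * ennreal (heat 1 y))" for t and y :: 'a
    using liminf_cmult_ennreal[of "ennreal (heat 1 y)" "\<lambda>k. ?w k t y" for t y]
    by (simp add: mult.commute[of _ "ennreal _"] mult_left_mono)
  then have "v x * (\<integral>\<^sup>+ y. ennreal (heat 1 (y :: 'a)) \<partial>lborel)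
      \<le> (\<integral>\<^sup>+ y. liminf (\<lambda>k. ?w k t y * ennreal (heat 1 y)) \<partial>lborel)" for t
    by (subst nn_integral_cmult[symmetric]) (auto intro!: nn_integral_mono)
  also have "\<dots> t \<le> liminf (\<lambda>k. \<integral>\<^sup>+ y. ?w k t y * ennreal (heat 1 y) \<partial>lborel)" for t
    by (rule nn_integral_liminf) measurable
  finally have "(\<integral>\<^sup>+ t. v x \<partial>Q) \<le> (\<integral>\<^sup>+ t. liminf (\<lambda>k. \<integral>\<^sup>+ y. ?w k t y * ennreal (heat 1 y) \<partial>lborel) \<partial>Q)"
    by (intro nn_integral_mono) (simp add: nn_integral_heat)
  also have "\<dots> \<le> liminf (\<lambda>k. \<integral>\<^sup>+ t. (\<integral>\<^sup>+ y. ?w k t y * ennreal (heat 1 y) \<partial>lborel) \<partial>Q)"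
    by (rule nn_integral_liminf) measurable
  finally show ?thesis
    using T(1) by (simp add: conv_heat_mixture_dilated[OF Q sQ pos] emeasure_space_1)
qed

lemma tendsto_conv_heat_mixture:
  fixes v :: "'a::euclidean_space \<Rightarrow> ennreal"
  assumes Q: "prob_space Q" "sets Q = sets borel" "AE t in Q. t > 0"
    and v: "continuous_on UNIV v" "\<And>x. v x \<le> C" "C < \<infinity>" and T: "\<And>k. T k > 0" "T \<longlonglongrightarrow> 0"
  shows "(\<lambda>k. conv (heat_mixture (distr Q borel ((*) (T k)))) v x) \<longlonglongrightarrow> v x"
proof (rule tendsto_of_liminf_complement)
  let ?q = "\<lambda>k. heat_mixture (distr Q borel ((*) (T k))) :: 'a \<Rightarrow> ennreal"
  have [measurable]: "v \<in> borel_measurable borel" by (rule borel_measurable_continuous_onI[OF v(1)])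
  have fin: "v x \<noteq> \<top>" for x using le_less_trans[OF v(2,3), of x] by simp
  have lsc: "lsc v" "lsc (\<lambda>x. C - v x)"
    using v fin unfolding lsc_def by (auto intro!: open_Collect_less continuous_intros continuous_on_diff_ennreal)
  show "v x \<le> liminf (\<lambda>k. conv (?q k) v x)" "C - v x \<le> liminf (\<lambda>k. conv (?q k) (\<lambda>x. C - v x) x)"
    by (rule lsc_le_liminf_conv_heat_mixture[OF Q _ T], rule lsc)+
  show "conv (?q k) v x + conv (?q k) (\<lambda>x. C - v x) x = C" for k
    using v(2) T(1)
    by (subst conv_add_right[symmetric])
      (auto simp: add_diff_inverse_ennreal conv_const nn_integral_heat_mixture_dilated[OF Q])
qed (use v in \<open>auto simp: add_diff_inverse_ennreal\<close>)

lemma kernel_energy_heat: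
  fixes l \<nu> :: "'a::euclidean_space measure"
  assumes l: "sigma_finite_measure l" "sets l = sets borel" and nu: "sigma_finite_measure \<nu>" "sets \<nu> = sets borel"
  shows "kernel_energy (\<lambda>x. ennreal (heat t x)) l \<nu> =
    (\<integral>\<^sup>+ z. conv_measure (\<lambda>x. ennreal (heat (t / 2) x)) l z * conv_measure (\<lambda>x. ennreal (heat (t / 2) x)) \<nu> z \<partial>lborel)"
proof (cases "t > 0")
  case True
  let ?h = "\<lambda>x::'a. ennreal (heat (t / 2) x)"
  have "(\<lambda>x::'a. ennreal (heat t x)) = conv ?h ?h"
    using True by (auto simp: fun_eq_iff conv_heat)
  then have "conv_measure (\<lambda>x. ennreal (heat t x)) l = conv ?h (conv_measure ?h l)"
    using l by (simp add: conv_conv_measure)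
  then show ?thesis
    using l nu by (simp add: kernel_energy_def nn_integral_conv_dual heat_minus mult.commute)
qed (simp add: kernel_energy_def conv_measure_def)

lemma quadratic_form_ineq_ennreal:
  fixes a b b' :: ennreal assumes s: "s > (0::real)"
  shows "2 * (a * b) + ennreal (2 / s) * (b * b') \<le>
     2 * (a * b') + ennreal s * (a * a) + ennreal (1 / s) * (b * b + b' * b')"
proof (cases "a = \<top> \<or> b = \<top> \<or> b' = \<top>")
  case True
  then have "2 * (a * b') + ennreal s * (a * a) + ennreal (1 / s) * (b * b + b' * b') = \<top>"
    using s by (auto simp: ennreal_mult_top ennreal_top_mult ennreal_mult_eq_top_iff)
  then show ?thesis by (simp only: top_greatest)
next
  case False
  then obtain x y z where reals: "a = ennreal x" "b = ennreal y" "b' = ennreal z" "x \<ge> 0" "y \<ge> 0" "z \<ge> 0"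
    by (metis ennreal_cases)
  have "0 \<le> (s * x - (y - z))\<^sup>2 / s" using s by simp
  also have "\<dots> = s * (x * x) + (1 / s) * (y * y + z * z) + 2 * (x * z) - 2 * (x * y) - (2 / s) * (y * z)"
    using s by (simp add: field_simps power2_eq_square)
  finally have "2 * (x * y) + (2 / s) * (y * z) \<le> 2 * (x * z) + s * (x * x) + (1 / s) * (y * y + z * z)"
    by simp
  moreover have "2 * ennreal u = ennreal (2 * u)" if "u \<ge> 0" for u using that by (simp add: ennreal_mult)
  ultimately show ?thesis using s reals
    by (simp add: ennreal_mult[symmetric] ennreal_plus[symmetric] del: ennreal_plus ennreal_numeral)
qed

lemma kernel_energy_heat_ineq:
  fixes l \<nu> \<nu>' :: "'a::euclidean_space measure" and t :: real
  assumes s: "s > 0" and l: "sigma_finite_measure l" "sets l = sets borel"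
    and nu: "sigma_finite_measure \<nu>" "sets \<nu> = sets borel"
    and "sigma_finite_measure \<nu>'" "sets \<nu>' = sets borel"
  defines "E \<equiv> kernel_energy (\<lambda>x. ennreal (heat t x))"
  shows "2 * E l \<nu> + ennreal (2 / s) * E \<nu> \<nu>'
      \<le> 2 * E l \<nu>' + ennreal s * E l l + ennreal (1 / s) * (E \<nu> \<nu> + E \<nu>' \<nu>')"
proof -
  define F where "F = conv_measure (\<lambda>x::'a. ennreal (heat (t / 2) x))"
  have [measurable]: "F l \<in> borel_measurable borel" "F \<nu> \<in> borel_measurable borel" "F \<nu>' \<in> borel_measurable borel"
    using assms unfolding F_def by (auto intro!: measurable_conv_measure)
  have E: "E m m' = (\<integral>\<^sup>+ z. F m z * F m' z \<partial>lborel)" if "m \<in> {l, \<nu>, \<nu>'}" "m' \<in> {l, \<nu>, \<nu>'}" for m m'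
    unfolding E_def F_def using that assms by (intro kernel_energy_heat) auto
  have "2 * E l \<nu> + ennreal (2 / s) * E \<nu> \<nu>'
      = (\<integral>\<^sup>+ z. 2 * (F l z * F \<nu> z) + ennreal (2 / s) * (F \<nu> z * F \<nu>' z) \<partial>lborel)"
    by (simp add: E nn_integral_add nn_integral_cmult)
  also have "\<dots> \<le> (\<integral>\<^sup>+ z. 2 * (F l z * F \<nu>' z) + ennreal s * (F l z * F l z)
      + ennreal (1 / s) * (F \<nu> z * F \<nu> z + F \<nu>' z * F \<nu>' z) \<partial>lborel)"
    by (intro nn_integral_mono quadratic_form_ineq_ennreal s)
  also have "\<dots> = 2 * E l \<nu>' + ennreal s * E l l + ennreal (1 / s) * (E \<nu> \<nu> + E \<nu>' \<nu>')"
    by (simp add: E nn_integral_add nn_integral_cmult)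
  finally show ?thesis .
qed

lemma measurable_kernel_energy_heat [measurable]:
  fixes l \<nu> :: "'a::euclidean_space measure"
  assumes "sigma_finite_measure l" and [measurable_cong]: "sets l = sets borel"
    and "sigma_finite_measure \<nu>" and [measurable_cong]: "sets \<nu> = sets borel"
  shows "(\<lambda>t. kernel_energy (\<lambda>x. ennreal (heat t x)) l \<nu>) \<in> borel_measurable borel"
proof -
  interpret L: sigma_finite_measure l by fact
  interpret N: sigma_finite_measure \<nu> by fact
  show ?thesis unfolding kernel_energy_def conv_measure_def by measurable
qed

lemma kernel_energy_heat_mixture:
  fixes l \<nu> :: "'a::euclidean_space measure"
  assumes "sigma_finite_measure Q" and [measurable_cong]: "sets Q = sets borel"
    and "sigma_finite_measure l" and [measurable_cong]: "sets l = sets borel"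
    and "sigma_finite_measure \<nu>" and [measurable_cong]: "sets \<nu> = sets borel"
  shows "kernel_energy (heat_mixture Q) l \<nu> = (\<integral>\<^sup>+ t. kernel_energy (\<lambda>x. ennreal (heat t x)) l \<nu> \<partial>Q)"
proof -
  interpret Q: sigma_finite_measure Q by fact
  interpret L: sigma_finite_measure l by fact
  interpret N: sigma_finite_measure \<nu> by fact
  interpret QL: pair_sigma_finite Q l ..
  interpret QN: pair_sigma_finite Q \<nu> ..
  have "kernel_energy (heat_mixture Q) l \<nu> = (\<integral>\<^sup>+ x. (\<integral>\<^sup>+ t. (\<integral>\<^sup>+ y. ennreal (heat t (x - y)) \<partial>l) \<partial>Q) \<partial>\<nu>)"
    unfolding kernel_energy_def conv_measure_def heat_mixture_def
    by (intro nn_integral_cong QL.Fubini') measurable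
  also have "\<dots> = (\<integral>\<^sup>+ t. (\<integral>\<^sup>+ x. (\<integral>\<^sup>+ y. ennreal (heat t (x - y)) \<partial>l) \<partial>\<nu>) \<partial>Q)"
    by (rule QN.Fubini') measurable
  finally show ?thesis by (simp add: kernel_energy_def conv_measure_def)
qed

text \<open>Positive definiteness: the inequality expands \<open>\<parallel>s l - (\<nu> - \<nu>')\<parallel>\<^sup>2 \<ge> 0\<close> with all terms moved so
  that no difference of possibly infinite energies occurs.\<close>

lemma kernel_energy_heat_mixture_ineq:
  fixes l \<nu> \<nu>' :: "'a::euclidean_space measure"
  assumes s: "s > 0" and Q: "sigma_finite_measure Q" "sets Q = sets borel"
    and l: "sigma_finite_measure l" "sets l = sets borel"
    and nu: "sigma_finite_measure \<nu>" "sets \<nu> = sets borel"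
    and "sigma_finite_measure \<nu>'" "sets \<nu>' = sets borel"
  defines "E \<equiv> kernel_energy (heat_mixture Q)"
  shows "2 * E l \<nu> + ennreal (2 / s) * E \<nu> \<nu>'
      \<le> 2 * E l \<nu>' + ennreal s * E l l + ennreal (1 / s) * (E \<nu> \<nu> + E \<nu>' \<nu>')"
proof -
  note Q(2)[measurable_cong]
  define H where "H = (\<lambda>m m' t. kernel_energy (\<lambda>x::'a. ennreal (heat t x)) m m')"
  have [measurable]: "H m m' \<in> borel_measurable borel" and E: "E m m' = (\<integral>\<^sup>+ t. H m m' t \<partial>Q)"
    if "m \<in> {l, \<nu>, \<nu>'}" "m' \<in> {l, \<nu>, \<nu>'}" for m m'
    unfolding E_def H_def using that assms
    by (auto intro!: kernel_energy_heat_mixture measurable_kernel_energy_heat)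
  have "2 * E l \<nu> + ennreal (2 / s) * E \<nu> \<nu>' = (\<integral>\<^sup>+ t. 2 * H l \<nu> t + ennreal (2 / s) * H \<nu> \<nu>' t \<partial>Q)"
    by (simp add: E nn_integral_add nn_integral_cmult)
  also have "\<dots> \<le> (\<integral>\<^sup>+ t. 2 * H l \<nu>' t + ennreal s * H l l t + ennreal (1 / s) * (H \<nu> \<nu> t + H \<nu>' \<nu>' t) \<partial>Q)"
    unfolding H_def by (intro nn_integral_mono kernel_energy_heat_ineq assms)
  also have "\<dots> = 2 * E l \<nu>' + ennreal s * E l l + ennreal (1 / s) * (E \<nu> \<nu> + E \<nu>' \<nu>')"
    by (simp add: E nn_integral_add nn_integral_cmult)
  finally show ?thesis .
qed

section \<open>Power laws and the arcsine law\<close>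

definition power_law :: "real \<Rightarrow> real \<Rightarrow> real set \<Rightarrow> real measure" where
  "power_law c b S = density lborel (\<lambda>t. ennreal (c * t powr (b - 1)) * indicator S t)"

lemma sets_power_law [simp, measurable_cong]: "sets (power_law c b S) = sets borel"
  by (simp add: power_law_def)

lemma space_power_law [simp]: "space (power_law c b S) = UNIV"
  by (simp add: power_law_def)

lemma nn_integral_power_law:
  assumes [measurable]: "f \<in> borel_measurable borel" "S \<in> sets borel"
  shows "(\<integral>\<^sup>+ t. f t \<partial>power_law c b S) = (\<integral>\<^sup>+ t. ennreal (c * t powr (b - 1)) * indicator S t * f t \<partial>lborel)"
  unfolding power_law_def by (rule nn_integral_density) measurable

lemma sigma_finite_power_law: "S \<in> sets borel \<Longrightarrow> sigma_finite_measure (power_law c b S)"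
  unfolding power_law_def
  by (subst sigma_finite_measure.sigma_finite_iff_density_finite[OF sigma_finite_lborel])
    (auto split: split_indicator)

lemma AE_power_law_pos: "S \<in> sets borel \<Longrightarrow> S \<subseteq> {0<..} \<Longrightarrow> AE t in power_law c b S. t > 0"
  unfolding power_law_def by (subst AE_density) (auto split: split_indicator)

lemma nn_integral_power_law_scale:
  assumes [measurable]: "f \<in> borel_measurable borel" "S \<in> sets borel" and c: "c \<ge> 0" and r: "r > 0"
  shows "(\<integral>\<^sup>+ t. f t \<partial>power_law c b S) = ennreal (r powr b) * (\<integral>\<^sup>+ t. f (r * t) \<partial>power_law c b ((*) r -` S))"
proof -
  have [measurable]: "(*) r -` S \<in> sets borel"
    using measurable_sets[of "(*) r" borel borel S] by simp
  have "(\<integral>\<^sup>+ t. f t \<partial>power_law c b S)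
      = ennreal r * (\<integral>\<^sup>+ t. ennreal (c * (0 + r * t) powr (b - 1)) * indicator S (0 + r * t) * f (0 + r * t) \<partial>lborel)"
    using r by (subst nn_integral_power_law, simp, simp, subst nn_integral_real_affine[of _ r 0]) auto
  also have "\<dots> = (\<integral>\<^sup>+ t. ennreal (r powr b) * (ennreal (c * t powr (b - 1)) * indicator ((*) r -` S) t * f (r * t)) \<partial>lborel)"
  proof (subst nn_integral_cmult[symmetric], measurable, intro nn_integral_cong)
    fix t
    have "r * (c * (r * t) powr (b - 1)) = r powr b * (c * t powr (b - 1))"
      using r powr_mult_base[of r "b - 1"] by (simp add: powr_mult mult_ac)
    then have "ennreal r * ennreal (c * (r * t) powr (b - 1)) = ennreal (r powr b) * ennreal (c * t powr (b - 1))"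
      using r c by (simp add: ennreal_mult[symmetric])
    then show "ennreal r * (ennreal (c * (0 + r * t) powr (b - 1)) * indicator S (0 + r * t) * f (0 + r * t))
        = ennreal (r powr b) * (ennreal (c * t powr (b - 1)) * indicator ((*) r -` S) t * f (r * t))"
      by (simp add: mult.assoc[symmetric] split: split_indicator)
  qed
  also have "\<dots> = ennreal (r powr b) * (\<integral>\<^sup>+ t. f (r * t) \<partial>power_law c b ((*) r -` S))"
    by (simp add: nn_integral_cmult nn_integral_power_law)
  finally show ?thesis .
qed

lemma emeasure_power_law:
  assumes "b > 0" "c \<ge> 0" "T > 0"
  shows "emeasure (power_law c b {0<..T}) UNIV = ennreal (c * (T powr b / b))"
proof -
  have "emeasure (power_law c b {0<..T}) UNIV = (\<integral>\<^sup>+ t. ennreal (c * t powr (b - 1)) * indicator {0..T} t \<partial>lborel)"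
    unfolding power_law_def by (subst emeasure_density) (auto intro!: nn_integral_cong split: split_indicator)
  also have "\<dots> = ennreal (c * (T powr b / b))"
    using assms has_integral_mult_right[OF has_integral_powr_from_0[of "b - 1" T], of c]
    by (intro nn_integral_has_integral_lebesgue') auto
  finally show ?thesis .
qed

text \<open>The point mass is the limit of the beta distributions as \<open>b\<close> tends to 1.\<close>

definition arcsine_law :: "real \<Rightarrow> real measure" where
  "arcsine_law b = (if b = 1 then return borel 1 else
     density lborel (\<lambda>y. ennreal (y powr (b - 1) * (1 - y) powr (- b) / Beta b (1 - b)) * indicator {0<..<1} y))"

lemma sets_arcsine_law [simp, measurable_cong]: "sets (arcsine_law b) = sets borel"
  by (simp add: arcsine_law_def)

lemma Beta_pos: "0 < a \<Longrightarrow> 0 < b \<Longrightarrow> 0 < Beta a (b :: real)"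
  unfolding Beta_def by (intro divide_pos_pos mult_pos_pos Gamma_real_pos) auto

lemma nn_integral_beta:
  assumes "0 < b" "b < 1"
  shows "(\<integral>\<^sup>+ y. ennreal (y powr (b - 1) * (1 - y) powr (- b)) * indicator {0<..<1} y \<partial>lborel)
      = ennreal (Beta b (1 - b))"
proof -
  have "(\<integral>\<^sup>+ y. ennreal (y powr (b - 1) * (1 - y) powr (- b)) * indicator {0<..<1} y \<partial>lborel)
      = (\<integral>\<^sup>+ y. ennreal (y powr (b - 1) * (1 - y) powr (1 - b - 1)) * indicator {0..1} y \<partial>lborel)"
    by (intro nn_integral_cong) (auto split: split_indicator)
  also have "\<dots> = ennreal (Beta b (1 - b))"
    using assms has_integral_Beta_real[of b "1 - b"] by (intro nn_integral_has_integral_lebesgue') auto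
  finally show ?thesis .
qed

lemma nn_integral_beta_affine:
  assumes b: "0 < b" "b < 1" and t: "0 < T" "T < t"
  shows "(\<integral>\<^sup>+ y. ennreal ((t * y - T) powr (b - 1) * (1 - y) powr (- b)) * indicator {T / t<..<1} y \<partial>lborel)
    = ennreal (t powr (b - 1) * Beta b (1 - b))" (is "?I = _")
proof -
  define u where "u = 1 - T / t"
  have u: "u > 0" using t by (simp add: u_def)
  have "?I = ennreal \<bar>u\<bar> * (\<integral>\<^sup>+ z. ennreal ((t * (T / t + u * z) - T) powr (b - 1) * (1 - (T / t + u * z)) powr (- b))
           * indicator {T / t<..<1} (T / t + u * z) \<partial>lborel)"
    using u by (intro nn_integral_real_affine) auto
  also have "\<dots> = (\<integral>\<^sup>+ z. ennreal (t powr (b - 1)) * (ennreal (z powr (b - 1) * (1 - z) powr (- b)) * indicator {0<..<1} z) \<partial>lborel)"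
  proof (subst nn_integral_cmult[symmetric], measurable, intro nn_integral_cong)
    fix z :: real
    have "1 - (T / t + u * z) = u * (1 - z)" by (simp add: u_def algebra_simps diff_divide_distrib)
    moreover have "t * (T / t + u * z) - T = t * u * z" using t by (simp add: field_simps)
    moreover have "T / t + u * z \<in> {T / t<..<1} \<longleftrightarrow> z \<in> {0<..<1}"
      using u calculation(1) by (simp add: zero_less_mult_iff) (metis diff_gt_0_iff_gt u zero_less_mult_iff less_asym)
    moreover have "u * ((t * u * z) powr (b - 1) * (u * (1 - z)) powr (- b))
        = t powr (b - 1) * (z powr (b - 1) * (1 - z) powr (- b))"
    proof -
      have "u * (u powr (b - 1) * u powr (- b)) = 1" using u by (simp add: powr_diff powr_minus)
      then show ?thesis by (simp add: powr_mult mult_ac)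
    qed
    ultimately show "ennreal \<bar>u\<bar> * (ennreal ((t * (T / t + u * z) - T) powr (b - 1) * (1 - (T / t + u * z)) powr (- b))
        * indicator {T / t<..<1} (T / t + u * z))
      = ennreal (t powr (b - 1)) * (ennreal (z powr (b - 1) * (1 - z) powr (- b)) * indicator {0<..<1} z)"
      using u by (auto simp: indicator_def ennreal_mult[symmetric])
  qed
  also have "\<dots> = ennreal (t powr (b - 1) * Beta b (1 - b))"
    using Beta_pos[of b "1 - b"] b by (simp add: nn_integral_cmult nn_integral_beta ennreal_mult[symmetric])
  finally show ?thesis .
qed

lemma prob_space_arcsine_law:
  assumes "0 < b" "b \<le> 1" shows "prob_space (arcsine_law b)"
proof (cases "b = 1")
  case True then show ?thesis by (simp add: arcsine_law_def prob_space_return)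
next
  case False
  then have b: "0 < b" "b < 1" "Beta b (1 - b) > 0" using assms Beta_pos[of b "1 - b"] by auto
  have "(\<integral>\<^sup>+ y. ennreal (y powr (b - 1) * (1 - y) powr (- b) / Beta b (1 - b)) * indicator {0<..<1} y \<partial>lborel)
      = (\<integral>\<^sup>+ y. ennreal (1 / Beta b (1 - b)) * (ennreal (y powr (b - 1) * (1 - y) powr (- b)) * indicator {0<..<1} y) \<partial>lborel)"
    using b by (intro nn_integral_cong) (auto simp: ennreal_mult[symmetric] split: split_indicator)
  also have "\<dots> = 1" using b by (simp add: nn_integral_cmult nn_integral_beta ennreal_mult[symmetric])
  finally show ?thesis using False by (intro prob_spaceI) (simp add: arcsine_law_def emeasure_density)
qed

lemma AE_arcsine_law: "AE y in arcsine_law b. 0 < y \<and> y \<le> 1"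
proof (cases "b = 1")
  case True then show ?thesis
    unfolding arcsine_law_def if_P[OF True] by (subst AE_return) auto
next
  case False then show ?thesis
    unfolding arcsine_law_def by (simp del: AE_conj_iff) (subst AE_density, auto split: split_indicator)
qed

lemma nn_integral_arcsine_law_power_less:
  assumes b: "0 < b" "b < 1" and T: "0 < T" "T < t"
  shows "(\<integral>\<^sup>+ y. ennreal ((t - T / y) powr (b - 1)) * indicator {y. T / y < t} y \<partial>arcsine_law b)
      = ennreal (t powr (b - 1))"
proof -
  have B: "Beta b (1 - b) > 0" using b Beta_pos[of b "1 - b"] by auto
  have density: "arcsine_law b = density lborel
      (\<lambda>y. ennreal (y powr (b - 1) * (1 - y) powr (- b) / Beta b (1 - b)) * indicator {0<..<1} y)"
    using b by (simp add: arcsine_law_def)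
  have "(\<integral>\<^sup>+ y. ennreal ((t - T / y) powr (b - 1)) * indicator {y. T / y < t} y \<partial>arcsine_law b)
      = (\<integral>\<^sup>+ y. ennreal (1 / Beta b (1 - b)) *
          (ennreal ((t * y - T) powr (b - 1) * (1 - y) powr (- b)) * indicator {T / t<..<1} y) \<partial>lborel)"
    unfolding density
  proof (subst nn_integral_density, measurable, intro nn_integral_cong)
    fix y :: real
    have "T / t > 0" "t > 0" using T by simp_all
    then have "y \<in> {0<..<1} \<and> T / y < t \<longleftrightarrow> y \<in> {T / t<..<1}"
      using T by (cases "y > 0") (auto simp: pos_divide_less_eq mult.commute zero_less_mult_iff dest: less_trans[OF T(1)])
    moreover have "y powr (b - 1) * (t - T / y) powr (b - 1) = (t * y - T) powr (b - 1)" if "y > 0"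
      using that by (simp add: powr_mult[symmetric] right_diff_distrib mult.commute)
    ultimately show "ennreal (y powr (b - 1) * (1 - y) powr (- b) / Beta b (1 - b)) * indicator {0<..<1} y *
        (ennreal ((t - T / y) powr (b - 1)) * indicator {y. T / y < t} y)
      = ennreal (1 / Beta b (1 - b)) * (ennreal ((t * y - T) powr (b - 1) * (1 - y) powr (- b)) * indicator {T / t<..<1} y)"
      using B T by (auto simp: indicator_def ennreal_mult[symmetric] mult_ac)
  qed
  also have "\<dots> = ennreal (t powr (b - 1))"
    using b T B by (subst nn_integral_cmult) (auto simp: nn_integral_beta_affine ennreal_mult[symmetric])
  finally show ?thesis .
qed

lemma nn_integral_arcsine_law_power:
  assumes b: "0 < b" "b \<le> 1" and T: "T > 0"
  shows "(\<integral>\<^sup>+ y. ennreal ((t - T / y) powr (b - 1)) * indicator {y. T / y < t} y \<partial>arcsine_law b)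
    = ennreal (t powr (b - 1)) * indicator {T<..} t"
proof (cases "b < 1 \<and> T < t")
  case True
  then show ?thesis using nn_integral_arcsine_law_power_less[of b T t] b T by simp
next
  case False
  have "AE y in arcsine_law b. ennreal ((t - T / y) powr (b - 1)) * indicator {y. T / y < t} y
      = ennreal (t powr (b - 1)) * indicator {T<..} t"
  proof (cases "b = 1")
    case True
    then show ?thesis
      using T unfolding arcsine_law_def if_P[OF True] by (subst AE_return) (auto split: split_indicator)
  next
    case b1: False
    show ?thesis using AE_arcsine_law[of b]
    proof eventually_elim
      case (elim y)
      then have "T \<le> T / y" using T by (simp add: field_simps)
      then show ?case using False b b1 by (auto split: split_indicator)
    qed
  qed
  then show ?thesis
    using prob_space.emeasure_space_1[OF prob_space_arcsine_law[OF b]] by (subst nn_integral_cong_AE) auto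
qed

text \<open>The law of the position of a \<open>b\<close>-stable subordinator, whose potential measure is a multiple of \<open>t\<^bsup>b-1\<^esup> dt\<close>,
  at its first passage above level 1.\<close>

definition passage_law :: "real \<Rightarrow> real measure" where
  "passage_law b = distr (arcsine_law b) borel (\<lambda>y. 1 / y)"

lemma sets_passage_law [simp, measurable_cong]: "sets (passage_law b) = sets borel"
  by (simp add: passage_law_def)

lemma prob_space_passage_law: "0 < b \<Longrightarrow> b \<le> 1 \<Longrightarrow> prob_space (passage_law b)"
  unfolding passage_law_def by (intro prob_space.prob_space_distr prob_space_arcsine_law) auto

lemma AE_passage_law_pos: "AE t in passage_law b. t > 0"
  unfolding passage_law_def using AE_arcsine_law[of b] by (subst AE_distr_iff) (auto elim: eventually_mono)

lemma nn_integral_power_law_passage: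
  assumes [measurable]: "f \<in> borel_measurable borel" and b: "0 < b" "b \<le> 1" and c: "c \<ge> 0" and T: "T > 0"
  shows "(\<integral>\<^sup>+ s. (\<integral>\<^sup>+ t. f (s + t) \<partial>distr (passage_law b) borel ((*) T)) \<partial>power_law c b {0<..})
    = (\<integral>\<^sup>+ t. f t \<partial>power_law c b {T<..})"
proof -
  interpret A: prob_space "arcsine_law b" by (rule prob_space_arcsine_law[OF b])
  interpret P: sigma_finite_measure "power_law c b {0<..}" by (rule sigma_finite_power_law) simp
  interpret AP: pair_sigma_finite "arcsine_law b" "power_law c b {0<..}" ..
  interpret AL: pair_sigma_finite "arcsine_law b" "lborel :: real measure" ..
  let ?w = "\<lambda>t. ennreal (c * t powr (b - 1)) * indicator {0<..} t"
  have "(\<integral>\<^sup>+ s. (\<integral>\<^sup>+ t. f (s + t) \<partial>distr (passage_law b) borel ((*) T)) \<partial>power_law c b {0<..})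
      = (\<integral>\<^sup>+ s. (\<integral>\<^sup>+ y. f (s + T / y) \<partial>arcsine_law b) \<partial>power_law c b {0<..})"
    by (simp add: passage_law_def distr_distr nn_integral_distr)
  also have "\<dots> = (\<integral>\<^sup>+ y. (\<integral>\<^sup>+ s. f (s + T / y) \<partial>power_law c b {0<..}) \<partial>arcsine_law b)"
    by (rule AP.Fubini') measurable
  also have "\<dots> = (\<integral>\<^sup>+ y. (\<integral>\<^sup>+ t. ?w (t - T / y) * f t \<partial>lborel) \<partial>arcsine_law b)"
  proof (rule nn_integral_cong)
    fix y
    show "(\<integral>\<^sup>+ s. f (s + T / y) \<partial>power_law c b {0<..}) = (\<integral>\<^sup>+ t. ?w (t - T / y) * f t \<partial>lborel)"
      using nn_integral_lborel_shift[of "\<lambda>t. ?w (t - T / y) * f t" "T / y"] by (simp add: nn_integral_power_law)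
  qed
  also have "\<dots> = (\<integral>\<^sup>+ t. (\<integral>\<^sup>+ y. ?w (t - T / y) * f t \<partial>arcsine_law b) \<partial>lborel)"
    by (rule AL.Fubini'[symmetric]) measurable
  also have "\<dots> = (\<integral>\<^sup>+ t. ennreal (c * t powr (b - 1)) * indicator {T<..} t * f t \<partial>lborel)"
  proof (rule nn_integral_cong)
    fix t
    have "(\<integral>\<^sup>+ y. ?w (t - T / y) * f t \<partial>arcsine_law b)
        = (\<integral>\<^sup>+ y. ennreal c * f t * (ennreal ((t - T / y) powr (b - 1)) * indicator {y. T / y < t} y) \<partial>arcsine_law b)"
      using c by (intro nn_integral_cong) (auto simp: ennreal_mult mult_ac split: split_indicator)
    also have "\<dots> = ennreal c * f t * (ennreal (t powr (b - 1)) * indicator {T<..} t)"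
      by (simp add: nn_integral_cmult nn_integral_arcsine_law_power[OF b T])
    finally show "(\<integral>\<^sup>+ y. ?w (t - T / y) * f t \<partial>arcsine_law b)
        = ennreal (c * t powr (b - 1)) * indicator {T<..} t * f t"
      using c by (simp add: ennreal_mult mult_ac)
  qed
  finally show ?thesis by (simp add: nn_integral_power_law)
qed

lemma nn_integral_power_law_cmult:
  assumes [measurable]: "f \<in> borel_measurable borel" "S \<in> sets borel" and k: "k \<ge> 0"
  shows "(\<integral>\<^sup>+ t. f t \<partial>power_law (k * c) b S) = ennreal k * (\<integral>\<^sup>+ t. f t \<partial>power_law c b S)"
  using k by (simp add: nn_integral_power_law nn_integral_cmult[symmetric] ennreal_mult' mult.assoc)

section \<open>The Riesz kernel as a heat mixture\<close>

lemma heat_mixture_power_law_scale: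
  fixes x :: "'a::euclidean_space"
  assumes "S \<in> sets borel" "c \<ge> 0" "r > 0"
  shows "heat_mixture (power_law c b S) (r *\<^sub>R x)
    = ennreal (r powr (2 * b - real DIM('a))) * heat_mixture (power_law c b ((*) (r\<^sup>2) -` S)) x"
proof -
  have "r\<^sup>2 powr b * r powr (- real DIM('a)) = r powr (2 * b - real DIM('a))"
    using assms(3) by (simp add: powr_powr powr_add[symmetric] flip: powr_numeral)
  then have weight: "ennreal (r\<^sup>2 powr b) * ennreal (r powr (- real DIM('a)))
      = ennreal (r powr (2 * b - real DIM('a)))"
    by (simp add: ennreal_mult[symmetric])
  show ?thesis
    unfolding weight[symmetric] mult.assoc using assms
    by (simp add: heat_mixture_def nn_integral_power_law_scale[of _ S c "r\<^sup>2"] heat_scale ennreal_mult nn_integral_cmult)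
qed

lemma heat_mixture_power_law_cmult:
  "k \<ge> 0 \<Longrightarrow> S \<in> sets borel \<Longrightarrow>
    heat_mixture (power_law (k * c) b S) x = ennreal k * heat_mixture (power_law c b S) x"
  unfolding heat_mixture_def by (rule nn_integral_power_law_cmult) auto

lemma nn_integral_power_law_heat_bound:
  fixes n :: real
  assumes "c \<ge> 0" "T > 0" "b < n / 2"
  shows "(\<integral>\<^sup>+ t. ennreal ((4 * pi * t) powr (- (n / 2))) \<partial>power_law c b {T<..})
    = ennreal (c * (4 * pi) powr (- (n / 2)) / (n / 2 - b) * T powr (b - n / 2))"
proof -
  define p where "p = n / 2 - b"
  have p: "p > 0" using assms by (simp add: p_def)
  define C where "C = c * (4 * pi) powr (- (n / 2))"
  have C: "C \<ge> 0" using assms(1) by (simp add: C_def)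
  have "c * t powr (b - 1) * (4 * pi * t) powr (- (n / 2)) = C * t powr (- p - 1)" for t
  proof -
    have "c * t powr (b - 1) * (4 * pi * t) powr (- (n / 2)) = C * (t powr (b - 1) * t powr (- (n / 2)))"
      by (simp add: C_def powr_mult)
    then show ?thesis by (simp add: p_def powr_add[symmetric] algebra_simps)
  qed
  then have "(\<integral>\<^sup>+ t. ennreal ((4 * pi * t) powr (- (n / 2))) \<partial>power_law c b {T<..})
      = (\<integral>\<^sup>+ t. ennreal (C * t powr (- p - 1)) * indicator {T<..} t \<partial>lborel)"
    using assms(1)
    by (simp add: nn_integral_power_law ennreal_mult''[symmetric] mult.commute[of _ "indicator _ _"] mult.assoc)
  also have "\<dots> = (\<integral>\<^sup>+ t. ennreal (C * t powr (- p - 1)) * indicator {T..} t \<partial>lborel)"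
    by (rule nn_integral_cong_AE, use AE_lborel_singleton[of T] in eventually_elim) (auto split: split_indicator)
  also have "\<dots> = ennreal (C * (T powr (- p) / p))"
    using p C assms(2) has_integral_mult_right[OF has_integral_powr_to_inf[of "- p - 1" T], of C]
    by (intro nn_integral_has_integral_lebesgue') auto
  finally show ?thesis by (simp add: C_def p_def)
qed

lemma AE_heat_le_power_law:
  fixes x :: "'a::euclidean_space"
  assumes "S \<in> sets borel" "S \<subseteq> {0<..}"
  shows "AE t in power_law c b S. ennreal (heat t x) \<le> ennreal ((4 * pi * t) powr (- (real DIM('a) / 2)))"
  using AE_power_law_pos[OF assms, of c b] by eventually_elim (intro ennreal_leI heat_le)

lemma heat_mixture_power_law_Ioi_le:
  fixes x :: "'a::euclidean_space"
  assumes "c \<ge> 0" "T > 0" "b < real DIM('a) / 2"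
  shows "heat_mixture (power_law c b {T<..}) x
    \<le> ennreal (c * (4 * pi) powr (- (real DIM('a) / 2)) / (real DIM('a) / 2 - b) * T powr (b - real DIM('a) / 2))"
  unfolding nn_integral_power_law_heat_bound[OF assms, symmetric] heat_mixture_def
  using assms(2) by (intro nn_integral_mono_AE AE_heat_le_power_law) auto

lemma continuous_on_heat_mixture_power_law_Ioi:
  assumes "c \<ge> 0" "T > 0" "b < real DIM('a) / 2"
  shows "continuous_on UNIV (heat_mixture (power_law c b {T<..}) :: 'a::euclidean_space \<Rightarrow> ennreal)"
proof (rule continuous_on_sequentiallyI)
  fix X and x :: 'a assume X: "X \<longlonglongrightarrow> x"
  show "(\<lambda>k. heat_mixture (power_law c b {T<..}) (X k)) \<longlonglongrightarrow> heat_mixture (power_law c b {T<..}) x"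
    unfolding heat_mixture_def
  proof (rule nn_integral_dominated_convergence[OF _ _ _ AE_heat_le_power_law])
    show "(\<integral>\<^sup>+ t. ennreal ((4 * pi * t) powr (- (real DIM('a) / 2))) \<partial>power_law c b {T<..}) < \<infinity>"
      by (simp add: nn_integral_power_law_heat_bound[OF assms])
  qed (use assms(2) in \<open>auto intro!: tendsto_ennrealI tendsto_heat X\<close>)
qed

lemma heat_mixture_power_law_mono:
  "S \<in> sets borel \<Longrightarrow> S' \<in> sets borel \<Longrightarrow> S \<subseteq> S' \<Longrightarrow>
    heat_mixture (power_law c b S) x \<le> heat_mixture (power_law c b S') x"
  by (auto simp: heat_mixture_def nn_integral_power_law intro!: nn_integral_mono split: split_indicator)

lemma heat_mixture_power_law_UN:
  assumes S: "\<And>k. S k \<in> sets borel" "incseq S"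
  shows "heat_mixture (power_law c b (\<Union>k. S k)) x = (SUP k. heat_mixture (power_law c b (S k)) x)"
proof -
  let ?f = "\<lambda>k t. ennreal (c * t powr (b - 1)) * indicator (S k) t * ennreal (heat t x)"
  have [measurable]: "S k \<in> sets borel" for k by (rule S)
  have "indicator (\<Union>k. S k) t = (SUP k. indicator (S k) t :: ennreal)" for t
    by (rule LIMSEQ_unique[OF LIMSEQ_indicator_incseq[OF S(2)] LIMSEQ_SUP])
      (use S(2) in \<open>auto simp: incseq_def split: split_indicator\<close>)
  then have "heat_mixture (power_law c b (\<Union>k. S k)) x = (\<integral>\<^sup>+ t. (SUP k. ?f k t) \<partial>lborel)"
    by (simp add: heat_mixture_def nn_integral_power_law SUP_mult_left_ennreal SUP_mult_right_ennreal)
  also have "\<dots> = (SUP k. \<integral>\<^sup>+ t. ?f k t \<partial>lborel)"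
    using S(2) by (intro nn_integral_monotone_convergence_SUP)
      (auto simp: incseq_def le_fun_def split: split_indicator)
  finally show ?thesis by (simp add: heat_mixture_def nn_integral_power_law)
qed

lemma heat_mixture_power_law_neq_0:
  assumes "c > 0" and [measurable]: "S \<in> sets borel" and "S \<subseteq> {0<..}" "{l<..<u} \<subseteq> S" "l < u"
  shows "heat_mixture (power_law c b S) x \<noteq> 0"
proof (rule heat_mixture_neq_0)
  show "AE t in power_law c b S. t > 0" using assms by (intro AE_power_law_pos) auto
  have "emeasure (power_law c b S) UNIV \<noteq> 0"
  proof
    assume "emeasure (power_law c b S) UNIV = 0"
    then have "AE t in lborel. ennreal (c * t powr (b - 1)) * indicator S t = 0"
      unfolding power_law_def by (simp add: emeasure_density nn_integral_0_iff_AE)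
    then have "AE t in lborel. t \<notin> {l<..<u}"
      by eventually_elim (use assms in \<open>auto simp: ennreal_eq_0_iff mult_le_0_iff split: split_indicator_asm\<close>)
    then have "emeasure lborel {l<..<u} = 0"
      by (subst (asm) AE_iff_measurable[of "{l<..<u}"]) auto
    then show False using assms(5) by simp
  qed
  then show "emeasure (power_law c b S) (space (power_law c b S)) \<noteq> 0" by simp
qed simp

lemma powr_heat_bounded:
  fixes x :: "'a::euclidean_space"
  assumes "x \<noteq> 0"
  obtains C where "C \<ge> 0" "\<And>t. 0 < t \<Longrightarrow> t \<le> 1 \<Longrightarrow> t powr a * heat t x \<le> C"
proof -
  define p where "p = real DIM('a) / 2 - a"
  define k where "k = Suc (nat \<lceil>p\<rceil>)"
  have k: "p \<le> real k" "k > 0" by (simp_all add: k_def) linarith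
  define C where "C = (4 * pi) powr (- (real DIM('a) / 2)) * (4 * real k / (norm x)\<^sup>2) ^ k"
  have C: "C \<ge> 0" by (simp add: C_def)
  have "t powr a * heat t x \<le> C" if t: "0 < t" "t \<le> 1" for t
  proof -
    define z where "z = (norm x)\<^sup>2 / (4 * t)"
    have z: "z > 0" using assms t by (simp add: z_def)
    have "(z / real k) ^ k \<le> (1 + z / real k) ^ k" using z k by (intro power_mono) auto
    also have "\<dots> \<le> exp z" using z k by (intro exp_ge_one_plus_x_over_n_power_n) auto
    finally have "exp (- z) \<le> (real k / z) ^ k"
      using z k by (simp add: exp_minus field_simps power_divide)
    also have "\<dots> = (4 * real k / (norm x)\<^sup>2) ^ k * t powr real k"
      using t by (simp add: z_def powr_realpow power_mult_distrib[symmetric] mult_ac)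
    finally have "(4 * pi * t) powr (- (real DIM('a) / 2)) * exp (- z)
        \<le> (4 * pi * t) powr (- (real DIM('a) / 2)) * ((4 * real k / (norm x)\<^sup>2) ^ k * t powr real k)"
      by (intro mult_left_mono) auto
    also have "\<dots> = C * t powr (real k - real DIM('a) / 2)"
      using powr_add[of t "real k" "- (real DIM('a) / 2)"] by (simp add: C_def powr_mult mult_ac)
    finally have "t powr a * heat t x \<le> t powr a * (C * t powr (real k - real DIM('a) / 2))"
      using t by (intro mult_left_mono) (auto simp: heat_eq z_def)
    also have "\<dots> = C * t powr (real k - p)"
      by (simp add: p_def powr_add[symmetric] algebra_simps)
    also have "\<dots> \<le> C * 1" using t k C by (intro mult_left_mono powr_le1) auto
    finally show ?thesis by simp
  qed
  then show ?thesis by (rule that[OF C])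
qed

lemma heat_mixture_power_law_Ioc_finite:
  fixes x :: "'a::euclidean_space"
  assumes "c \<ge> 0" "x \<noteq> 0"
  shows "heat_mixture (power_law c b {0<..1}) x < \<infinity>"
proof -
  obtain C where bound: "\<And>t. 0 < t \<Longrightarrow> t \<le> 1 \<Longrightarrow> t powr (b - 1) * heat t x \<le> C"
    using powr_heat_bounded[OF assms(2)] by metis
  have "heat_mixture (power_law c b {0<..1}) x
      = (\<integral>\<^sup>+ t. ennreal (c * t powr (b - 1)) * indicator {0<..1} t * ennreal (heat t x) \<partial>lborel)"
    unfolding heat_mixture_def by (rule nn_integral_power_law) measurable
  also have "\<dots> \<le> (\<integral>\<^sup>+ t. ennreal (c * C) * indicator {0<..1::real} t \<partial>lborel)"
    using bound assms(1)
    by (intro nn_integral_mono)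
      (auto simp: ennreal_mult''[symmetric] mult.assoc intro!: ennreal_leI mult_left_mono split: split_indicator)
  also have "\<dots> < \<infinity>" by (subst nn_integral_cmult_indicator) auto
  finally show ?thesis .
qed

lemma heat_mixture_power_law_split:
  fixes x :: "'a::euclidean_space"
  assumes "T \<ge> 0"
  shows "heat_mixture (power_law c b {0<..}) x
    = heat_mixture (power_law c b {0<..T}) x + heat_mixture (power_law c b {T<..}) x"
proof -
  have "indicator {0<..} t = (indicator {0<..T} t + indicator {T<..} t :: ennreal)" for t
    using assms by (auto split: split_indicator)
  then show ?thesis
    by (simp add: heat_mixture_def nn_integral_power_law nn_integral_add[symmetric] distrib_left distrib_right)
qed

lemma heat_mixture_power_law_homogeneous:
  fixes x :: "'a::euclidean_space"
  assumes "c \<ge> 0" "r > 0"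
  shows "heat_mixture (power_law c b {0<..}) (r *\<^sub>R x)
    = ennreal (r powr (2 * b - real DIM('a))) * heat_mixture (power_law c b {0<..}) x"
proof -
  have "(*) (r\<^sup>2) -` {0<..} = {0<..}" using assms by (auto simp: zero_less_mult_iff)
  then show ?thesis using assms by (simp add: heat_mixture_power_law_scale)
qed

lemma heat_mixture_power_law_finite:
  fixes x :: "'a::euclidean_space"
  assumes "c \<ge> 0" "b < real DIM('a) / 2" "x \<noteq> 0"
  shows "heat_mixture (power_law c b {0<..}) x < \<infinity>"
proof -
  have "heat_mixture (power_law c b {1<..}) x < \<infinity>"
    using heat_mixture_power_law_Ioi_le[of c 1 b x] assms by (simp add: le_less_trans)
  then show ?thesis
    using heat_mixture_power_law_Ioc_finite[OF assms(1,3)] by (simp add: heat_mixture_power_law_split[of 1])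
qed

lemma heat_mixture_power_law_0:
  assumes "c > 0" "b < real DIM('a) / 2"
  shows "heat_mixture (power_law c b {0<..}) (0 :: 'a::euclidean_space) = \<infinity>" (is "?M = _")
proof (rule ccontr)
  assume "?M \<noteq> \<infinity>"
  moreover have "?M \<noteq> 0" using assms by (intro heat_mixture_power_law_neq_0[where l=0 and u=1]) auto
  ultimately obtain m where m: "?M = ennreal m" "m > 0"
    by (cases ?M) (auto simp: less_eq_real_def)
  have "ennreal m = ennreal (2 powr (2 * b - real DIM('a)) * m)"
    using heat_mixture_power_law_homogeneous[of c 2 b "0 :: 'a"] assms m by (simp add: ennreal_mult)
  then have "m = 2 powr (2 * b - real DIM('a)) * m" using m(2) by simp
  moreover have "2 powr (2 * b - real DIM('a)) < 1" using assms by (intro powr_less_one) auto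
  ultimately show False using m(2) by simp
qed

lemma riesz_kernel_heat_mixture:
  assumes "\<alpha> < real DIM('a::euclidean_space)"
  obtains c where "c > 0" "\<And>x::'a. riesz_kernel \<alpha> x 0 = heat_mixture (power_law c (\<alpha> / 2) {0<..}) x"
proof -
  define M where "M = (heat_mixture (power_law 1 (\<alpha> / 2) {0<..}) :: 'a \<Rightarrow> ennreal)"
  obtain e :: 'a where e: "norm e = 1" using nonempty_Basis norm_Basis by blast
  have "M e < \<infinity>" unfolding M_def using assms e by (intro heat_mixture_power_law_finite) auto
  moreover have "M e \<noteq> 0" unfolding M_def by (rule heat_mixture_power_law_neq_0[where l=0 and u=1]) auto
  ultimately obtain m where m: "M e = ennreal m" "m > 0"
    by (cases "M e") (auto simp: less_eq_real_def)
  have "M x = ennreal (norm x powr (\<alpha> - real DIM('a)) * m)" if "x \<noteq> 0" for x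
  proof -
    have "M (x /\<^sub>R norm x) = M e"
      unfolding M_def using that e by (intro antisym heat_mixture_antimono) auto
    then show ?thesis
      using heat_mixture_power_law_homogeneous[of 1 "norm x" "\<alpha> / 2" "x /\<^sub>R norm x"] that m
      by (simp add: M_def ennreal_mult)
  qed
  moreover have "M 0 = \<infinity>" unfolding M_def using assms by (intro heat_mixture_power_law_0) auto
  ultimately have "riesz_kernel \<alpha> x 0 = ennreal (1 / m) * M x" for x :: 'a
    using m by (simp add: riesz_kernel_def ennreal_mult_top ennreal_mult[symmetric])
  then have "riesz_kernel \<alpha> x 0 = heat_mixture (power_law (1 / m) (\<alpha> / 2) {0<..}) x" for x :: 'a
    using m heat_mixture_power_law_cmult[of "1 / m" "{0<..}" 1 "\<alpha> / 2" x] by (simp add: M_def)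
  then show ?thesis using m by (intro that[of "1 / m"]) auto
qed

lemma conv_heat_heat_mixture_power_law_le:
  fixes x :: "'a::euclidean_space"
  assumes b: "0 \<le> b" "b \<le> 1" and c: "c \<ge> 0" and s: "0 < s" "s \<le> T"
  shows "conv (\<lambda>x. ennreal (heat s x)) (heat_mixture (power_law c b {T<..})) x
    \<le> 2 * heat_mixture (power_law c b {T<..}) x"
proof -
  let ?P = "power_law c b {T<..}"
  let ?w = "\<lambda>t. ennreal (c * t powr (b - 1)) * indicator {T<..} t"
  have pos: "AE t in ?P. t > 0" using s by (intro AE_power_law_pos) auto
  have "conv (\<lambda>x. ennreal (heat s x)) (heat_mixture ?P) x
      = (\<integral>\<^sup>+ t. conv (\<lambda>x. ennreal (heat t x)) (\<lambda>x. ennreal (heat s x)) x \<partial>?P)"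
    by (subst conv_commute, simp, simp, rule conv_heat_mixture) (auto intro: sigma_finite_power_law)
  also have "\<dots> = (\<integral>\<^sup>+ t. ennreal (heat (t + s) x) \<partial>?P)"
    by (rule nn_integral_cong_AE, use pos in eventually_elim) (simp add: conv_heat s)
  also have "\<dots> = (\<integral>\<^sup>+ t. ?w (t - s) * ennreal (heat t x) \<partial>lborel)"
    using nn_integral_lborel_shift[of "\<lambda>t. ?w (t - s) * ennreal (heat t x)" s] by (simp add: nn_integral_power_law)
  also have "\<dots> \<le> (\<integral>\<^sup>+ t. 2 * (?w t * ennreal (heat t x)) \<partial>lborel)"
  proof (intro nn_integral_mono)
    fix t
    have "?w (t - s) \<le> 2 * ?w t"
    proof (cases "t - s > T")
      case True
      have "2 powr (b - 1) * (t - s) powr (b - 1) = (2 * (t - s)) powr (b - 1)" by (rule powr_mult[symmetric])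
      also have "\<dots> \<le> t powr (b - 1)" using True s b by (intro powr_mono2') auto
      finally have "2 powr (1 - b) * (2 powr (b - 1) * (t - s) powr (b - 1)) \<le> 2 powr (1 - b) * t powr (b - 1)"
        by (intro mult_left_mono) simp_all
      also have "\<dots> \<le> 2 powr 1 * t powr (b - 1)" using b by (intro mult_right_mono powr_mono) auto
      also have "2 powr (1 - b) * (2 powr (b - 1) * (t - s) powr (b - 1)) = (t - s) powr (b - 1)"
        unfolding mult.assoc[symmetric] powr_add[symmetric] by simp
      finally have "c * (t - s) powr (b - 1) \<le> 2 * (c * t powr (b - 1))"
        using mult_left_mono[OF _ c] by (simp add: mult.left_commute)
      then have "ennreal (c * (t - s) powr (b - 1)) \<le> ennreal (2 * (c * t powr (b - 1)))" by (rule ennreal_leI)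
      then show ?thesis using True s c by (simp add: ennreal_mult)
    qed simp
    then show "?w (t - s) * ennreal (heat t x) \<le> 2 * (?w t * ennreal (heat t x))"
      by (metis mult.assoc mult_right_mono zero_le)
  qed
  also have "\<dots> = 2 * heat_mixture ?P x"
    by (simp add: nn_integral_cmult heat_mixture_def nn_integral_power_law)
  finally show ?thesis .
qed

text \<open>The kernel is a parameter of the locale only in order to fix the dimension.\<close>

locale riesz_potential =
  fixes \<alpha> c :: real and K :: "'a::euclidean_space \<Rightarrow> ennreal"
  assumes alpha: "0 < \<alpha>" "\<alpha> \<le> 2" "\<alpha> < real DIM('a)" and c_pos: "c > 0"
    and K_eq: "K = heat_mixture (power_law c (\<alpha> / 2) {0<..})"
    and riesz_kernel_eq: "\<And>x y. riesz_kernel \<alpha> x y = K (x - y)"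

lemma riesz_potential_exists:
  assumes "0 < \<alpha>" "\<alpha> \<le> 2" "\<alpha> < real DIM('a)"
  obtains c and K :: "'a::euclidean_space \<Rightarrow> ennreal" where "riesz_potential \<alpha> c K"
proof -
  obtain c where "c > 0" and "\<And>x::'a. riesz_kernel \<alpha> x 0 = heat_mixture (power_law c (\<alpha> / 2) {0<..}) x"
    using riesz_kernel_heat_mixture[OF assms(3)] by blast
  moreover have "riesz_kernel \<alpha> x y = riesz_kernel \<alpha> (x - y) 0" for x y :: 'a
    by (simp add: riesz_kernel_def dist_norm)
  ultimately have "riesz_potential \<alpha> c (heat_mixture (power_law c (\<alpha> / 2) {0<..}) :: 'a \<Rightarrow> ennreal)"
    using assms by unfold_locales simp_all
  then show ?thesis by (rule that)
qed

context riesz_potential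
begin

abbreviation riesz_law :: "real set \<Rightarrow> real measure" where
  "riesz_law \<equiv> power_law c (\<alpha> / 2)"

definition swept :: "real \<Rightarrow> 'a \<Rightarrow> ennreal" where
  "swept T = heat_mixture (riesz_law {T<..})"

definition unswept :: "real \<Rightarrow> 'a \<Rightarrow> ennreal" where
  "unswept T = heat_mixture (riesz_law {0<..T})"

definition sweep :: "real \<Rightarrow> 'a \<Rightarrow> ennreal" where
  "sweep T = heat_mixture (distr (passage_law (\<alpha> / 2)) borel ((*) T))"

definition mollifier :: "real \<Rightarrow> 'a \<Rightarrow> ennreal" where
  "mollifier T = heat_mixture (distr (power_law (\<alpha> / 2) (\<alpha> / 2) {0<..1}) borel ((*) T))"

definition unswept_mass :: "real \<Rightarrow> real" where
  "unswept_mass T = c / (\<alpha> / 2) * T powr (\<alpha> / 2)"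

definition swept_bound :: "real \<Rightarrow> real" where
  "swept_bound T = c * (4 * pi) powr (- (real DIM('a) / 2)) / (real DIM('a) / 2 - \<alpha> / 2)
    * T powr (\<alpha> / 2 - real DIM('a) / 2)"

lemma K_minus: "K (- x) = K x"
  and swept_minus: "swept T (- x) = swept T x"
  and sweep_minus: "sweep T (- x) = sweep T x"
  and mollifier_minus: "mollifier T (- x) = mollifier T x"
  by (simp_all add: K_eq swept_def sweep_def mollifier_def heat_mixture_minus)

lemma lsc_K: "lsc K"
  and lsc_swept: "lsc (swept T)"
  and lsc_sweep: "lsc (sweep T)"
  and lsc_mollifier: "lsc (mollifier T)"
  and lsc_unswept: "lsc (unswept T)"
  by (simp_all add: K_eq swept_def sweep_def mollifier_def unswept_def lsc_heat_mixture)

lemmas measurable_kernels [measurable] = lsc_K[THEN borel_measurable_lsc] lsc_swept[THEN borel_measurable_lsc]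
  lsc_sweep[THEN borel_measurable_lsc] lsc_mollifier[THEN borel_measurable_lsc] lsc_unswept[THEN borel_measurable_lsc]

lemma swept_antimono: "norm x \<le> norm y \<Longrightarrow> swept T y \<le> swept T x"
  by (simp add: swept_def heat_mixture_antimono)

lemma prob_space_passage: "prob_space (passage_law (\<alpha> / 2))"
  using alpha by (intro prob_space_passage_law) auto

lemma prob_space_mollifier_law: "prob_space (power_law (\<alpha> / 2) (\<alpha> / 2) {0<..1})"
  using alpha by (intro prob_spaceI) (simp add: emeasure_power_law)

lemma AE_mollifier_law_pos: "AE t in power_law (\<alpha> / 2) (\<alpha> / 2) {0<..1}. t > 0"
  by (rule AE_power_law_pos) auto

lemma nn_integral_sweep: "T > 0 \<Longrightarrow> (\<integral>\<^sup>+ x. sweep T x \<partial>lborel) = 1"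
  unfolding sweep_def
  by (rule nn_integral_heat_mixture_dilated[OF prob_space_passage _ AE_passage_law_pos]) auto

lemma nn_integral_mollifier: "T > 0 \<Longrightarrow> (\<integral>\<^sup>+ x. mollifier T x \<partial>lborel) = 1"
  unfolding mollifier_def
  by (rule nn_integral_heat_mixture_dilated[OF prob_space_mollifier_law _ AE_mollifier_law_pos]) auto

lemma swept_mono_level: "S \<le> T \<Longrightarrow> swept T x \<le> swept S x"
  unfolding swept_def by (rule heat_mixture_power_law_mono) auto

lemma swept_le_K: "T \<ge> 0 \<Longrightarrow> swept T x \<le> K x"
  unfolding swept_def K_eq by (rule heat_mixture_power_law_mono) auto

lemma K_split: "T > 0 \<Longrightarrow> K x = unswept T x + swept T x"
  unfolding K_eq unswept_def swept_def
  by (rule heat_mixture_power_law_split) simp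

lemma unswept_mass_pos: "T > 0 \<Longrightarrow> unswept_mass T > 0"
  using c_pos alpha by (simp add: unswept_mass_def)

lemma unswept_eq: "T > 0 \<Longrightarrow> unswept T x = ennreal (unswept_mass T) * mollifier T x"
proof -
  assume T: "T > 0"
  have "unswept T x = ennreal (T powr (\<alpha> / 2)) *
      (\<integral>\<^sup>+ t. ennreal (heat (T * t) x) \<partial>riesz_law ((*) T -` {0<..T}))"
    unfolding unswept_def heat_mixture_def using T c_pos by (intro nn_integral_power_law_scale) auto
  moreover have "(*) T -` {0<..T} = {0<..1}" using T by (auto simp: zero_less_mult_iff)
  ultimately have "unswept T x = ennreal (T powr (\<alpha> / 2)) *
      (\<integral>\<^sup>+ t. ennreal (heat (T * t) x) \<partial>power_law (c / (\<alpha> / 2) * (\<alpha> / 2)) (\<alpha> / 2) {0<..1})"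
    using alpha by simp
  also have "\<dots> = ennreal (unswept_mass T) * (\<integral>\<^sup>+ t. ennreal (heat (T * t) x) \<partial>power_law (\<alpha> / 2) (\<alpha> / 2) {0<..1})"
  proof -
    have "ennreal (T powr (\<alpha> / 2)) * ennreal (c / (\<alpha> / 2)) = ennreal (unswept_mass T)"
      using c_pos alpha by (simp add: unswept_mass_def ennreal_mult[symmetric] mult.commute)
    then show ?thesis
      using c_pos alpha by (subst nn_integral_power_law_cmult) (auto simp: mult.assoc[symmetric])
  qed
  also have "(\<integral>\<^sup>+ t. ennreal (heat (T * t) x) \<partial>power_law (\<alpha> / 2) (\<alpha> / 2) {0<..1}) = mollifier T x"
    unfolding mollifier_def heat_mixture_def by (rule nn_integral_distr[symmetric]) measurable
  finally show ?thesis .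
qed

lemma nn_integral_unswept: "T > 0 \<Longrightarrow> (\<integral>\<^sup>+ x. unswept T x \<partial>lborel) = ennreal (unswept_mass T)"
  by (simp add: unswept_eq nn_integral_cmult nn_integral_mollifier)

lemma conv_K_sweep: "T > 0 \<Longrightarrow> conv K (sweep T) = swept T"
proof
  fix x assume T: "T > 0"
  let ?D = "distr (passage_law (\<alpha> / 2)) borel ((*) T)" and ?P = "riesz_law {0<..}"
  interpret passage: prob_space "passage_law (\<alpha> / 2)" by (rule prob_space_passage)
  interpret D: prob_space ?D by (rule passage.prob_space_distr) simp
  have "AE t in ?D. t > 0" by (rule AE_distr_mult_pos[OF _ AE_passage_law_pos T]) simp
  then have "conv K (sweep T) x = (\<integral>\<^sup>+ s. (\<integral>\<^sup>+ t. ennreal (heat (s + t) x) \<partial>?D) \<partial>?P)"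
    unfolding K_eq sweep_def
    by (intro conv_heat_mixtures sigma_finite_power_law AE_power_law_pos D.sigma_finite_measure_axioms) auto
  also have "\<dots> = swept T x"
    unfolding swept_def heat_mixture_def
    using alpha T c_pos by (intro nn_integral_power_law_passage) auto
  finally show "conv K (sweep T) x = swept T x" .
qed

lemma conv_sweep_swept: "S > 0 \<Longrightarrow> T > 0 \<Longrightarrow> conv (sweep S) (swept T) = conv (sweep T) (swept S)"
  using conv_left_commute[of "sweep S" K "sweep T"] conv_left_commute[of "sweep T" K "sweep S"]
  by (simp add: conv_K_sweep conv_commute[of "sweep S" "sweep T"])

lemma swept_bound_nonneg: "swept_bound T \<ge> 0"
  using c_pos alpha by (simp add: swept_bound_def)

lemma swept_le: "T > 0 \<Longrightarrow> swept T x \<le> ennreal (swept_bound T)"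
  using heat_mixture_power_law_Ioi_le[of c T "\<alpha> / 2" x] c_pos alpha
  by (simp add: swept_def swept_bound_def)

lemma swept_finite: "T > 0 \<Longrightarrow> swept T x < \<infinity>"
  using swept_le[of T x] by (simp add: le_less_trans)

lemma tendsto_swept_bound: "(\<lambda>k. swept_bound (real (Suc k))) \<longlonglongrightarrow> 0"
proof -
  have "(\<lambda>k. real (Suc k) powr (\<alpha> / 2 - real DIM('a) / 2)) \<longlonglongrightarrow> 0"
    using alpha by (intro tendsto_neg_powr filterlim_compose[OF filterlim_real_sequentially filterlim_Suc]) auto
  then show ?thesis unfolding swept_bound_def by (rule tendsto_mult_right_zero)
qed

lemma continuous_on_swept: "T > 0 \<Longrightarrow> continuous_on UNIV (swept T)"
  unfolding swept_def using c_pos alpha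
  by (intro continuous_on_heat_mixture_power_law_Ioi) auto

lemma swept_neq_0: "T > 0 \<Longrightarrow> swept T x \<noteq> 0"
  unfolding swept_def using c_pos
  by (intro heat_mixture_power_law_neq_0[where l=T and u="T + 1"]) auto

lemma sweep_neq_0: "T > 0 \<Longrightarrow> sweep T x \<noteq> 0"
proof -
  assume T: "T > 0"
  interpret passage: prob_space "passage_law (\<alpha> / 2)" by (rule prob_space_passage)
  interpret D: prob_space "distr (passage_law (\<alpha> / 2)) borel ((*) T)" by (rule passage.prob_space_distr) simp
  show ?thesis unfolding sweep_def
    using AE_distr_mult_pos[OF _ AE_passage_law_pos T] D.emeasure_space_1
    by (intro heat_mixture_neq_0) auto
qed

lemma K_eq_SUP_swept: "K x = (SUP k. swept (1 / real (Suc k)) x)"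
proof -
  define S where "S = (\<lambda>k. {1 / real (Suc k)<..})"
  have "incseq S" unfolding S_def by (rule incseq_SucI) (auto simp: field_simps)
  moreover have "(\<Union>k. S k) = {0<..}"
  proof (intro set_eqI iffI)
    show "t \<in> (\<Union>k. S k)" if "t \<in> {0<..}" for t
    proof -
      have "t > 0" using that by simp
      then obtain k where "1 / real (Suc k) < t" using nat_approx_posE by blast
      then show ?thesis by (intro UN_I[of k]) (simp_all add: S_def)
    qed
    show "t \<in> {0<..}" if "t \<in> (\<Union>k. S k)" for t
    proof -
      obtain k where "1 / real (Suc k) < t" using \<open>t \<in> _\<close> by (auto simp: S_def)
      then have "0 < t" by (rule less_trans[rotated]) simp
      then show ?thesis by simp
    qed
  qed
  ultimately show ?thesis
    using heat_mixture_power_law_UN[of S c "\<alpha> / 2" x]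
    unfolding K_eq swept_def by (simp add: S_def)
qed

lemma K_eq_SUP_unswept: "K x = (SUP k. unswept (real (Suc k)) x)"
proof -
  define S where "S = (\<lambda>k. {0<..real (Suc k)})"
  have "incseq S" unfolding S_def by (rule incseq_SucI) auto
  moreover have "(\<Union>k. S k) = {0<..}"
  proof (intro set_eqI iffI)
    show "t \<in> (\<Union>k. S k)" if "t \<in> {0<..}" for t
    proof -
      obtain k where "t \<le> real k" using real_arch_simple by blast
      then show ?thesis using that by (intro UN_I[of k]) (auto simp: S_def)
    qed
  qed (auto simp: S_def)
  ultimately show ?thesis
    using heat_mixture_power_law_UN[of S c "\<alpha> / 2" x]
    unfolding K_eq unswept_def by (simp add: S_def)
qed

lemma incseq_unswept: "incseq (\<lambda>k. unswept (real (Suc k)) x)"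
  unfolding unswept_def by (intro incseq_SucI heat_mixture_power_law_mono) auto

lemma K_le_swept:
  obtains \<kappa> where "\<kappa> > 0" "\<And>T x. 0 < T \<Longrightarrow> T \<le> (norm x)\<^sup>2 \<Longrightarrow> ennreal \<kappa> * K x \<le> swept T x"
proof -
  obtain e :: 'a where e: "norm e = 1" using nonempty_Basis norm_Basis by blast
  obtain \<kappa> where kappa: "swept 1 e = ennreal \<kappa>" "\<kappa> > 0"
    using swept_finite[of 1 e] swept_neq_0[of 1 e] by (cases "swept 1 e") (auto simp: less_eq_real_def)
  have "ennreal \<kappa> * K x \<le> swept T x" if T: "0 < T" "T \<le> (norm x)\<^sup>2" for T x
  proof -
    define r where "r = norm x"
    have r: "r > 0" using T by (auto simp: r_def)
    have "K x = ennreal (r powr (\<alpha> - real DIM('a)))"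
      using riesz_kernel_eq[of x 0] r by (simp add: riesz_kernel_def r_def)
    then have "ennreal \<kappa> * K x = ennreal (r powr (\<alpha> - real DIM('a))) * swept 1 e"
      by (simp add: kappa mult.commute)
    also have "\<dots> \<le> ennreal (r powr (\<alpha> - real DIM('a))) * swept 1 (x /\<^sub>R r)"
      using e r by (intro mult_left_mono swept_antimono) (simp_all add: r_def)
    also have "\<dots> = swept (r\<^sup>2) x "
    proof -
      have "(*) (r\<^sup>2) -` {r\<^sup>2<..} = {1<..}" using r by auto
      then show ?thesis
        using heat_mixture_power_law_scale[of "{r\<^sup>2<..}" c r "\<alpha> / 2" "x /\<^sub>R r"] r c_pos
        by (simp add: swept_def)
    qed
    also have "\<dots> \<le> swept T x" using T by (intro swept_mono_level) (simp add: r_def)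
    finally show ?thesis .
  qed
  then show ?thesis using that kappa(2) by blast
qed

lemma unswept_sweep_commute:
  assumes S: "S > 0" and T: "T > 0"
  shows "unswept S x + conv (unswept T) (sweep S) x = unswept T x + conv (unswept S) (sweep T) x"
proof -
  have split: "swept R x = conv (unswept T) (sweep R) x + conv (swept T) (sweep R) x" if "R > 0" "T > 0" for R T
  proof -
    have "K = (\<lambda>x. unswept T x + swept T x)" using K_split[OF that(2)] by auto
    then have "swept R x = conv (\<lambda>x. unswept T x + swept T x) (sweep R) x"
      using conv_K_sweep[OF that(1)] by metis
    then show ?thesis by (simp add: conv_add_left)
  qed
  have common: "conv (swept S) (sweep T) x = conv (swept T) (sweep S) x"
    using conv_sweep_swept[OF S T] by (simp add: conv_commute[of "sweep _"])
  have "conv (swept T) (sweep S) x \<le> 1 * ennreal (swept_bound T)"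
    using conv_le_const[of "sweep S" "swept T" "ennreal (swept_bound T)" x] swept_le[OF T]
    by (simp add: conv_commute[of "sweep S"] nn_integral_sweep[OF S])
  then have fin: "conv (swept T) (sweep S) x \<noteq> \<infinity>" by (auto simp: top_unique)
  have "conv (swept T) (sweep S) x + (unswept S x + conv (unswept T) (sweep S) x) = K x"
    unfolding K_split[OF S, of x] split[OF S T] by (simp add: add_ac)
  also have "\<dots> = conv (swept T) (sweep S) x + (unswept T x + conv (unswept S) (sweep T) x)"
    unfolding K_split[OF T, of x] split[OF T S] common by (simp add: add_ac)
  finally show ?thesis using fin by (simp add: ennreal_add_left_cancel)
qed

lemma conv_mollifier_swept_le:
  assumes T: "0 < T" "T \<le> 1" shows "conv (mollifier T) (swept 1) x \<le> 2 * swept 1 x"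
proof -
  let ?D = "distr (power_law (\<alpha> / 2) (\<alpha> / 2) {0<..1}) borel ((*) T)"
  interpret M: prob_space "power_law (\<alpha> / 2) (\<alpha> / 2) {0<..1}" by (rule prob_space_mollifier_law)
  interpret D: prob_space ?D by (rule M.prob_space_distr) simp
  have "AE t in power_law (\<alpha> / 2) (\<alpha> / 2) {0<..1}. t \<in> {0<..1}"
    unfolding power_law_def by (subst AE_density) (auto split: split_indicator)
  then have "AE t in power_law (\<alpha> / 2) (\<alpha> / 2) {0<..1}. T * t \<in> {0<..1}"
    by eventually_elim (use T in \<open>auto intro: mult_le_one\<close>)
  then have pos: "AE t in ?D. t \<in> {0<..1}" by (subst AE_distr_iff) auto
  have "conv (mollifier T) (swept 1) x = (\<integral>\<^sup>+ t. conv (\<lambda>x. ennreal (heat t x)) (swept 1) x \<partial>?D)"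
    unfolding mollifier_def by (rule conv_heat_mixture) (auto intro: D.sigma_finite_measure_axioms)
  also have "\<dots> \<le> (\<integral>\<^sup>+ t. 2 * swept 1 x \<partial>?D)"
  proof (rule nn_integral_mono_AE, use pos in eventually_elim)
    show "conv (\<lambda>x. ennreal (heat t x)) (swept 1) x \<le> 2 * swept 1 x" if "t \<in> {0<..1}" for t
      unfolding swept_def using that alpha c_pos
      by (intro conv_heat_heat_mixture_power_law_le) auto
  qed
  also have "\<dots> = 2 * swept 1 x" using D.emeasure_space_1 by simp
  finally show ?thesis .
qed

end

section \<open>Superharmonic functions\<close>

context riesz_potential
begin

definition superharmonic :: "('a \<Rightarrow> ennreal) \<Rightarrow> bool" where
  "superharmonic v \<longleftrightarrow> lsc v \<and> (\<forall>T>0. \<forall>x. conv (sweep T) v x \<le> v x)"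

lemma superharmonic_lsc: "superharmonic v \<Longrightarrow> lsc v"
  and superharmonic_conv_sweep_le: "superharmonic v \<Longrightarrow> T > 0 \<Longrightarrow> conv (sweep T) v x \<le> v x"
  by (simp_all add: superharmonic_def)

lemma borel_measurable_superharmonic: "superharmonic v \<Longrightarrow> v \<in> borel_measurable borel"
  by (intro borel_measurable_lsc superharmonic_lsc)

lemma superharmonic_min:
  assumes "superharmonic u" "superharmonic v" shows "superharmonic (\<lambda>x. min (u x) (v x))"
  unfolding superharmonic_def
proof (intro conjI allI impI)
  show "lsc (\<lambda>x. min (u x) (v x))" using assms by (intro lsc_min superharmonic_lsc)
  fix T :: real and x assume T: "T > 0"
  have "conv (sweep T) (\<lambda>x. min (u x) (v x)) x \<le> conv (sweep T) u x"
    "conv (sweep T) (\<lambda>x. min (u x) (v x)) x \<le> conv (sweep T) v x"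
    by (auto intro!: conv_mono)
  then show "conv (sweep T) (\<lambda>x. min (u x) (v x)) x \<le> min (u x) (v x)"
    using assms[THEN superharmonic_conv_sweep_le, OF T, of x] by auto
qed

lemma superharmonic_INF_atMost:
  fixes f :: "nat \<Rightarrow> 'a \<Rightarrow> ennreal"
  assumes "\<And>i. superharmonic (f i)" shows "superharmonic (\<lambda>x. INF i\<in>{..j}. f i x)"
proof (induction j)
  case (Suc j)
  then show ?case
    using superharmonic_min[OF assms Suc] by (simp add: atMost_Suc inf_min)
qed (simp add: assms)

lemma superharmonic_cmult:
  assumes "superharmonic v" "a < \<infinity>" shows "superharmonic (\<lambda>x. a * v x)"
  using assms borel_measurable_superharmonic[OF assms(1)]
  by (auto simp: superharmonic_def conv_cmult_right intro!: lsc_cmult mult_left_mono)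

lemma conv_sweep_potential:
  assumes "sigma_finite_measure \<eta>" "sets \<eta> = sets borel" "T > 0"
  shows "conv (sweep T) (conv_measure K \<eta>) = conv_measure (swept T) \<eta>"
  using assms by (simp add: conv_conv_measure conv_commute[of "sweep T"] conv_K_sweep)

lemma superharmonic_potential:
  assumes "sigma_finite_measure \<eta>" "sets \<eta> = sets borel" shows "superharmonic (conv_measure K \<eta>)"
  using assms unfolding superharmonic_def
  by (auto simp: conv_sweep_potential lsc_conv_measure[OF lsc_K] conv_measure_def intro!: nn_integral_mono swept_le_K)

lemma superharmonic_swept: "S > 0 \<Longrightarrow> superharmonic (swept S)"
proof -
  assume S: "S > 0"
  have "prob_space (density lborel (sweep S))"
    by (rule prob_spaceI) (simp add: emeasure_density nn_integral_sweep[OF S])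
  then have "superharmonic (conv_measure K (density lborel (sweep S)))"
    by (intro superharmonic_potential) (simp_all add: prob_space_def finite_measure_def)
  then show ?thesis by (simp add: conv_eq_conv_measure[symmetric] conv_K_sweep[OF S])
qed

lemma lsc_le_liminf_conv_sweep:
  assumes "lsc v" "\<And>k. T k > 0" "T \<longlonglongrightarrow> 0"
  shows "v x \<le> liminf (\<lambda>k. conv (sweep (T k)) v x)"
  unfolding sweep_def
  by (rule lsc_le_liminf_conv_heat_mixture[OF prob_space_passage _ AE_passage_law_pos]) (simp_all add: assms)

lemma superharmonic_le_of_AE_le:
  assumes u: "lsc u" and v: "superharmonic v" and le: "AE x in lborel. u x \<le> v x"
  shows "u x \<le> v x"
proof -
  have T: "1 / real (Suc k) > 0" "(\<lambda>k. 1 / real (Suc k)) \<longlonglongrightarrow> 0" for k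
    using LIMSEQ_inverse_real_of_nat by (auto simp: divide_inverse)
  have "conv (sweep (1 / real (Suc k))) u x \<le> v x" for k
  proof -
    have "conv (sweep (1 / real (Suc k))) u x \<le> conv (sweep (1 / real (Suc k))) v x"
      unfolding conv_def
      by (rule nn_integral_mono_AE, use le in eventually_elim) (simp add: mult_left_mono)
    also have "\<dots> \<le> v x" by (intro superharmonic_conv_sweep_le v) simp
    finally show ?thesis .
  qed
  then have "liminf (\<lambda>k. conv (sweep (1 / real (Suc k))) u x) \<le> liminf (\<lambda>k::nat. v x)"
    by (intro Liminf_mono always_eventually allI)
  then show ?thesis
    using lsc_le_liminf_conv_sweep[OF u T, of x] by (simp add: Liminf_const)
qed

lemma superharmonic_AE_finite:
  assumes v: "superharmonic v" and "v x < \<infinity>"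
  shows "AE y in lborel. v y < \<infinity>"
proof -
  note borel_measurable_superharmonic[OF v, measurable]
  have "(\<integral>\<^sup>+ y. sweep 1 (x - y) * v y \<partial>lborel) \<noteq> \<infinity>"
    using superharmonic_conv_sweep_le[OF v, of 1 x] assms(2) by (auto simp: conv_def top_unique)
  then have "AE y in lborel. sweep 1 (x - y) * v y \<noteq> \<infinity>"
    by (intro nn_integral_noteq_infinite) auto
  then show ?thesis
    by eventually_elim (use sweep_neq_0[of 1] in \<open>auto simp: less_top ennreal_mult_eq_top_iff\<close>)
qed

end

section \<open>The energy estimate\<close>

context riesz_potential
begin

lemma tendsto_conv_unswept:
  assumes [measurable]: "f \<in> borel_measurable borel"
  shows "(\<lambda>k. conv (unswept (real (Suc k))) f x) \<longlonglongrightarrow> conv K f x"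
proof -
  have "conv K f x = (SUP k. conv f (unswept (real (Suc k))) x)"
    unfolding K_eq_SUP_unswept[abs_def]
    by (subst conv_commute) (simp_all add: conv_SUP incseq_unswept del: of_nat_Suc)
  moreover have "incseq (\<lambda>k. conv f (unswept (real (Suc k))) x)"
    by (intro incseq_SucI conv_mono incseq_SucD[OF incseq_unswept]) simp
  ultimately show ?thesis using LIMSEQ_SUP by (simp add: conv_commute[of _ f])
qed

lemma conv_sweep_le_swept_bound:
  assumes v: "\<And>x. v x \<le> ennreal M * swept 1 x" and M: "M \<ge> 0" and N: "N > 0"
  shows "conv (sweep N) v x \<le> ennreal (M * swept_bound N)"
proof -
  have "conv (sweep N) v x \<le> conv (sweep N) (\<lambda>x. ennreal M * swept 1 x) x" by (intro conv_mono v) simp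
  also have "\<dots> = ennreal M * conv (sweep 1) (swept N) x"
    by (subst conv_cmult_right) (simp_all add: conv_sweep_swept[OF N])
  also have "\<dots> \<le> ennreal M * (1 * ennreal (swept_bound N))"
    using conv_le_const[OF _ swept_le[OF N], where f="sweep 1" and x=x]
    by (intro mult_left_mono) (simp_all add: nn_integral_sweep)
  finally show ?thesis using M swept_bound_nonneg by (simp add: ennreal_mult)
qed

lemma le_swept_imp_bounded:
  assumes "v x \<le> ennreal M * swept 1 x" "M \<ge> 0"
  shows "v x \<le> ennreal (M * swept_bound 1)"
proof -
  have "v x \<le> ennreal M * ennreal (swept_bound 1)"
    using assms(1) by (rule order_trans) (intro mult_left_mono swept_le, simp_all)
  then show ?thesis using assms(2) swept_bound_nonneg by (simp add: ennreal_mult)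
qed

text \<open>Formally this is the resolvent relation \<open>K * (v - \<rho> * v) = (K - K * \<rho>) * v\<close> for \<open>\<rho> = sweep T\<close>; since \<open>K * v\<close> may be
  infinite, it is derived first with \<open>K\<close> replaced by its integrable parts \<open>unswept N\<close>, which increase to \<open>K\<close>.\<close>

lemma conv_unswept_diff_conv_sweep:
  assumes [measurable]: "v \<in> borel_measurable borel" and M: "M \<ge> 0" and v: "\<And>x. v x \<le> ennreal M * swept 1 x"
    and T: "T > 0" and sup: "\<And>x. conv (sweep T) v x \<le> v x" and N: "N > 0"
  shows "conv (unswept N) (\<lambda>x. v x - conv (sweep T) v x) x + conv (unswept T) (conv (sweep N) v) x
    = conv (unswept T) v x"
proof -
  define f where "f = (\<lambda>x. v x - conv (sweep T) v x)"
  have [measurable]: "f \<in> borel_measurable borel" unfolding f_def by measurable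
  have v_eq: "v = (\<lambda>x. f x + conv (sweep T) v x)"
    using sup by (auto simp: f_def fun_eq_iff diff_add_cancel_ennreal)
  let ?a = "conv (unswept N) (conv (sweep T) v) x"
  have "?a \<le> ennreal (unswept_mass N) * ennreal (M * swept_bound T)"
    using conv_le_const[OF _ conv_sweep_le_swept_bound[OF v M T], where f="unswept N" and x=x]
    by (simp add: nn_integral_unswept[OF N])
  then have fin: "?a \<noteq> \<infinity>" by (auto simp: top_unique ennreal_mult_eq_top_iff)
  have "conv (\<lambda>x. unswept N x + conv (unswept T) (sweep N) x) v x
      = conv (\<lambda>x. unswept T x + conv (unswept N) (sweep T) x) v x"
    using unswept_sweep_commute[OF N T] by simp
  then have "conv (unswept N) v x + conv (unswept T) (conv (sweep N) v) x = conv (unswept T) v x + ?a"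
    by (simp add: conv_add_left conv_assoc)
  moreover have "conv (unswept N) v x = conv (unswept N) f x + ?a"
    by (subst v_eq) (rule conv_add_right, auto)
  ultimately have "?a + (conv (unswept N) f x + conv (unswept T) (conv (sweep N) v) x) = ?a + conv (unswept T) v x"
    by (simp add: add_ac)
  then show ?thesis using fin unfolding f_def[symmetric] by (simp add: ennreal_add_left_cancel)
qed

lemma conv_K_diff_conv_sweep:
  assumes [measurable]: "v \<in> borel_measurable borel" and M: "M \<ge> 0" and v: "\<And>x. v x \<le> ennreal M * swept 1 x"
    and T: "T > 0" and sup: "\<And>x. conv (sweep T) v x \<le> v x"
  shows "conv K (\<lambda>x. v x - conv (sweep T) v x) x = conv (unswept T) v x"
proof -
  define f where "f = (\<lambda>x. v x - conv (sweep T) v x)"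
  have [measurable]: "f \<in> borel_measurable borel" unfolding f_def by measurable
  have split: "conv (unswept N) f x + conv (unswept T) (conv (sweep N) v) x = conv (unswept T) v x"
    if "N > 0" for N
    unfolding f_def by (rule conv_unswept_diff_conv_sweep[OF _ M v T sup that]) simp
  have "(\<lambda>k. conv (unswept T) (conv (sweep (real (Suc k))) v) x) \<longlonglongrightarrow> 0"
  proof (rule tendsto_sandwich[OF _ _ tendsto_const])
    show "\<forall>\<^sub>F k in sequentially. conv (unswept T) (conv (sweep (real (Suc k))) v) x
        \<le> ennreal (unswept_mass T) * ennreal (M * swept_bound (real (Suc k)))"
      using conv_le_const[OF _ conv_sweep_le_swept_bound[OF v M], where f="unswept T" and x=x]
      by (simp add: nn_integral_unswept[OF T])
    have "(\<lambda>k. ennreal (unswept_mass T) * ennreal (M * swept_bound (real (Suc k))))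
        \<longlonglongrightarrow> ennreal (unswept_mass T) * ennreal (M * 0)"
      by (intro ennreal_tendsto_cmult tendsto_ennrealI tendsto_mult_left tendsto_swept_bound) simp
    then show "(\<lambda>k. ennreal (unswept_mass T) * ennreal (M * swept_bound (real (Suc k)))) \<longlonglongrightarrow> 0" by simp
  qed simp
  then have "(\<lambda>k. conv (unswept (real (Suc k))) f x + conv (unswept T) (conv (sweep (real (Suc k))) v) x)
      \<longlonglongrightarrow> conv K f x + 0"
    by (intro tendsto_add tendsto_conv_unswept) simp
  then have "(\<lambda>k::nat. conv (unswept T) v x) \<longlonglongrightarrow> conv K f x"
    by (subst (asm) split) simp_all
  then show ?thesis unfolding f_def by (simp add: LIMSEQ_const_iff)
qed

definition swept_measure :: "real \<Rightarrow> 'a measure \<Rightarrow> 'a measure" where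
  "swept_measure T \<nu> = density lborel (conv_measure (sweep T) \<nu>)"

lemma sets_swept_measure [simp, measurable_cong]: "sets (swept_measure T \<nu>) = sets borel"
  by (simp add: swept_measure_def)

lemma nn_integral_swept_measure:
  assumes "sigma_finite_measure \<nu>" "sets \<nu> = sets borel" and [measurable]: "f \<in> borel_measurable borel"
  shows "(\<integral>\<^sup>+ x. f x \<partial>swept_measure T \<nu>) = (\<integral>\<^sup>+ x. conv (sweep T) f x \<partial>\<nu>)"
  unfolding swept_measure_def
  using assms by (subst nn_integral_density)
    (auto simp: nn_integral_conv_dual sweep_minus intro!: measurable_conv_measure)

lemma prob_space_swept_measure:
  assumes "prob_space \<nu>" "sets \<nu> = sets borel" "T > 0" shows "prob_space (swept_measure T \<nu>)"
proof (rule prob_spaceI)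
  interpret prob_space \<nu> by fact
  have "emeasure (swept_measure T \<nu>) (space (swept_measure T \<nu>)) = (\<integral>\<^sup>+ x. 1 \<partial>swept_measure T \<nu>)" by simp
  also have "\<dots> = (\<integral>\<^sup>+ x. 1 \<partial>\<nu>)"
    using assms
    by (subst nn_integral_swept_measure)
      (simp_all add: sigma_finite_measure_axioms conv_const nn_integral_sweep cong: nn_integral_cong)
  finally show "emeasure (swept_measure T \<nu>) (space (swept_measure T \<nu>)) = 1"
    by (simp add: emeasure_space_1)
qed

lemma potential_swept_measure:
  assumes "sigma_finite_measure \<nu>" "sets \<nu> = sets borel"
  shows "conv_measure K (swept_measure T \<nu>) = conv (sweep T) (conv_measure K \<nu>)"
proof -
  have [measurable]: "conv_measure (sweep T) \<nu> \<in> borel_measurable borel"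
    using assms by (intro measurable_conv_measure) auto
  have "conv_measure K (swept_measure T \<nu>) = conv K (conv_measure (sweep T) \<nu>)"
    by (simp add: swept_measure_def conv_eq_conv_measure)
  then show ?thesis using assms by (simp add: conv_conv_measure conv_commute[of "sweep T"])
qed

lemma kernel_energy_swept_measure_le:
  assumes nu: "prob_space \<nu>" "sets \<nu> = sets borel" and T: "T > 0"
  shows "kernel_energy K \<nu> (swept_measure T \<nu>) \<le> kernel_energy K \<nu> \<nu>"
    and "kernel_energy K (swept_measure T \<nu>) (swept_measure T \<nu>) \<le> kernel_energy K \<nu> (swept_measure T \<nu>)"
proof -
  interpret prob_space \<nu> by (rule nu)
  have U: "superharmonic (conv_measure K \<nu>)"
    by (intro superharmonic_potential sigma_finite_measure_axioms nu)
  note borel_measurable_superharmonic[OF U, measurable]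
  have sweep_le: "conv (sweep T) (conv_measure K \<nu>) x \<le> conv_measure K \<nu> x" for x
    by (intro superharmonic_conv_sweep_le U T)
  have "kernel_energy K \<nu> (swept_measure T \<nu>) = (\<integral>\<^sup>+ x. conv (sweep T) (conv_measure K \<nu>) x \<partial>\<nu>)"
    unfolding kernel_energy_def
    by (rule nn_integral_swept_measure) (simp_all add: nu sigma_finite_measure_axioms)
  then show "kernel_energy K \<nu> (swept_measure T \<nu>) \<le> kernel_energy K \<nu> \<nu>"
    by (auto simp: kernel_energy_def intro!: nn_integral_mono sweep_le)
  show "kernel_energy K (swept_measure T \<nu>) (swept_measure T \<nu>) \<le> kernel_energy K \<nu> (swept_measure T \<nu>)"
    unfolding kernel_energy_def potential_swept_measure[OF sigma_finite_measure_axioms nu(2)]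
    by (intro nn_integral_mono sweep_le)
qed

lemma mollified_potential:
  assumes v: "superharmonic v" and M: "M \<ge> 0" and le: "\<And>x. v x \<le> ennreal M * swept 1 x" and T: "T > 0"
  obtains l where "sigma_finite_measure l" "sets l = sets borel" "conv_measure K l = conv (mollifier T) v"
proof -
  note borel_measurable_superharmonic[OF v, measurable]
  define m where "m = ennreal (unswept_mass T)"
  have m: "m \<noteq> 0" "m < \<infinity>" using unswept_mass_pos[OF T] by (simp_all add: m_def)
  define f where "f = (\<lambda>x. (v x - conv (sweep T) v x) / m)"
  have [measurable]: "f \<in> borel_measurable borel" unfolding f_def by measurable
  define l where "l = density lborel f"
  have bound: "v x \<le> ennreal (M * swept_bound 1)" for x by (intro le_swept_imp_bounded le M)
  have "f x \<noteq> \<infinity>" for x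
    using bound[of x] m by (auto simp: f_def ennreal_divide_eq_top_iff ennreal_minus_eq_top top_unique)
  then have l: "sigma_finite_measure l" "sets l = sets borel" unfolding l_def
    by (subst sigma_finite_measure.sigma_finite_iff_density_finite[OF sigma_finite_lborel]) auto
  have "conv_measure K l = conv (mollifier T) v"
  proof
    fix x
    have "conv_measure K l x = conv K (\<lambda>x. v x - conv (sweep T) v x) x / m"
      unfolding l_def f_def by (simp add: conv_eq_conv_measure[symmetric] conv_def nn_integral_divide[symmetric] ennreal_times_divide)
    also have "\<dots> = conv (unswept T) v x / m"
      using conv_K_diff_conv_sweep[OF _ M le T superharmonic_conv_sweep_le[OF v T]] by simp
    also have "conv (unswept T) v x = m * conv (mollifier T) v x"
      unfolding unswept_eq[OF T, abs_def] m_def by (rule conv_cmult_left) measurable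
    finally show "conv_measure K l x = conv (mollifier T) v x"
      using m by (simp add: ennreal_mult_divide_eq mult.commute[of m])
  qed
  with l show ?thesis by (rule that)
qed

lemma kernel_energy_mollified_le:
  assumes [measurable]: "v \<in> borel_measurable borel" and M: "M \<ge> 0" and le: "\<And>x. v x \<le> ennreal M * swept 1 x"
    and T: "T > 0" and l: "sigma_finite_measure l" "sets l = sets borel"
    and potential: "conv_measure K l = conv (mollifier T) v"
  shows "kernel_energy K l l \<le> ennreal (M * M * swept_bound 1)"
proof -
  have bound: "v x \<le> ennreal (M * swept_bound 1)" for x by (intro le_swept_imp_bounded le M)
  have "kernel_energy K l l \<le> (\<integral>\<^sup>+ x. ennreal M * conv K (conv (mollifier T) (sweep 1)) x \<partial>l)"
    unfolding kernel_energy_def potential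
  proof (intro nn_integral_mono)
    fix x
    have "conv (mollifier T) v x \<le> conv (mollifier T) (\<lambda>x. ennreal M * swept 1 x) x" by (intro conv_mono le) simp
    also have "\<dots> = ennreal M * conv K (conv (mollifier T) (sweep 1)) x"
      by (simp add: conv_cmult_right conv_left_commute[of K] conv_K_sweep)
    finally show "conv (mollifier T) v x \<le> ennreal M * conv K (conv (mollifier T) (sweep 1)) x" .
  qed
  also have "\<dots> = ennreal M * (\<integral>\<^sup>+ x. conv (mollifier T) v x * conv (mollifier T) (sweep 1) x \<partial>lborel)"
    using l by (simp add: nn_integral_cmult nn_integral_conv_dual K_minus potential)
  also have "\<dots> \<le> ennreal M * (\<integral>\<^sup>+ x. ennreal (M * swept_bound 1) * conv (mollifier T) (sweep 1) x \<partial>lborel)"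
    using conv_le_const[OF _ bound, where f="mollifier T"] T
    by (intro mult_left_mono nn_integral_mono mult_right_mono) (simp_all add: nn_integral_mollifier)
  also have "\<dots> = ennreal (M * M * swept_bound 1)"
    using M T swept_bound_nonneg
    by (simp add: nn_integral_cmult nn_integral_conv nn_integral_mollifier nn_integral_sweep ennreal_mult[symmetric] mult.assoc)
  finally show ?thesis .
qed

lemma energy_estimate_mollified:
  assumes v: "superharmonic v" and M: "M \<ge> 0" and le: "\<And>x. v x \<le> ennreal M * swept 1 x" and d: "d > 0"
    and nu: "prob_space \<nu>" "sets \<nu> = sets borel" and fin: "kernel_energy K \<nu> \<nu> < \<infinity>" and T: "T > 0" and s: "s > 0"
  shows "2 * (\<integral>\<^sup>+ x. conv (mollifier d) v x \<partial>\<nu>) + ennreal (1 / s) * kernel_energy K \<nu> (swept_measure T \<nu>)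
    \<le> 2 * (\<integral>\<^sup>+ x. conv (mollifier d) v x \<partial>swept_measure T \<nu>)
      + (ennreal (s * (M * M * swept_bound 1)) + ennreal (1 / s) * kernel_energy K \<nu> \<nu>)"
proof -
  interpret nu: prob_space \<nu> by (rule nu)
  interpret nu': prob_space "swept_measure T \<nu>" by (rule prob_space_swept_measure[OF nu T])
  have nu_fin: "sigma_finite_measure \<nu>" by (rule nu.sigma_finite_measure_axioms)
  let ?E = "kernel_energy K" and ?\<nu> = "swept_measure T \<nu>" and ?V = "conv (mollifier d) v"
  obtain l where l: "sigma_finite_measure l" "sets l = sets borel" and potential: "conv_measure K l = ?V"
    by (rule mollified_potential[OF v M le d])
  have energy: "?E l l \<le> ennreal (M * M * swept_bound 1)"
    by (rule kernel_energy_mollified_le[OF borel_measurable_superharmonic[OF v] M le d l potential])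
  have mixed_fin: "?E \<nu> ?\<nu> \<noteq> \<infinity>"
    using kernel_energy_swept_measure_le(1)[OF nu T] fin by (auto simp: top_unique)
  have "2 * ?E l \<nu> + ennreal (2 / s) * ?E \<nu> ?\<nu>
      \<le> 2 * ?E l ?\<nu> + ennreal s * ?E l l + ennreal (1 / s) * (?E \<nu> \<nu> + ?E ?\<nu> ?\<nu>)"
    unfolding K_eq
    by (rule kernel_energy_heat_mixture_ineq)
      (simp_all add: s l nu nu_fin nu'.sigma_finite_measure_axioms sigma_finite_power_law)
  also have "\<dots> \<le> 2 * ?E l ?\<nu> + ennreal s * ennreal (M * M * swept_bound 1) + ennreal (1 / s) * (?E \<nu> \<nu> + ?E \<nu> ?\<nu>)"
    using kernel_energy_swept_measure_le(2)[OF nu T] energy by (intro add_mono mult_left_mono) auto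
  also have "ennreal (2 / s) = ennreal (1 / s) + ennreal (1 / s)"
    using s by (simp add: ennreal_plus[symmetric] del: ennreal_plus)
  finally have "ennreal (1 / s) * ?E \<nu> ?\<nu> + (2 * ?E l \<nu> + ennreal (1 / s) * ?E \<nu> ?\<nu>)
      \<le> ennreal (1 / s) * ?E \<nu> ?\<nu> + (2 * ?E l ?\<nu> + (ennreal s * ennreal (M * M * swept_bound 1) + ennreal (1 / s) * ?E \<nu> \<nu>))"
    by (simp add: distrib_left distrib_right add_ac)
  then show ?thesis
    using mixed_fin M s swept_bound_nonneg
    by (simp add: ennreal_add_left_cancel_le ennreal_mult_eq_top_iff ennreal_mult' kernel_energy_def potential)
qed

lemma tendsto_nn_integral_mollifier_swept_measure:
  assumes [measurable]: "v \<in> borel_measurable borel" and C: "\<And>x. v x \<le> C" "C < \<infinity>" and T: "T > 0"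
    and nu: "prob_space \<nu>" "sets \<nu> = sets borel"
  shows "(\<lambda>k. \<integral>\<^sup>+ x. conv (mollifier (1 / real (Suc k))) v x \<partial>swept_measure T \<nu>)
    \<longlonglongrightarrow> (\<integral>\<^sup>+ x. v x \<partial>swept_measure T \<nu>)"
proof -
  interpret nu: prob_space \<nu> by (rule nu)
  note nu(2)[measurable_cong]
  let ?u = "conv (sweep T) v"
  have "continuous_on UNIV ?u"
    using C T by (intro continuous_on_sequentiallyI tendsto_conv_bounded lsc_sweep) (auto simp: nn_integral_sweep)
  moreover have u_le: "?u x \<le> C" for x
    using conv_le_const[OF _ C(1), where f="sweep T" and x=x] T by (simp add: nn_integral_sweep)
  moreover have "(\<lambda>k. 1 / real (Suc k)) \<longlonglongrightarrow> 0" using LIMSEQ_inverse_real_of_nat by (simp add: divide_inverse)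
  ultimately have "(\<lambda>k. conv (mollifier (1 / real (Suc k))) ?u x) \<longlonglongrightarrow> ?u x" for x
    unfolding mollifier_def using C(2)
    by (intro tendsto_conv_heat_mixture[OF prob_space_mollifier_law sets_power_law AE_mollifier_law_pos]) auto
  then have "(\<lambda>k. \<integral>\<^sup>+ x. conv (mollifier (1 / real (Suc k))) ?u x \<partial>\<nu>) \<longlonglongrightarrow> (\<integral>\<^sup>+ x. ?u x \<partial>\<nu>)"
    using C(2) conv_le_const[OF _ u_le, where f="mollifier (1 / real (Suc k))" for k]
    by (intro nn_integral_dominated_convergence[where w="\<lambda>_. C"])
      (simp_all add: nn_integral_mollifier nu.emeasure_space_1)
  then show ?thesis
    by (simp add: nn_integral_swept_measure[OF nu.sigma_finite_measure_axioms nu(2)] conv_left_commute[of "sweep T"])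
qed

lemma energy_estimate:
  assumes v: "superharmonic v" and M: "M \<ge> 0" and le: "\<And>x. v x \<le> ennreal M * swept 1 x"
    and nu: "prob_space \<nu>" "sets \<nu> = sets borel" and fin: "kernel_energy K \<nu> \<nu> < \<infinity>" and T: "T > 0" and s: "s > 0"
  shows "2 * (\<integral>\<^sup>+ x. v x \<partial>\<nu>) + ennreal (1 / s) * kernel_energy K \<nu> (swept_measure T \<nu>)
    \<le> 2 * (\<integral>\<^sup>+ x. v x \<partial>swept_measure T \<nu>)
      + (ennreal (s * (M * M * swept_bound 1)) + ennreal (1 / s) * kernel_energy K \<nu> \<nu>)"
    (is "2 * ?I + ?e \<le> 2 * ?J + ?R")
proof -
  note borel_measurable_superharmonic[OF v, measurable] nu(2)[measurable_cong]
  define C where "C = ennreal (M * swept_bound 1)"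
  have C: "v x \<le> C" "C < \<infinity>" for x unfolding C_def by (simp_all add: le_swept_imp_bounded le M)
  define d where "d = (\<lambda>k. 1 / real (Suc k))"
  have d: "d k > 0" "d \<longlonglongrightarrow> 0" for k
    unfolding d_def using LIMSEQ_inverse_real_of_nat by (auto simp: divide_inverse)
  have mollified: "(\<lambda>k. \<integral>\<^sup>+ x. conv (mollifier (d k)) v x \<partial>swept_measure T \<nu>) \<longlonglongrightarrow> ?J"
    unfolding d_def by (rule tendsto_nn_integral_mollifier_swept_measure[OF _ C T nu]) simp
  note mollify = prob_space_mollifier_law sets_power_law AE_mollifier_law_pos
  have "?I \<le> (\<integral>\<^sup>+ x. liminf (\<lambda>k. conv (mollifier (d k)) v x) \<partial>\<nu>)"
    unfolding mollifier_def
    by (intro nn_integral_mono lsc_le_liminf_conv_heat_mixture[OF mollify] superharmonic_lsc v d)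
  also have "\<dots> \<le> liminf (\<lambda>k. \<integral>\<^sup>+ x. conv (mollifier (d k)) v x \<partial>\<nu>)"
    by (rule nn_integral_liminf) measurable
  finally have "2 * ?I + ?e \<le> liminf (\<lambda>k. 2 * (\<integral>\<^sup>+ x. conv (mollifier (d k)) v x \<partial>\<nu>) + ?e)"
    by (simp add: Liminf_add_const liminf_cmult_ennreal add_right_mono mult_left_mono)
  also have "\<dots> \<le> liminf (\<lambda>k. 2 * (\<integral>\<^sup>+ x. conv (mollifier (d k)) v x \<partial>swept_measure T \<nu>) + ?R)"
    by (intro Liminf_mono always_eventually allI energy_estimate_mollified v M le d nu fin T s)
  also have "\<dots> = 2 * ?J + ?R"
    by (intro lim_imp_Liminf tendsto_add ennreal_tendsto_cmult tendsto_const mollified) simp_all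
  finally show ?thesis .
qed

lemma kernel_energy_swept_measure_approx:
  assumes nu: "prob_space \<nu>" "sets \<nu> = sets borel" and fin: "kernel_energy K \<nu> \<nu> < \<infinity>" and e: "e > 0"
  obtains T where "T > 0" "kernel_energy K \<nu> \<nu> \<le> kernel_energy K \<nu> (swept_measure T \<nu>) + ennreal e"
proof -
  interpret nu: prob_space \<nu> by (rule nu)
  note nu(2)[measurable_cong]
  have nu_fin: "sigma_finite_measure \<nu>" by (rule nu.sigma_finite_measure_axioms)
  let ?T = "\<lambda>k. 1 / real (Suc k)" and ?E = "kernel_energy K \<nu>"
  have T: "?T k > 0" "?T \<longlonglongrightarrow> 0" for k
    using LIMSEQ_inverse_real_of_nat by (auto simp: divide_inverse)
  have U: "superharmonic (conv_measure K \<nu>)" by (intro superharmonic_potential nu_fin nu)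
  note borel_measurable_superharmonic[OF U, measurable]
  have "?E \<nu> \<le> (\<integral>\<^sup>+ x. liminf (\<lambda>k. conv (sweep (?T k)) (conv_measure K \<nu>) x) \<partial>\<nu>)"
    unfolding kernel_energy_def by (intro nn_integral_mono lsc_le_liminf_conv_sweep superharmonic_lsc U T)
  also have "\<dots> \<le> liminf (\<lambda>k. \<integral>\<^sup>+ x. conv (sweep (?T k)) (conv_measure K \<nu>) x \<partial>\<nu>)"
    by (rule nn_integral_liminf) measurable
  also have "\<dots> = liminf (\<lambda>k. ?E (swept_measure (?T k) \<nu>))"
    by (simp add: kernel_energy_def nn_integral_swept_measure[OF nu_fin nu(2)])
  finally have "?E \<nu> + ennreal e \<le> liminf (\<lambda>k. ?E (swept_measure (?T k) \<nu>) + ennreal e)"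
    by (simp add: Liminf_add_const add_right_mono)
  moreover have "?E \<nu> < ?E \<nu> + ennreal e" using fin e
    by (cases "?E \<nu>") (auto simp: ennreal_plus[symmetric] ennreal_less_iff simp del: ennreal_plus)
  ultimately have "?E \<nu> < liminf (\<lambda>k. ?E (swept_measure (?T k) \<nu>) + ennreal e)" by (rule less_le_trans[rotated])
  then have "\<forall>\<^sub>F k in sequentially. ?E \<nu> < ?E (swept_measure (?T k) \<nu>) + ennreal e" by (rule less_LiminfD)
  then obtain k where "?E \<nu> < ?E (swept_measure (?T k) \<nu>) + ennreal e"
    by (auto simp: eventually_sequentially)
  then show ?thesis using that[of "?T k"] by simp
qed

lemma nn_integral_swept_measure_uniform_approx:
  assumes M: "M \<ge> 0" and nu: "prob_space \<nu>" "sets \<nu> = sets borel" and fin: "kernel_energy K \<nu> \<nu> < \<infinity>" and e: "e > 0"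
  obtains T where "T > 0" "\<And>v. superharmonic v \<Longrightarrow> (\<And>x. v x \<le> ennreal M * swept 1 x) \<Longrightarrow>
    (\<integral>\<^sup>+ x. v x \<partial>\<nu>) \<le> (\<integral>\<^sup>+ x. v x \<partial>swept_measure T \<nu>) + ennreal e"
proof -
  let ?E = "kernel_energy K \<nu>"
  define B where "B = M * M * swept_bound 1"
  have B: "B \<ge> 0" using swept_bound_nonneg M by (simp add: B_def)
  define s where "s = e / (B + 1)"
  have s: "s > 0" "s * B \<le> e" using e B by (simp_all add: s_def field_simps)
  obtain T where T: "T > 0" "?E \<nu> \<le> ?E (swept_measure T \<nu>) + ennreal (s * e)"
    using kernel_energy_swept_measure_approx[OF nu fin, of "s * e"] e s by auto
  have mixed_fin: "?E (swept_measure T \<nu>) \<noteq> \<infinity>"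
    using kernel_energy_swept_measure_le(1)[OF nu T(1)] fin by (auto simp: top_unique)
  have "(\<integral>\<^sup>+ x. v x \<partial>\<nu>) \<le> (\<integral>\<^sup>+ x. v x \<partial>swept_measure T \<nu>) + ennreal e"
    if v: "superharmonic v" "\<And>x. v x \<le> ennreal M * swept 1 x" for v
  proof -
    have "ennreal (1 / s) * ?E (swept_measure T \<nu>) + 2 * (\<integral>\<^sup>+ x. v x \<partial>\<nu>)
        \<le> 2 * (\<integral>\<^sup>+ x. v x \<partial>swept_measure T \<nu>) + (ennreal (s * B) + ennreal (1 / s) * ?E \<nu>)"
      using energy_estimate[OF v(1) M v(2) nu fin T(1) s(1)] by (simp add: B_def add.commute)
    also have "\<dots> \<le> 2 * (\<integral>\<^sup>+ x. v x \<partial>swept_measure T \<nu>)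
        + (ennreal e + ennreal (1 / s) * (?E (swept_measure T \<nu>) + ennreal (s * e)))"
      using s T(2) by (intro add_left_mono add_mono mult_left_mono ennreal_leI) auto
    also have "ennreal (1 / s) * (?E (swept_measure T \<nu>) + ennreal (s * e))
        = ennreal (1 / s) * ?E (swept_measure T \<nu>) + ennreal e"
      using s e by (simp add: distrib_left ennreal_mult[symmetric])
    finally have "ennreal (1 / s) * ?E (swept_measure T \<nu>) + 2 * (\<integral>\<^sup>+ x. v x \<partial>\<nu>)
        \<le> ennreal (1 / s) * ?E (swept_measure T \<nu>) + 2 * ((\<integral>\<^sup>+ x. v x \<partial>swept_measure T \<nu>) + ennreal e)"
      by (simp add: distrib_left add_ac mult_2)
    then have "2 * (\<integral>\<^sup>+ x. v x \<partial>\<nu>) \<le> 2 * ((\<integral>\<^sup>+ x. v x \<partial>swept_measure T \<nu>) + ennreal e)"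
      using mixed_fin by (simp add: ennreal_add_left_cancel_le ennreal_mult_eq_top_iff)
    then show ?thesis by (subst (asm) ennreal_mult_le_mult_iff) auto
  qed
  then show ?thesis by (rule that[OF T(1)])
qed

end

section \<open>Sets of inner capacity zero\<close>

lemma radon_pos_sets: "radon_pos \<mu> \<Longrightarrow> sets \<mu> = sets borel"
  by (simp add: radon_pos_def)

lemma radon_pos_space: "radon_pos \<mu> \<Longrightarrow> space \<mu> = UNIV"
  using sets_eq_imp_space_eq[of \<mu> borel] by (simp add: radon_pos_def)

lemma radon_pos_sigma_finite:
  assumes "radon_pos (\<mu> :: 'a::euclidean_space measure)" shows "sigma_finite_measure \<mu>"
proof
  have "(\<Union>n. cball (0::'a) (real n)) = UNIV" by (auto simp: real_arch_simple)
  then show "\<exists>A. countable A \<and> A \<subseteq> sets \<mu> \<and> \<Union>A = space \<mu> \<and> (\<forall>a\<in>A. emeasure \<mu> a \<noteq> \<infinity>)"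
    using assms radon_pos_space[OF assms]
    by (intro exI[of _ "range (\<lambda>n. cball (0::'a) (real n))"]) (auto simp: radon_pos_def less_top)
qed

lemma radon_pos_finite_measure:
  assumes "finite_measure \<mu>" "sets \<mu> = sets borel" shows "radon_pos \<mu>"
  using assms by (simp add: radon_pos_def less_top[symmetric] finite_measure.emeasure_finite)

lemma concentrated_on_iff_AE: "space \<mu> = UNIV \<Longrightarrow> concentrated_on \<mu> A \<longleftrightarrow> (AE x in \<mu>. x \<in> A)"
  by (auto simp: concentrated_on_def eventually_ae_filter subset_eq)

lemma inner_cap_eq_0_iff:
  "inner_cap \<alpha> A = 0 \<longleftrightarrow> \<not> (\<exists>\<nu>. prob_space \<nu> \<and> sets \<nu> = sets borel \<and> energy \<alpha> \<nu> < \<infinity> \<and> (AE x in \<nu>. x \<in> A))"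
proof -
  let ?S = "{\<nu>. radon_pos \<nu> \<and> energy \<alpha> \<nu> < \<infinity> \<and> concentrated_on \<nu> A \<and> emeasure \<nu> UNIV = 1}"
  have "inner_cap \<alpha> A = 0 \<longleftrightarrow> ?S = {}"
    by (auto simp: inner_cap_def INF_top_conv)
  moreover have "\<nu> \<in> ?S \<longleftrightarrow> prob_space \<nu> \<and> sets \<nu> = sets borel \<and> energy \<alpha> \<nu> < \<infinity> \<and> (AE x in \<nu>. x \<in> A)" for \<nu>
  proof
    assume "\<nu> \<in> ?S"
    then show "prob_space \<nu> \<and> sets \<nu> = sets borel \<and> energy \<alpha> \<nu> < \<infinity> \<and> (AE x in \<nu>. x \<in> A)"
      by (auto simp: radon_pos_sets radon_pos_space concentrated_on_iff_AE intro!: prob_spaceI)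
  next
    assume prob: "prob_space \<nu> \<and> sets \<nu> = sets borel \<and> energy \<alpha> \<nu> < \<infinity> \<and> (AE x in \<nu>. x \<in> A)"
    then have "radon_pos \<nu>"
      by (intro radon_pos_finite_measure) (auto simp: prob_space_def)
    then show "\<nu> \<in> ?S"
      using prob prob_space.emeasure_space_1[of \<nu>] by (simp add: radon_pos_space concentrated_on_iff_AE)
  qed
  ultimately show ?thesis by blast
qed

lemma inner_cap_eq_0_mono: "inner_cap \<alpha> B = 0 \<Longrightarrow> A \<subseteq> B \<Longrightarrow> inner_cap \<alpha> A = 0"
  unfolding inner_cap_eq_0_iff by (blast intro: eventually_mono)

lemma nearly_everywhere_on_iff:
  "nearly_everywhere_on \<alpha> A P \<longleftrightarrow> inner_cap \<alpha> {x \<in> A. \<not> P x} = 0"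
proof
  assume "nearly_everywhere_on \<alpha> A P"
  then obtain N where "inner_cap \<alpha> N = 0" "\<forall>x\<in>A - N. P x" unfolding nearly_everywhere_on_def by blast
  then show "inner_cap \<alpha> {x \<in> A. \<not> P x} = 0" by (elim inner_cap_eq_0_mono) auto
next
  assume "inner_cap \<alpha> {x \<in> A. \<not> P x} = 0"
  then show "nearly_everywhere_on \<alpha> A P"
    unfolding nearly_everywhere_on_def by (intro exI[of _ "{x \<in> A. \<not> P x}"]) auto
qed

lemma energy_uniform_measure_le:
  fixes \<nu> :: "'a::euclidean_space measure"
  assumes "sigma_finite_measure \<nu>" and [measurable_cong]: "sets \<nu> = sets borel"
    and S [measurable]: "S \<in> sets borel"
  shows "energy \<alpha> (uniform_measure \<nu> S) \<le> energy \<alpha> \<nu> / emeasure \<nu> S / emeasure \<nu> S"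
proof -
  interpret sigma_finite_measure \<nu> by fact
  let ?c = "emeasure \<nu> S"
  have int_le: "(\<integral>\<^sup>+ x. f x \<partial>uniform_measure \<nu> S) \<le> (\<integral>\<^sup>+ x. f x \<partial>\<nu>) / ?c"
    if [measurable]: "f \<in> borel_measurable borel" for f
    by (subst nn_integral_uniform_measure)
      (auto intro!: divide_right_mono_ennreal nn_integral_mono split: split_indicator)
  have [measurable]: "case_prod (riesz_kernel \<alpha>) \<in> borel_measurable (borel \<Otimes>\<^sub>M (borel :: 'a measure))"
    unfolding riesz_kernel_def case_prod_unfold by measurable
  have "energy \<alpha> (uniform_measure \<nu> S) \<le> (\<integral>\<^sup>+ x. (\<integral>\<^sup>+ y. riesz_kernel \<alpha> x y \<partial>\<nu>) / ?c \<partial>uniform_measure \<nu> S)"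
    unfolding energy_def mutual_energy_def by (intro nn_integral_mono int_le) measurable
  also have "\<dots> \<le> (\<integral>\<^sup>+ x. (\<integral>\<^sup>+ y. riesz_kernel \<alpha> x y \<partial>\<nu>) / ?c \<partial>\<nu>) / ?c"
    by (rule int_le) measurable
  also have "\<dots> = energy \<alpha> \<nu> / ?c / ?c"
    by (subst nn_integral_divide) (auto simp: energy_def mutual_energy_def)
  finally show ?thesis .
qed

lemma inner_cap_eq_0_imp_null:
  assumes nu: "prob_space \<nu>" "sets \<nu> = sets borel" "energy \<alpha> \<nu> < \<infinity>" "AE x in \<nu>. x \<in> A"
    and S: "S \<in> sets borel" and cap: "inner_cap \<alpha> (A \<inter> S) = 0"
  shows "emeasure \<nu> S = 0"
proof (rule ccontr)
  assume pos: "emeasure \<nu> S \<noteq> 0"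
  interpret prob_space \<nu> by fact
  have fin: "emeasure \<nu> S \<noteq> \<infinity>" by simp
  have "energy \<alpha> (uniform_measure \<nu> S) \<le> energy \<alpha> \<nu> / emeasure \<nu> S / emeasure \<nu> S"
    by (rule energy_uniform_measure_le) (simp_all add: nu S sigma_finite_measure_axioms)
  also have "\<dots> < \<infinity>" using nu(3) pos by (simp add: less_top[symmetric] ennreal_divide_eq_top_iff)
  finally have "energy \<alpha> (uniform_measure \<nu> S) < \<infinity>" .
  moreover have "AE x in uniform_measure \<nu> S. x \<in> A \<inter> S"
    using nu(4) by (intro AE_uniform_measureI) (auto simp: S nu(2) elim!: eventually_mono)
  ultimately show False
    using cap prob_space_uniform_measure[OF pos fin] nu(2) unfolding inner_cap_eq_0_iff by auto
qed

lemma inner_cap_eq_0_UN: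
  fixes U :: "nat \<Rightarrow> 'a::euclidean_space set"
  assumes U: "\<And>j. universally_measurable (U j)" and cover: "A \<subseteq> (\<Union>j. U j)"
    and cap: "\<And>j. inner_cap \<alpha> (A \<inter> U j) = 0"
  shows "inner_cap \<alpha> A = 0"
  unfolding inner_cap_eq_0_iff
proof (rule notI, elim exE conjE)
  fix \<nu> :: "'a measure"
  assume nu: "prob_space \<nu>" "sets \<nu> = sets borel" "energy \<alpha> \<nu> < \<infinity>" "AE x in \<nu>. x \<in> A"
  interpret prob_space \<nu> by fact
  have rad: "radon_pos \<nu>" by (rule radon_pos_finite_measure) (simp_all add: nu finite_measure_axioms)
  have "AE x in \<nu>. x \<notin> U j" for j
  proof -
    have "U j \<in> sets (completion \<nu>)" using U rad by (auto simp: universally_measurable_def)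
    then obtain S N N' where S: "U j = S \<union> N" "N \<subseteq> N'" "N' \<in> null_sets \<nu>" "S \<in> sets \<nu>"
      by (elim sets_completionE)
    have "inner_cap \<alpha> (A \<inter> S) = 0" using cap[of j] by (rule inner_cap_eq_0_mono) (use S in auto)
    then have "emeasure \<nu> S = 0" using S(4) nu(2) by (intro inner_cap_eq_0_imp_null[OF nu]) auto
    then have "AE x in \<nu>. x \<notin> S" using S(4) by (intro AE_not_in) auto
    with AE_not_in[OF S(3)] show ?thesis by eventually_elim (use S in auto)
  qed
  then have "AE x in \<nu>. \<forall>j. x \<notin> U j" by (simp add: AE_all_countable)
  with nu(4) have "AE x in \<nu>. False" by eventually_elim (use cover in auto)
  then show False by (simp add: AE_False)
qed

lemma nearly_everywhere_on_iff_AE: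
  fixes P :: "'a::euclidean_space \<Rightarrow> bool"
  assumes P: "{x. \<not> P x} \<in> sets borel"
  shows "nearly_everywhere_on \<alpha> A P \<longleftrightarrow>
    (\<forall>\<nu>. prob_space \<nu> \<longrightarrow> sets \<nu> = sets borel \<longrightarrow> energy \<alpha> \<nu> < \<infinity> \<longrightarrow> (AE x in \<nu>. x \<in> A) \<longrightarrow> (AE x in \<nu>. P x))"
proof (intro iffI allI impI)
  fix \<nu> :: "'a measure"
  assume "nearly_everywhere_on \<alpha> A P"
    and nu: "prob_space \<nu>" "sets \<nu> = sets borel" "energy \<alpha> \<nu> < \<infinity>" "AE x in \<nu>. x \<in> A"
  then have "inner_cap \<alpha> (A \<inter> {x. \<not> P x}) = 0" by (simp add: nearly_everywhere_on_iff Int_def)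
  then have "{x. \<not> P x} \<in> null_sets \<nu>" using P nu(2) by (intro null_setsI inner_cap_eq_0_imp_null[OF nu]) auto
  then show "AE x in \<nu>. P x" by (intro AE_I'[where N="{x. \<not> P x}"]) auto
next
  assume AE: "\<forall>\<nu>. prob_space \<nu> \<longrightarrow> sets \<nu> = sets borel \<longrightarrow> energy \<alpha> \<nu> < \<infinity> \<longrightarrow> (AE x in \<nu>. x \<in> A) \<longrightarrow> (AE x in \<nu>. P x)"
  show "nearly_everywhere_on \<alpha> A P" unfolding nearly_everywhere_on_iff inner_cap_eq_0_iff
  proof (rule notI, elim exE conjE)
    fix \<nu> :: "'a measure"
    assume nu: "prob_space \<nu>" "sets \<nu> = sets borel" "energy \<alpha> \<nu> < \<infinity>" "AE x in \<nu>. x \<in> {x \<in> A. \<not> P x}"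
    interpret prob_space \<nu> by fact
    have "AE x in \<nu>. x \<in> A" using nu(4) by eventually_elim simp
    then have "AE x in \<nu>. P x" using AE nu by blast
    with nu(4) have "AE x in \<nu>. False" by eventually_elim simp
    then show False by (simp add: AE_False)
  qed
qed

section \<open>Infima of superharmonic functions\<close>

lemma INF_eq_INF_sequence:
  fixes \<phi> :: "'b \<Rightarrow> ennreal"
  assumes "F \<noteq> {}"
  shows "\<exists>f. range f \<subseteq> F \<and> (INF g\<in>F. \<phi> g) = (INF i::nat. \<phi> (f i))"
proof -
  have "\<phi> ` F \<noteq> {}" using assms by auto
  from ennreal_Inf_countable_INF[OF this] obtain a :: "nat \<Rightarrow> ennreal"
    where a: "range a \<subseteq> \<phi> ` F" "(INF g\<in>F. \<phi> g) = (INF i. a i)"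
    by auto
  then have "\<forall>i. \<exists>g\<in>F. a i = \<phi> g" by (auto simp: image_iff subset_eq)
  then obtain f where "\<And>i. f i \<in> F \<and> a i = \<phi> (f i)" by metis
  then show ?thesis using a(2) by (intro exI[of _ f]) auto
qed

lemma choquet_countable_subfamily:
  fixes F :: "('a::second_countable_topology \<Rightarrow> ennreal) set"
  assumes "F \<noteq> {}"
  obtains f :: "nat \<Rightarrow> 'a \<Rightarrow> ennreal" where "range f \<subseteq> F"
    "\<And>h g x. lsc h \<Longrightarrow> (\<And>j x. h x \<le> f j x) \<Longrightarrow> g \<in> F \<Longrightarrow> h x \<le> g x"
proof -
  obtain \<B> :: "'a set set" where B: "countable \<B>" "topological_basis \<B>"
    using ex_countable_basis by blast
  have "\<exists>f. range f \<subseteq> F \<and> (INF g\<in>F. INF y\<in>V. g y) = (INF i::nat. INF y\<in>V. f i y)" for V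
    by (rule INF_eq_INF_sequence[OF assms])
  then obtain fs where fs: "\<And>V. range (fs V) \<subseteq> F" "\<And>V. (INF g\<in>F. INF y\<in>V. g y) = (INF i::nat. INF y\<in>V. fs V i y)"
    by metis
  obtain g0 where g0: "g0 \<in> F" using assms by auto
  define F' where "F' = insert g0 (\<Union>V\<in>\<B>. range (fs V))"
  have F': "countable F'" "F' \<noteq> {}" "F' \<subseteq> F" using B(1) fs(1) g0 by (auto simp: F'_def)
  have range: "range (from_nat_into F') = F'" using F' by (simp add: range_from_nat_into)
  show ?thesis
  proof (rule that[of "from_nat_into F'"])
    fix h g and x :: 'a
    assume h: "lsc h" and le: "\<And>j x. h x \<le> from_nat_into F' j x" and g: "g \<in> F"
    show "h x \<le> g x"
    proof (rule dense_le)
      fix a assume "a < h x"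
      then obtain V where V: "V \<in> \<B>" "x \<in> V" "V \<subseteq> {y. a < h y}"
        using topological_basisE[OF B(2), of "{y. a < h y}" x] h by (auto simp: lsc_def)
      have "a \<le> fs V i y" if "y \<in> V" for i y
      proof -
        have "fs V i \<in> range (from_nat_into F')" using V(1) unfolding range by (auto simp: F'_def)
        then show ?thesis using le[of y] V(3) that by (force intro: less_imp_le less_le_trans)
      qed
      then have "a \<le> (INF i. INF y\<in>V. fs V i y)" by (intro INF_greatest)
      also have "\<dots> = (INF g\<in>F. INF y\<in>V. g y)" by (rule fs(2)[symmetric])
      also have "\<dots> \<le> g x" using g V(2) by (intro INF_lower2[of g] INF_lower) auto
      finally show "a \<le> g x" .
    qed
  qed (use range F' in simp)
qed

lemma INF_INF_atMost:
  fixes f :: "nat \<Rightarrow> 'a::complete_lattice"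
  shows "(INF j. INF i\<in>{..j}. f i) = (INF j. f j)"
  by (rule antisym) (auto intro!: INF_greatest intro: INF_lower INF_lower2[OF UNIV_I])

lemma le_of_min_of_nat_mult_le:
  fixes a b h :: ennreal
  assumes "h \<noteq> 0" and le: "\<And>m::nat. min b (of_nat m * h) \<le> a"
  shows "b \<le> a"
proof (rule ccontr)
  assume "\<not> b \<le> a"
  then have "of_nat m * h \<le> a" for m using le[of m] by (auto simp: min_le_iff_disj)
  then have "(SUP m::nat. of_nat m * h) \<le> a" by (rule SUP_least)
  then have "a = \<top>"
    using assms(1) by (simp add: SUP_mult_right_ennreal[symmetric] ennreal_SUP_of_nat_eq_top ennreal_top_mult top_unique)
  then show False using \<open>\<not> b \<le> a\<close> by simp
qed

context riesz_potential
begin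

lemma nn_integral_INF_le_conv_sweep:
  fixes f :: "nat \<Rightarrow> 'a \<Rightarrow> ennreal"
  assumes f: "\<And>j. superharmonic (f j)" and dec: "\<And>x. decseq (\<lambda>j. f j x)"
    and M: "M \<ge> 0" and le: "\<And>j x. f j x \<le> ennreal M * swept 1 x"
    and nu: "prob_space \<nu>" "sets \<nu> = sets borel" and fin: "kernel_energy K \<nu> \<nu> < \<infinity>" and e: "e > 0"
  obtains T where "T > 0"
    "(\<integral>\<^sup>+ x. (INF j. f j x) \<partial>\<nu>) \<le> (\<integral>\<^sup>+ x. conv (sweep T) (\<lambda>x. INF j. f j x) x \<partial>\<nu>) + ennreal e"
proof -
  interpret prob_space \<nu> by (rule nu)
  note borel_measurable_superharmonic[OF f, measurable]
  define w where "w = (\<lambda>x. INF j. f j x)"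
  have [measurable]: "w \<in> borel_measurable borel" unfolding w_def by measurable
  have bound: "f j x \<le> ennreal (M * swept_bound 1)" for j x by (intro le_swept_imp_bounded le M)
  have w_le: "w x \<le> f j x" for j x unfolding w_def by (rule INF_lower) simp
  obtain T where T: "T > 0" and approx: "\<And>v. superharmonic v \<Longrightarrow> (\<And>x. v x \<le> ennreal M * swept 1 x) \<Longrightarrow>
      (\<integral>\<^sup>+ x. v x \<partial>\<nu>) \<le> (\<integral>\<^sup>+ x. v x \<partial>swept_measure T \<nu>) + ennreal e"
    using nn_integral_swept_measure_uniform_approx[OF M nu fin e] by metis
  interpret swept: prob_space "swept_measure T \<nu>" by (rule prob_space_swept_measure[OF nu T])
  have "(\<lambda>j. \<integral>\<^sup>+ x. f j x \<partial>swept_measure T \<nu>) \<longlonglongrightarrow> (\<integral>\<^sup>+ x. w x \<partial>swept_measure T \<nu>)"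
    using bound LIMSEQ_INF[OF dec]
    by (intro nn_integral_dominated_convergence[where w="\<lambda>_. ennreal (M * swept_bound 1)"])
      (auto simp: w_def swept.emeasure_space_1)
  then have "(\<lambda>j. (\<integral>\<^sup>+ x. f j x \<partial>swept_measure T \<nu>) + ennreal e) \<longlonglongrightarrow> (\<integral>\<^sup>+ x. w x \<partial>swept_measure T \<nu>) + ennreal e"
    by (intro tendsto_add tendsto_const)
  moreover have "(\<integral>\<^sup>+ x. w x \<partial>\<nu>) \<le> (\<integral>\<^sup>+ x. f j x \<partial>swept_measure T \<nu>) + ennreal e" for j
    using nn_integral_mono[of \<nu> w "f j", OF w_le] approx[OF f le] by (rule order_trans)
  ultimately have "(\<integral>\<^sup>+ x. w x \<partial>\<nu>) \<le> (\<integral>\<^sup>+ x. w x \<partial>swept_measure T \<nu>) + ennreal e"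
    by (intro LIMSEQ_le_const) auto
  also have "(\<integral>\<^sup>+ x. w x \<partial>swept_measure T \<nu>) = (\<integral>\<^sup>+ x. conv (sweep T) w x \<partial>\<nu>)"
    by (rule nn_integral_swept_measure) (simp_all add: nu sigma_finite_measure_axioms)
  finally show ?thesis unfolding w_def by (rule that[OF T])
qed

lemma decreasing_superharmonic_limit_le_AE:
  fixes f :: "nat \<Rightarrow> 'a \<Rightarrow> ennreal"
  assumes f: "\<And>j. superharmonic (f j)" and dec: "\<And>x. decseq (\<lambda>j. f j x)"
    and M: "M \<ge> 0" and le: "\<And>j x. f j x \<le> ennreal M * swept 1 x"
    and [measurable]: "u \<in> borel_measurable borel"
    and u: "\<And>T x. T > 0 \<Longrightarrow> conv (sweep T) (\<lambda>x. INF j. f j x) x \<le> u x"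
    and nu: "prob_space \<nu>" "sets \<nu> = sets borel" and fin: "kernel_energy K \<nu> \<nu> < \<infinity>"
  shows "AE x in \<nu>. (INF j. f j x) \<le> u x"
proof -
  interpret prob_space \<nu> by (rule nu)
  note nu(2)[measurable_cong] borel_measurable_superharmonic[OF f, measurable]
  define w where "w = (\<lambda>x. INF j. f j x)"
  have [measurable]: "w \<in> borel_measurable borel" unfolding w_def by measurable
  have w_le: "w x \<le> f j x" for j x unfolding w_def by (rule INF_lower) simp
  have sweep_le: "conv (sweep T) w x \<le> min (u x) (w x)" if T: "T > 0" for T x
  proof (rule min.boundedI)
    show "conv (sweep T) w x \<le> u x" using u[OF T] by (simp add: w_def)
    have "conv (sweep T) w x \<le> f j x" for j
      by (rule order_trans[OF conv_mono superharmonic_conv_sweep_le[OF f T]]) (simp_all add: w_le)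
    then show "conv (sweep T) w x \<le> w x" unfolding w_def by (intro INF_greatest)
  qed
  have "(\<integral>\<^sup>+ x. w x \<partial>\<nu>) \<le> (\<integral>\<^sup>+ x. min (u x) (w x) \<partial>\<nu>)"
  proof (rule ennreal_le_epsilon)
    fix e :: real assume "e > 0"
    then obtain T where T: "T > 0"
      and w: "(\<integral>\<^sup>+ x. w x \<partial>\<nu>) \<le> (\<integral>\<^sup>+ x. conv (sweep T) w x \<partial>\<nu>) + ennreal e"
      unfolding w_def by (rule nn_integral_INF_le_conv_sweep[OF f dec M le nu fin])
    note w
    also have "(\<integral>\<^sup>+ x. conv (sweep T) w x \<partial>\<nu>) \<le> (\<integral>\<^sup>+ x. min (u x) (w x) \<partial>\<nu>)"
      by (intro nn_integral_mono sweep_le T)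
    finally show "(\<integral>\<^sup>+ x. w x \<partial>\<nu>) \<le> (\<integral>\<^sup>+ x. min (u x) (w x) \<partial>\<nu>) + ennreal e" by (simp add: add_right_mono)
  qed
  moreover have "(\<integral>\<^sup>+ x. min (u x) (w x) \<partial>\<nu>) \<noteq> \<infinity>"
  proof -
    have "w x \<le> ennreal (M * swept_bound 1)" for x
      using w_le[of x 0] le_swept_imp_bounded[OF le M] by (rule order_trans)
    then have "(\<integral>\<^sup>+ x. min (u x) (w x) \<partial>\<nu>) \<le> (\<integral>\<^sup>+ x. ennreal (M * swept_bound 1) \<partial>\<nu>)"
      by (intro nn_integral_mono) (simp add: min.coboundedI2)
    then show ?thesis by (auto simp: emeasure_space_1 top_unique)
  qed
  ultimately have "AE x in \<nu>. w x \<le> min (u x) (w x)"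
    using nn_integral_less[of "\<lambda>x. min (u x) (w x)" \<nu> w] by (auto simp: not_less[symmetric])
  then show ?thesis by (simp add: w_def)
qed

lemma INF_superharmonic_le_AE:
  fixes f :: "nat \<Rightarrow> 'a \<Rightarrow> ennreal"
  assumes f: "\<And>j. superharmonic (f j)" and [measurable]: "u \<in> borel_measurable borel"
    and u: "\<And>T x. T > 0 \<Longrightarrow> conv (sweep T) (\<lambda>x. INF j. f j x) x \<le> u x"
    and nu: "prob_space \<nu>" "sets \<nu> = sets borel" and fin: "kernel_energy K \<nu> \<nu> < \<infinity>"
  shows "AE x in \<nu>. (INF j. f j x) \<le> u x"
proof -
  define v where "v = (\<lambda>(m::nat) j x. min (INF i\<in>{..j}. f i x) (of_nat m * swept 1 x))"
  have INF_v: "(INF j. v m j x) = min (INF j. f j x) (of_nat m * swept 1 x)" for m x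
    by (simp add: v_def inf_min[symmetric] INF_inf_const2[symmetric] INF_INF_atMost)
  have "AE x in \<nu>. (INF j. v m j x) \<le> u x" for m
  proof (rule decreasing_superharmonic_limit_le_AE[OF _ _ _ _ _ _ nu fin])
    show "superharmonic (v m j)" for j
      unfolding v_def
      by (intro superharmonic_min superharmonic_INF_atMost superharmonic_cmult superharmonic_swept f)
        (simp_all add: of_nat_less_top)
    show "decseq (\<lambda>j. v m j x)" for x
      unfolding v_def by (intro decseq_SucI min.mono INF_superset_mono) auto
    show "v m j x \<le> ennreal (real m) * swept 1 x" for j x
      by (simp add: v_def ennreal_of_nat_eq_real_of_nat)
    show "conv (sweep T) (\<lambda>x. INF j. v m j x) x \<le> u x" if "T > 0" for T x
      unfolding INF_v by (rule order_trans[OF conv_mono u[OF that]]) simp_all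
  qed auto
  then have "AE x in \<nu>. \<forall>m. (INF j. v m j x) \<le> u x" by (simp add: AE_all_countable)
  then show ?thesis
    unfolding INF_v
  proof eventually_elim
    show "(INF j. f j x) \<le> u x" if "\<forall>m. min (INF j. f j x) (of_nat m * swept 1 x) \<le> u x" for x
      by (rule le_of_min_of_nat_mult_le[OF swept_neq_0[of 1 x]]) (use that in simp_all)
  qed
qed

lemma potential_eq: "potential \<alpha> \<eta> = conv_measure K \<eta>"
  by (simp add: fun_eq_iff potential_def conv_measure_def riesz_kernel_eq)

lemma mutual_energy_eq: "mutual_energy \<alpha> \<nu> \<eta> = kernel_energy K \<eta> \<nu>"
  by (simp add: mutual_energy_def kernel_energy_def conv_measure_def riesz_kernel_eq)

lemma energy_eq: "energy \<alpha> \<nu> = kernel_energy K \<nu> \<nu>"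
  by (simp add: energy_def mutual_energy_eq)

lemma superharmonic_potential_radon: "radon_pos \<eta> \<Longrightarrow> superharmonic (potential \<alpha> \<eta>)"
  unfolding potential_eq by (intro superharmonic_potential radon_pos_sigma_finite radon_pos_sets)

lemma measurable_potential [measurable]: "radon_pos \<eta> \<Longrightarrow> potential \<alpha> \<eta> \<in> borel_measurable borel"
  for \<eta> :: "'a measure"
  by (intro borel_measurable_superharmonic superharmonic_potential_radon)

lemma cartan_countable_subfamily:
  fixes F :: "('a \<Rightarrow> ennreal) set"
  assumes F: "F \<noteq> {}" "\<And>g. g \<in> F \<Longrightarrow> superharmonic g" and meas: "(\<lambda>x. INF g\<in>F. g x) \<in> borel_measurable borel"
  obtains f :: "nat \<Rightarrow> 'a \<Rightarrow> ennreal" where "range f \<subseteq> F"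
    "\<And>\<nu>. prob_space \<nu> \<Longrightarrow> sets \<nu> = sets borel \<Longrightarrow> energy \<alpha> \<nu> < \<infinity> \<Longrightarrow> AE x in \<nu>. (INF j. f j x) \<le> (INF g\<in>F. g x)"
proof -
  obtain f :: "nat \<Rightarrow> 'a \<Rightarrow> ennreal" where f: "range f \<subseteq> F"
    and minorant: "\<And>h g x. lsc h \<Longrightarrow> (\<And>j x. h x \<le> f j x) \<Longrightarrow> g \<in> F \<Longrightarrow> h x \<le> g x"
    using choquet_countable_subfamily[OF F(1)] by metis
  have f_super: "superharmonic (f j)" for j using f F(2) by auto
  note borel_measurable_superharmonic[OF f_super, measurable]
  have "conv (sweep T) (\<lambda>x. INF j. f j x) x \<le> (INF g\<in>F. g x)" if T: "T > 0" for T x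
  proof (rule INF_greatest, rule minorant)
    show "lsc (conv (sweep T) (\<lambda>x. INF j. f j x))" by (intro lsc_conv lsc_sweep) measurable
    show "conv (sweep T) (\<lambda>x. INF j. f j x) y \<le> f j y" for j y
      by (rule order_trans[OF conv_mono superharmonic_conv_sweep_le[OF f_super T]]) (auto intro: INF_lower)
  qed
  then show ?thesis
    using f by (intro that[of f] INF_superharmonic_le_AE f_super meas) (auto simp: energy_eq)
qed

end

section \<open>Vague compactness\<close>

definition tooth :: "real \<Rightarrow> real" where
  "tooth y = max 0 (min 1 (1 / 2 - cos (pi * y)))"

lemma tooth_bounds: "0 \<le> tooth y" "tooth y \<le> 1" by (auto simp: tooth_def)

lemma continuous_tooth: "continuous_on UNIV tooth"
  unfolding tooth_def[abs_def] by (intro continuous_intros)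

lemma tooth_periodic: "tooth (2 * of_int k + y) = tooth y"
proof -
  have "pi * (2 * of_int k + y) = pi * y + of_int (2 * k) * pi" by (simp add: algebra_simps)
  then have "cos (pi * (2 * of_int k + y)) = cos (pi * y)"
    using cos_int_2pin[of k] sin_int_2pin[of k] by (simp add: cos_add mult_ac)
  then show ?thesis by (simp add: tooth_def)
qed

lemma tooth_low: assumes "0 \<le> y" "y \<le> 1 / 3" shows "tooth y = 0"
proof -
  have "pi * y \<le> pi * (1 / 3)" using assms by (intro mult_left_mono) auto
  then have "cos (pi / 3) \<le> cos (pi * y)" using assms pi_gt_zero
    by (intro cos_monotone_0_pi_le) auto
  then show ?thesis by (simp add: tooth_def cos_60)
qed

lemma tooth_high: assumes "2 / 3 \<le> y" "y \<le> 1" shows "tooth y = 1"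
proof -
  have "0 \<le> 1 - y" "1 - y \<le> 1 / 3" using assms by auto
  then have "pi * (1 - y) \<le> pi * (1 / 3)" by (intro mult_left_mono) auto
  then have "cos (pi / 3) \<le> cos (pi * (1 - y))" using assms pi_gt_zero
    by (intro cos_monotone_0_pi_le) auto
  moreover have "cos (pi * (1 - y)) = - cos (pi * y)" by (simp add: right_diff_distrib)
  ultimately show ?thesis by (simp add: tooth_def cos_60)
qed

definition ternary :: "(nat \<Rightarrow> real) \<Rightarrow> real" where
  "ternary d = (\<Sum>l. 2 * d l / 3 ^ Suc l)"

lemma ternary_summable:
  assumes "\<And>l. d l \<in> {0, 1::real}" shows "summable (\<lambda>l. 2 * d l / 3 ^ Suc l)"
proof (rule summable_comparison_test')
  show "summable (\<lambda>l. 2 / 3 * (1 / 3 :: real) ^ l)" by (intro summable_mult summable_geometric) auto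
  show "norm (2 * d l / 3 ^ Suc l) \<le> 2 / 3 * (1 / 3 :: real) ^ l" if "l \<ge> 0" for l
    using assms[of l] by (auto simp: power_divide)
qed

lemma ternary_bounds:
  assumes d: "\<And>l. d l \<in> {0, 1::real}" shows "0 \<le> ternary d" "ternary d \<le> 1"
proof -
  have nn: "0 \<le> 2 * d l / 3 ^ Suc l" for l using d[of l] by auto
  show "0 \<le> ternary d" unfolding ternary_def by (intro suminf_nonneg ternary_summable d nn)
  have s: "summable (\<lambda>l. 2 / 3 * (1 / 3 :: real) ^ l)" by (intro summable_mult summable_geometric) auto
  have "ternary d \<le> (\<Sum>l. 2 / 3 * (1 / 3 :: real) ^ l)"
    unfolding ternary_def
  proof (intro suminf_le ternary_summable d s)
    show "2 * d l / 3 ^ Suc l \<le> 2 / 3 * (1 / 3) ^ l" for l using d[of l] by (auto simp: power_divide)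
  qed
  also have "\<dots> = 2 / 3 * (1 / (1 - 1 / 3))"
    by (subst suminf_mult) (auto intro: summable_geometric simp: suminf_geometric)
  finally show "ternary d \<le> 1" by simp
qed

lemma ternary_Suc:
  assumes d: "\<And>l. d l \<in> {0, 1::real}"
  shows "3 * ternary d = 2 * d 0 + ternary (\<lambda>l. d (Suc l))"
proof -
  have "ternary d = (\<Sum>l. 2 * d (Suc l) / 3 ^ Suc (Suc l)) + 2 * d 0 / 3"
    unfolding ternary_def using suminf_split_head[OF ternary_summable[of d]] d by simp
  also have "(\<Sum>l. 2 * d (Suc l) / 3 ^ Suc (Suc l)) = (\<Sum>l. (1 / 3) * (2 * d (Suc l) / 3 ^ Suc l))" by simp
  also have "\<dots> = 1 / 3 * ternary (\<lambda>l. d (Suc l))"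
    unfolding ternary_def by (rule suminf_mult) (rule ternary_summable, rule d)
  finally show ?thesis by simp
qed

lemma ternary_shift:
  assumes d: "\<And>l. d l \<in> {0, 1::real}"
  shows "\<exists>k::int. 3 ^ l * ternary d = 2 * of_int k + ternary (\<lambda>j. d (j + l))"
proof (induction l)
  case 0 show ?case by (intro exI[of _ 0]) simp
next
  case (Suc l)
  then obtain k :: int where k: "3 ^ l * ternary d = 2 * of_int k + ternary (\<lambda>j. d (j + l))" by auto
  have "3 ^ Suc l * ternary d = 3 * (3 ^ l * ternary d)" by simp
  also have "\<dots> = 6 * of_int k + 3 * ternary (\<lambda>j. d (j + l))" using k by simp
  also have "3 * ternary (\<lambda>j. d (j + l)) = 2 * d l + ternary (\<lambda>j. d (j + Suc l))"
    using ternary_Suc[of "\<lambda>j. d (j + l)"] d by simp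
  finally show ?case using d[of l]
    by (intro exI[of _ "3 * k + \<lfloor>d l\<rfloor>"]) auto
qed

lemma tooth_ternary:
  assumes d: "\<And>l. d l \<in> {0, 1::real}" shows "tooth (3 ^ l * ternary d) = d l"
proof -
  obtain k :: int where "3 ^ l * ternary d = 2 * of_int k + ternary (\<lambda>j. d (j + l))"
    using ternary_shift[of d l, OF d] by blast
  then have shift: "tooth (3 ^ l * ternary d) = tooth (ternary (\<lambda>j. d (j + l)))" by (simp add: tooth_periodic)
  have head: "3 * ternary (\<lambda>j. d (j + l)) = 2 * d l + ternary (\<lambda>j. d (Suc j + l))"
    using ternary_Suc[of "\<lambda>j. d (j + l)"] d by simp
  have tail: "0 \<le> ternary (\<lambda>j. d (Suc j + l))" "ternary (\<lambda>j. d (Suc j + l)) \<le> 1"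
    using ternary_bounds[of "\<lambda>j. d (Suc j + l)"] d by auto
  show ?thesis
  proof (cases "d l = 0")
    case True then show ?thesis using shift head tail by (simp add: tooth_low)
  next
    case False then have "d l = 1" using d[of l] by auto
    then show ?thesis using shift head tail by (simp add: tooth_high)
  qed
qed

definition binary_digit :: "nat \<Rightarrow> real \<Rightarrow> real" where
  "binary_digit m x = of_int \<lfloor>2 ^ Suc m * x\<rfloor> - 2 * of_int \<lfloor>2 ^ m * x\<rfloor>"

lemma binary_digit_range: "binary_digit m x \<in> {0, 1}"
proof -
  define y where "y = 2 ^ m * x"
  have "2 * \<lfloor>y\<rfloor> \<le> \<lfloor>2 * y\<rfloor>" by (simp add: le_floor_iff)
  moreover have "\<lfloor>2 * y\<rfloor> < 2 * \<lfloor>y\<rfloor> + 2" by (simp add: floor_less_iff) linarith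
  ultimately have "\<lfloor>2 * y\<rfloor> - 2 * \<lfloor>y\<rfloor> = 0 \<or> \<lfloor>2 * y\<rfloor> - 2 * \<lfloor>y\<rfloor> = 1" by linarith
  then have "real_of_int (\<lfloor>2 * y\<rfloor> - 2 * \<lfloor>y\<rfloor>) \<in> {0, 1}" by auto
  then show ?thesis by (simp add: binary_digit_def y_def mult.assoc)
qed

lemma binary_digit_sums:
  assumes "0 \<le> x" "x < 1" shows "(\<lambda>m. binary_digit m x / 2 ^ Suc m) sums x"
proof -
  have part: "(\<Sum>m<N. binary_digit m x / 2 ^ Suc m) = of_int \<lfloor>2 ^ N * x\<rfloor> / 2 ^ N" for N
  proof (induction N)
    case 0 have "\<lfloor>x\<rfloor> = 0" using assms by (simp add: floor_eq_iff)
    then show ?case by simp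
  next
    case (Suc N) then show ?case by (simp add: binary_digit_def field_simps)
  qed
  have "(\<lambda>N. of_int \<lfloor>2 ^ N * x\<rfloor> / 2 ^ N) \<longlonglongrightarrow> x"
  proof (rule tendsto_sandwich)
    show "eventually (\<lambda>N. x - (1 / 2) ^ N \<le> of_int \<lfloor>2 ^ N * x\<rfloor> / 2 ^ N) sequentially"
    proof (intro always_eventually allI)
      fix N :: nat
      have "2 ^ N * x - 1 \<le> of_int \<lfloor>2 ^ N * x\<rfloor>" by linarith
      then have "(2 ^ N * x - 1) / 2 ^ N \<le> of_int \<lfloor>2 ^ N * x\<rfloor> / 2 ^ N" by (rule divide_right_mono) simp
      then show "x - (1 / 2) ^ N \<le> of_int \<lfloor>2 ^ N * x\<rfloor> / 2 ^ N" by (simp add: diff_divide_distrib power_divide)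
    qed
    show "eventually (\<lambda>N. of_int \<lfloor>2 ^ N * x\<rfloor> / 2 ^ N \<le> x) sequentially"
      by (intro always_eventually allI) (simp add: field_simps)
    have "(\<lambda>N. x - (1 / 2) ^ N) \<longlonglongrightarrow> x - 0" by (intro tendsto_intros LIMSEQ_power_zero) auto
    then show "(\<lambda>N. x - (1 / 2) ^ N) \<longlonglongrightarrow> x" by simp
  qed simp
  then show ?thesis unfolding sums_def part .
qed

text \<open>Schoenberg's space-filling curve: at a point of the Cantor set, \<open>tooth\<close> reads off the ternary digits, which
  encode the interleaved binary digits of the \<open>n\<close> coordinates.\<close>

definition schoenberg :: "nat \<Rightarrow> nat \<Rightarrow> real \<Rightarrow> real" where
  "schoenberg n i t = (\<Sum>m. tooth (3 ^ (n * m + i) * t) / 2 ^ Suc m)"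

lemma continuous_schoenberg: "continuous_on UNIV (schoenberg n i)"
proof -
  have "uniform_limit UNIV (\<lambda>N t. \<Sum>m<N. tooth (3 ^ (n * m + i) * t) / 2 ^ Suc m) (schoenberg n i) sequentially"
    unfolding schoenberg_def[abs_def]
  proof (rule Weierstrass_m_test)
    show "norm (tooth (3 ^ (n * m + i) * t) / 2 ^ Suc m) \<le> 1 / 2 ^ Suc m" for m t
      using tooth_bounds[of "3 ^ (n * m + i) * t"] by (simp add: divide_right_mono)
    show "summable (\<lambda>m. 1 / 2 ^ Suc m :: real)"
      using summable_mult[OF summable_geometric[of "1 / 2 :: real"], of "1 / 2"] by (simp add: power_divide)
  qed
  moreover have "continuous_on UNIV (\<lambda>t. \<Sum>m<N. tooth (3 ^ (n * m + i) * t) / 2 ^ Suc m)" for N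
    by (intro continuous_intros continuous_on_compose2[OF continuous_tooth]) auto
  ultimately show ?thesis by (intro uniform_limit_theorem) auto
qed

lemma schoenberg_ternary:
  assumes "\<And>l. d l \<in> {0, 1::real}"
  shows "schoenberg n i (ternary d) = (\<Sum>m. d (n * m + i) / 2 ^ Suc m)"
  by (simp add: schoenberg_def tooth_ternary[OF assms])

lemma space_filling_curve:
  obtains h :: "real \<Rightarrow> 'a::euclidean_space" and s :: "'a \<Rightarrow> real"
  where "continuous_on UNIV h" "s \<in> borel_measurable borel" "\<And>x. 0 \<le> s x \<and> s x \<le> 1"
    "\<And>x. (\<And>b. b \<in> Basis \<Longrightarrow> 0 \<le> x \<bullet> b \<and> x \<bullet> b < 1) \<Longrightarrow> h (s x) = x"
proof -
  define n where "n = DIM('a)"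
  have n: "n > 0" by (simp add: n_def)
  obtain e where e: "bij_betw e {0..<n} (Basis :: 'a set)"
    using ex_bij_betw_nat_finite[OF finite_Basis] by (auto simp: n_def)
  define idx where "idx = inv_into {0..<n} e"
  have idx: "idx b < n" "e (idx b) = b" if "b \<in> Basis" for b
    using that e bij_betw_inv_into_right[OF e that] bij_betw_apply[OF bij_betw_inv_into[OF e] that]
    by (auto simp: idx_def)
  define d where "d = (\<lambda>(x::'a) l. binary_digit (l div n) (x \<bullet> e (l mod n)))"
  have d: "d x l \<in> {0, 1}" for x l unfolding d_def by (rule binary_digit_range)
  define s where "s = (\<lambda>x. ternary (d x))"
  define h where "h = (\<lambda>t. \<Sum>b\<in>(Basis::'a set). schoenberg n (idx b) t *\<^sub>R b)"
  show ?thesis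
  proof (rule that[of h s])
    show "continuous_on UNIV h" unfolding h_def by (intro continuous_intros continuous_schoenberg)
    show "s \<in> borel_measurable borel"
      unfolding s_def ternary_def d_def binary_digit_def by measurable
    show "0 \<le> s x \<and> s x \<le> 1" for x unfolding s_def using ternary_bounds[of "d x"] d by auto
    fix x :: 'a assume x: "\<And>b. b \<in> Basis \<Longrightarrow> 0 \<le> x \<bullet> b \<and> x \<bullet> b < 1"
    have "schoenberg n (idx b) (s x) = x \<bullet> b" if b: "b \<in> Basis" for b
    proof -
      have "schoenberg n (idx b) (s x) = (\<Sum>m. binary_digit m (x \<bullet> b) / 2 ^ Suc m)"
        unfolding s_def schoenberg_ternary[OF d] using idx[OF b] n by (simp add: d_def)
      also have "\<dots> = x \<bullet> b" using binary_digit_sums[of "x \<bullet> b"] x[OF b] by (simp add: sums_iff)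
      finally show ?thesis .
    qed
    then show "h (s x) = x" unfolding h_def by (simp add: euclidean_representation)
  qed
qed

lemma weak_compact_unit_interval:
  fixes Q :: "nat \<Rightarrow> real measure"
  assumes Q: "\<And>k. real_distribution (Q k)" and unit: "\<And>k. AE y in Q k. 0 \<le> y \<and> y \<le> 1"
  obtains r Q' where "strict_mono (r :: nat \<Rightarrow> nat)" "real_distribution Q'" "weak_conv_m (\<lambda>k. Q (r k)) Q'"
proof -
  have "tight Q" unfolding tight_def
  proof (intro conjI allI impI Q)
    fix e :: real assume "e > 0"
    have "measure (Q k) {-1<..1} = 1" for k
    proof -
      interpret Q: real_distribution "Q k" by (rule Q)
      show ?thesis
        using unit[of k] by (intro Q.prob_eq_1[THEN iffD2]) (auto elim!: eventually_mono)
    qed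
    then show "\<exists>a b. a < b \<and> (\<forall>n. 1 - e < measure (Q n) {a<..b})"
      using \<open>e > 0\<close> by (intro exI[of _ "-1"] exI[of _ 1]) auto
  qed
  from tight_imp_convergent_subsubsequence[OF this strict_mono_id] show ?thesis
    using that by (auto simp: comp_def)
qed

lemma weak_compact_unit_cube:
  fixes N :: "nat \<Rightarrow> 'a::euclidean_space measure"
  assumes prob: "\<And>k. prob_space (N k)" and sets [measurable_cong]: "\<And>k. sets (N k) = sets borel"
    and cube: "\<And>k. AE x in N k. \<forall>b\<in>Basis. 0 \<le> x \<bullet> b \<and> x \<bullet> b < 1"
  obtains r M where "strict_mono (r :: nat \<Rightarrow> nat)" "prob_space M" "sets M = sets borel"
    "\<And>f C. continuous_on UNIV f \<Longrightarrow> (\<And>x. \<bar>f x\<bar> \<le> C) \<Longrightarrow>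
      (\<lambda>k. integral\<^sup>L (N (r k)) f) \<longlonglongrightarrow> integral\<^sup>L M (f :: 'a \<Rightarrow> real)"
proof -
  obtain h :: "real \<Rightarrow> 'a" and s where h: "continuous_on UNIV h" and s [measurable]: "s \<in> borel_measurable borel"
    and s_range: "\<And>x. 0 \<le> s x \<and> s x \<le> 1"
    and hs: "\<And>x. (\<And>b. b \<in> Basis \<Longrightarrow> 0 \<le> x \<bullet> b \<and> x \<bullet> b < 1) \<Longrightarrow> h (s x) = x"
    using space_filling_curve[where 'a='a] by blast
  have [measurable]: "h \<in> borel_measurable borel" by (rule borel_measurable_continuous_onI[OF h])
  define Q where "Q = (\<lambda>k. distr (N k) borel s)"
  have Q: "real_distribution (Q k)" for k
    unfolding Q_def by (rule prob_space.real_distribution_distr[OF prob]) measurable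
  have "AE y in Q k. 0 \<le> y \<and> y \<le> 1" for k
    unfolding Q_def using s_range by (subst AE_distr_iff) auto
  then obtain r Q' where r: "strict_mono (r :: nat \<Rightarrow> nat)" and Q': "real_distribution Q'"
    and conv: "weak_conv_m (\<lambda>k. Q (r k)) Q'"
    by (rule weak_compact_unit_interval[where Q=Q, OF Q])
  interpret Q': real_distribution Q' by (rule Q')
  show ?thesis
  proof (rule that[of r "distr Q' borel h"])
    show "prob_space (distr Q' borel h)" by (rule Q'.prob_space_distr) measurable
    fix f :: "'a \<Rightarrow> real" and C assume f: "continuous_on UNIV f" "\<And>x. \<bar>f x\<bar> \<le> C"
    have [measurable]: "f \<in> borel_measurable borel" by (rule borel_measurable_continuous_onI[OF f(1)])
    have "continuous_on UNIV (\<lambda>t. f (h t))" by (rule continuous_on_compose2[OF f(1) h]) auto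
    then have "(\<lambda>k. integral\<^sup>L (Q (r k)) (\<lambda>t. f (h t))) \<longlonglongrightarrow> integral\<^sup>L Q' (\<lambda>t. f (h t))"
      using Q f(2)
      by (intro weak_conv_imp_integral_bdd_continuous_conv[OF _ Q' conv])
        (auto simp: continuous_on_eq_continuous_at)
    moreover have "integral\<^sup>L (Q (r k)) (\<lambda>t. f (h t)) = integral\<^sup>L (N (r k)) f" for k
      unfolding Q_def
      by (subst integral_distr, measurable, rule integral_cong_AE, measurable, use cube[of "r k"] in eventually_elim)
        (simp add: hs)
    moreover have "integral\<^sup>L (distr Q' borel h) f = integral\<^sup>L Q' (\<lambda>t. f (h t))"
      by (rule integral_distr) measurable
    ultimately show "(\<lambda>k. integral\<^sup>L (N (r k)) f) \<longlonglongrightarrow> integral\<^sup>L (distr Q' borel h) f" by simp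
  qed (simp_all add: r)
qed

abbreviation compactly_supported :: "('a::euclidean_space \<Rightarrow> real) \<Rightarrow> bool" where
  "compactly_supported f \<equiv> continuous_on UNIV f \<and> compact (closure {x. f x \<noteq> 0})"

lemma compactly_supported_bounded:
  assumes "compactly_supported f" obtains C where "C \<ge> 0" "\<And>x. \<bar>f x\<bar> \<le> C"
proof -
  let ?S = "closure {x. f x \<noteq> 0}"
  have "compact (f ` ?S)" using assms by (intro compact_continuous_image) (auto intro: continuous_on_subset)
  then obtain C where C: "\<And>y. y \<in> f ` ?S \<Longrightarrow> \<bar>y\<bar> \<le> C"
    by (metis compact_imp_bounded bounded_iff real_norm_def)
  have "\<bar>f x\<bar> \<le> max 0 C" for x
  proof (cases "f x = 0")
    case False then have "x \<in> ?S" by (intro closure_subset[THEN subsetD]) auto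
    then show ?thesis using C[of "f x"] by auto
  qed auto
  then show ?thesis by (intro that[of "max 0 C"]) auto
qed

lemma compactly_supported_measurable:
  "compactly_supported f \<Longrightarrow> f \<in> borel_measurable borel"
  by (auto intro: borel_measurable_continuous_onI)

lemma continuous_on_extend_by_zero:
  fixes f :: "'a::euclidean_space \<Rightarrow> real" and S :: "'a set"
  assumes f: "compactly_supported f" and S: "open S" and pq: "homeomorphism S UNIV p q"
  shows "continuous_on UNIV (\<lambda>y. if y \<in> S then f (p y) else 0)" (is "continuous_on UNIV ?F")
proof -
  have p: "continuous_on S p" and q: "continuous_on UNIV q" and qS: "range q = S" and qp: "\<And>y. y \<in> S \<Longrightarrow> q (p y) = y"
    using pq by (auto simp: homeomorphism_def)
  define T where "T = q ` closure {x. f x \<noteq> 0}"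
  have T: "closed T" unfolding T_def
    using f q by (intro compact_imp_closed compact_continuous_image) (auto intro: continuous_on_subset)
  have "continuous_on S ?F"
    using f p by (subst continuous_on_cong[OF refl, where g="\<lambda>y. f (p y)"])
      (auto intro: continuous_on_compose2[of UNIV f S p])
  moreover have "continuous_on (- T) ?F"
  proof (subst continuous_on_cong[OF refl, where g="\<lambda>_. 0"])
    show "?F y = 0" if "y \<in> - T" for y
    proof (rule ccontr)
      assume "?F y \<noteq> 0"
      then have y: "y \<in> S" "p y \<in> closure {x. f x \<noteq> 0}"
        using closure_subset[of "{x. f x \<noteq> 0}"] by (auto split: if_splits)
      then have "q (p y) \<in> T" by (auto simp: T_def)
      then show False using qp y(1) that by auto
    qed
  qed simp
  ultimately have "continuous_on (S \<union> - T) ?F" using T S by (intro continuous_on_open_Un) auto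
  moreover have "S \<union> - T = UNIV" using qS by (auto simp: T_def)
  ultimately show ?thesis by simp
qed

lemma homeomorphism_unit_cube:
  obtains S and p q :: "'a::euclidean_space \<Rightarrow> 'a" where "open S" "homeomorphism S UNIV p q"
    "\<forall>y\<in>S. \<forall>b\<in>Basis. 0 \<le> y \<bullet> b \<and> y \<bullet> b < 1"
proof -
  define z :: 'a where "z = (\<Sum>b\<in>Basis. (1 / 2) *\<^sub>R b)"
  have "ball z (1 / 2) homeomorphic (UNIV :: 'a set)" by (rule homeomorphic_ball_UNIV) simp
  then obtain p q where pq: "homeomorphism (ball z (1 / 2)) (UNIV :: 'a set) p q"
    unfolding homeomorphic_def by auto
  have "0 \<le> y \<bullet> b \<and> y \<bullet> b < 1" if y: "y \<in> ball z (1 / 2)" and b: "b \<in> Basis" for y b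
  proof -
    have "\<bar>(y - z) \<bullet> b\<bar> \<le> norm (y - z)" using b by (rule Basis_le_norm)
    also have "\<dots> < 1 / 2" using y by (simp add: dist_norm norm_minus_commute)
    finally have "\<bar>y \<bullet> b - 1 / 2\<bar> < 1 / 2" using b by (simp add: z_def inner_diff_left)
    then show ?thesis by (auto simp: abs_if split: if_splits)
  qed
  then show ?thesis using pq by (intro that[of "ball z (1 / 2)" p q]) auto
qed

lemma vague_conv_pullback:
  fixes N :: "nat \<Rightarrow> 'a::euclidean_space measure"
  assumes [measurable_cong]: "\<And>k. sets (N k) = sets borel" and [measurable_cong]: "sets M = sets borel"
    and S: "open S" and pq: "homeomorphism S (UNIV :: 'a set) p q"
    and lim: "\<And>f C. continuous_on UNIV f \<Longrightarrow> (\<And>y. \<bar>f y\<bar> \<le> C) \<Longrightarrow>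
      (\<lambda>k. integral\<^sup>L (distr (N k) borel q) f) \<longlonglongrightarrow> integral\<^sup>L M (f :: 'a \<Rightarrow> real)"
  shows "vague_conv N (distr (density M (indicator S)) borel (\<lambda>y. if y \<in> S then p y else 0))"
  unfolding vague_conv_def
proof (intro allI impI)
  let ?D = "density M (indicator S)" and ?p = "\<lambda>y. if y \<in> S then p y else 0"
  have p: "continuous_on S p" and q: "continuous_on UNIV q" and qS: "q x \<in> S" and pq_id: "p (q x) = x" for x
    using pq by (auto simp: homeomorphism_def)
  have [measurable]: "q \<in> borel_measurable borel" "S \<in> sets borel"
    using q S by (auto intro: borel_measurable_continuous_onI)
  have [measurable]: "?p \<in> borel_measurable borel"
    using p by (intro borel_measurable_continuous_on_if) auto
  fix f :: "'a \<Rightarrow> real" assume f: "compactly_supported f"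
  note compactly_supported_measurable[OF f, measurable]
  obtain C where C: "C \<ge> 0" "\<And>x. \<bar>f x\<bar> \<le> C" using compactly_supported_bounded[OF f] by blast
  let ?F = "\<lambda>y. if y \<in> S then f (p y) else 0"
  have F: "continuous_on UNIV ?F" by (rule continuous_on_extend_by_zero[OF f S pq])
  note borel_measurable_continuous_onI[OF F, measurable]
  have "(\<lambda>k. integral\<^sup>L (distr (N k) borel q) ?F) \<longlonglongrightarrow> integral\<^sup>L M ?F"
    using C by (intro lim[OF F]) auto
  moreover have "integral\<^sup>L (distr (N k) borel q) ?F = integral\<^sup>L (N k) f" for k
    by (subst integral_distr) (simp_all add: qS pq_id)
  moreover have "integral\<^sup>L (distr ?D borel ?p) f = (\<integral>y. indicator S y *\<^sub>R f (?p y) \<partial>M)"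
    unfolding ennreal_indicator[symmetric]
    by (subst integral_distr, simp, simp, subst integral_density) auto
  moreover have "(\<lambda>y. indicator S y *\<^sub>R f (?p y)) = ?F" by (auto simp: fun_eq_iff)
  ultimately show "(\<lambda>k. integral\<^sup>L (N k) f) \<longlonglongrightarrow> integral\<^sup>L (distr ?D borel ?p) f" by simp
qed

lemma vague_compact_prob_space:
  fixes N :: "nat \<Rightarrow> 'a::euclidean_space measure"
  assumes prob: "\<And>k. prob_space (N k)" and sets [measurable_cong]: "\<And>k. sets (N k) = sets borel"
  obtains r M where "strict_mono (r :: nat \<Rightarrow> nat)" "finite_measure M" "sets M = sets borel"
    "vague_conv (\<lambda>k. N (r k)) M"
proof -
  obtain S and p q :: "'a \<Rightarrow> 'a" where S: "open S" and pq: "homeomorphism S UNIV p q"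
    and cube: "\<forall>y\<in>S. \<forall>b\<in>Basis. 0 \<le> y \<bullet> b \<and> y \<bullet> b < 1"
    by (rule homeomorphism_unit_cube)
  have q: "continuous_on UNIV q" "q x \<in> S" and p: "continuous_on S p" for x
    using pq by (auto simp: homeomorphism_def)
  have [measurable]: "q \<in> borel_measurable borel" "S \<in> sets borel"
    using q S by (auto intro: borel_measurable_continuous_onI)
  have [measurable]: "(\<lambda>y. if y \<in> S then p y else 0) \<in> borel_measurable borel"
    using p by (intro borel_measurable_continuous_on_if) auto
  have image: "prob_space (distr (N k) borel q)" "sets (distr (N k) borel q) = sets borel"
    "AE y in distr (N k) borel q. \<forall>b\<in>Basis. 0 \<le> y \<bullet> b \<and> y \<bullet> b < 1" for k
    using q(2) cube by (auto intro!: prob_space.prob_space_distr[OF prob] simp: AE_distr_iff)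
  obtain r and M :: "'a measure" where r: "strict_mono (r :: nat \<Rightarrow> nat)" and M: "prob_space M"
    and sM [measurable_cong]: "sets M = sets borel"
    and lim: "\<And>f C. continuous_on UNIV f \<Longrightarrow> (\<And>y. \<bar>f y\<bar> \<le> C) \<Longrightarrow>
      (\<lambda>k. integral\<^sup>L (distr (N (r k)) borel q) f) \<longlonglongrightarrow> integral\<^sup>L M (f :: 'a \<Rightarrow> real)"
    by (rule weak_compact_unit_cube[where N="\<lambda>k. distr (N k) borel q", OF image]) (rule that, assumption+, blast)
  interpret M: prob_space M by (rule M)
  have "finite_measure (density M (indicator S))"
    using sets_eq_imp_space_eq[OF sM] by (intro finite_measureI) (simp add: emeasure_density)
  then have "finite_measure (distr (density M (indicator S)) borel (\<lambda>y. if y \<in> S then p y else 0))"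
    by (rule finite_measure.finite_measure_distr) simp
  then show ?thesis
    by (rule that[OF r _ sets_distr]) (rule vague_conv_pullback[OF sets sM S pq lim])
qed

lemma finite_measure_normalize:
  fixes N :: "'a::euclidean_space measure"
  assumes "finite_measure N" and sN [measurable_cong]: "sets N = sets borel"
  obtains P where "prob_space P" "sets P = sets borel"
    "\<And>f :: 'a \<Rightarrow> real. f \<in> borel_measurable borel \<Longrightarrow> integral\<^sup>L N f = measure N UNIV * integral\<^sup>L P f"
proof (cases "measure N UNIV = 0")
  case True
  interpret finite_measure N by fact
  have "UNIV \<in> null_sets N" using True sN by (auto simp: emeasure_eq_measure)
  then have "integral\<^sup>L N f = 0" for f :: "'a \<Rightarrow> real"
    by (intro integral_eq_zero_AE AE_I'[of UNIV]) auto
  then show ?thesis using True by (intro that[of "return borel 0"]) (auto intro: prob_space_return)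
next
  case False
  interpret finite_measure N by fact
  define m where "m = measure N UNIV"
  have m: "m > 0" using False by (simp add: m_def zero_less_measure_iff)
  define P where "P = density N (\<lambda>_. ennreal (1 / m))"
  show ?thesis
  proof (rule that[of P])
    have "space N = UNIV" using sets_eq_imp_space_eq[OF sN] by simp
    then show "prob_space P" unfolding P_def
      by (intro prob_spaceI) (use m in \<open>simp add: emeasure_density emeasure_eq_measure m_def[symmetric] ennreal_mult[symmetric]\<close>)
    show "sets P = sets borel" by (simp add: P_def sN)
    fix f :: "'a \<Rightarrow> real" assume [measurable]: "f \<in> borel_measurable borel"
    show "integral\<^sup>L N f = measure N UNIV * integral\<^sup>L P f"
      unfolding P_def m_def[symmetric] using m by (subst integral_density) auto
  qed
qed

lemma vague_compact_finite_measure: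
  fixes N :: "nat \<Rightarrow> 'a::euclidean_space measure"
  assumes fin: "\<And>k. finite_measure (N k)" and sN: "\<And>k. sets (N k) = sets borel"
    and bound: "\<And>k. measure (N k) UNIV \<le> C"
  obtains r M where "strict_mono (r :: nat \<Rightarrow> nat)" "finite_measure M" "sets M = sets borel"
    "vague_conv (\<lambda>k. N (r k)) M"
proof -
  have "\<exists>P. prob_space P \<and> sets P = sets borel \<and>
      (\<forall>f :: 'a \<Rightarrow> real. f \<in> borel_measurable borel \<longrightarrow> integral\<^sup>L (N k) f = measure (N k) UNIV * integral\<^sup>L P f)" for k
    using finite_measure_normalize[OF fin sN, of k] by metis
  then obtain P where P: "\<And>k. prob_space (P k)" "\<And>k. sets (P k) = sets borel"
    and N_eq: "\<And>k f. f \<in> borel_measurable borel \<Longrightarrow>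
      integral\<^sup>L (N k) f = measure (N k) UNIV * integral\<^sup>L (P k) (f :: 'a \<Rightarrow> real)"
    by metis
  have "seq_compact {0..C}" using compact_Icc compact_imp_seq_compact by blast
  then obtain l r1 where r1: "strict_mono r1" and l: "((\<lambda>k. measure (N k) UNIV) \<circ> r1) \<longlonglongrightarrow> l" "l \<in> {0..C}"
    using bound by (elim seq_compactE[where f="\<lambda>k. measure (N k) UNIV"]) auto
  obtain r2 M where r2: "strict_mono (r2 :: nat \<Rightarrow> nat)" and M: "finite_measure M"
    and sM [measurable_cong]: "sets M = sets borel"
    and lim: "vague_conv (\<lambda>k. P (r1 (r2 k))) M"
    using vague_compact_prob_space[of "\<lambda>k. P (r1 k)"] P by metis
  interpret M: finite_measure M by (rule M)
  show ?thesis
  proof (rule that[of "r1 \<circ> r2" "density M (\<lambda>_. ennreal l)"])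
    show "strict_mono (r1 \<circ> r2)" using r1 r2 by (simp add: strict_mono_o)
    show "finite_measure (density M (\<lambda>_. ennreal l))"
      by (rule finite_measureI) (simp add: emeasure_density ennreal_mult_eq_top_iff)
    show "vague_conv (\<lambda>k. N ((r1 \<circ> r2) k)) (density M (\<lambda>_. ennreal l))" unfolding vague_conv_def
    proof (intro allI impI)
      fix f :: "'a \<Rightarrow> real" assume f: "compactly_supported f"
      note compactly_supported_measurable[OF f, measurable]
      have "(\<lambda>k. measure (N (r1 (r2 k))) UNIV * integral\<^sup>L (P (r1 (r2 k))) f) \<longlonglongrightarrow> l * integral\<^sup>L M f"
        using LIMSEQ_subseq_LIMSEQ[OF l(1) r2] lim f by (intro tendsto_mult) (auto simp: comp_def vague_conv_def)
      moreover have "integral\<^sup>L (density M (\<lambda>_. ennreal l)) f = l * integral\<^sup>L M f"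
        using l(2) by (subst integral_density) auto
      ultimately show "(\<lambda>k. integral\<^sup>L (N ((r1 \<circ> r2) k)) f) \<longlonglongrightarrow> integral\<^sup>L (density M (\<lambda>_. ennreal l)) f"
        by (simp add: N_eq)
    qed
  qed (simp add: sM)
qed

lemma radon_pos_density:
  fixes M :: "'a::euclidean_space measure" and \<psi> :: "'a \<Rightarrow> real"
  assumes "finite_measure M" and sM [measurable_cong]: "sets M = sets borel"
    and psi: "continuous_on UNIV \<psi>" "\<And>x. \<psi> x \<ge> 0"
  shows "radon_pos (density M (\<lambda>x. ennreal (\<psi> x)))"
  unfolding radon_pos_def
proof (intro conjI allI impI)
  interpret finite_measure M by fact
  have [measurable]: "\<psi> \<in> borel_measurable borel" by (rule borel_measurable_continuous_onI[OF psi(1)])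
  show "sets (density M (\<lambda>x. ennreal (\<psi> x))) = sets borel" by (simp add: sM)
  fix S :: "'a set" assume S: "compact S"
  then have [measurable]: "S \<in> sets borel" by (intro borel_closed compact_imp_closed)
  have "bounded (\<psi> ` S)"
    using S psi(1) by (intro compact_imp_bounded compact_continuous_image) (auto intro: continuous_on_subset)
  then obtain C where C: "\<And>x. x \<in> S \<Longrightarrow> \<psi> x \<le> C" by (auto simp: bounded_iff abs_le_iff)
  have "emeasure (density M (\<lambda>x. ennreal (\<psi> x))) S \<le> (\<integral>\<^sup>+ x. ennreal C \<partial>M)"
    using C by (subst emeasure_density, simp, simp, intro nn_integral_mono)
      (auto intro!: ennreal_leI split: split_indicator)
  also have "\<dots> < \<infinity>" by (simp add: ennreal_mult_eq_top_iff less_top[symmetric])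
  finally show "emeasure (density M (\<lambda>x. ennreal (\<psi> x))) S < \<infinity>" .
qed

lemma vague_compact_radon:
  fixes \<mu> :: "nat \<Rightarrow> 'a::euclidean_space measure" and \<psi> :: "'a \<Rightarrow> real"
  assumes rad: "\<And>k. radon_pos (\<mu> k)" and psi: "continuous_on UNIV \<psi>" "\<And>x. \<psi> x > 0"
    and bound: "\<And>k. (\<integral>\<^sup>+ x. ennreal (\<psi> x) \<partial>\<mu> k) \<le> ennreal C" and C: "C \<ge> 0"
  obtains r M where "strict_mono (r :: nat \<Rightarrow> nat)" "radon_pos M" "vague_conv (\<lambda>k. \<mu> (r k)) M"
proof -
  note radon_pos_sets[OF rad, measurable_cong]
  have [measurable]: "\<psi> \<in> borel_measurable borel" by (rule borel_measurable_continuous_onI[OF psi(1)])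
  have psi_neq_0: "\<psi> x \<noteq> 0" for x using psi(2)[of x] by simp
  define N where "N = (\<lambda>k. density (\<mu> k) \<psi>)"
  have mass: "emeasure (N k) UNIV \<le> ennreal C" for k
    using bound[of k] radon_pos_space[OF rad, of k] by (simp add: N_def emeasure_density)
  have sN: "sets (N k) = sets borel" for k by (simp add: N_def radon_pos_sets[OF rad])
  have fin: "finite_measure (N k)" for k
    using mass[of k] sets_eq_imp_space_eq[OF sN[of k]] by (intro finite_measureI) (auto simp: top_unique)
  have "measure (N k) UNIV \<le> C" for k
    using mass[of k] C by (simp add: finite_measure.emeasure_eq_measure[OF fin])
  then obtain r M where r: "strict_mono (r :: nat \<Rightarrow> nat)" and M: "finite_measure M" "sets M = sets borel"
    and lim: "vague_conv (\<lambda>k. N (r k)) M"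
    by (rule vague_compact_finite_measure[OF fin sN]) (rule that)
  note M(2)[measurable_cong]
  show ?thesis
  proof (rule that[OF r])
    show "radon_pos (density M (\<lambda>x. ennreal (1 / \<psi> x)))"
      using psi psi_neq_0 less_imp_le[OF psi(2)] by (intro radon_pos_density M continuous_intros) auto
    show "vague_conv (\<lambda>k. \<mu> (r k)) (density M (\<lambda>x. ennreal (1 / \<psi> x)))" unfolding vague_conv_def
    proof (intro allI impI)
      fix f :: "'a \<Rightarrow> real" assume f: "compactly_supported f"
      note compactly_supported_measurable[OF f, measurable]
      have "compactly_supported (\<lambda>x. f x / \<psi> x)"
        using f psi psi_neq_0 by (auto intro!: continuous_intros)
      then have "(\<lambda>k. integral\<^sup>L (N (r k)) (\<lambda>x. f x / \<psi> x)) \<longlonglongrightarrow> integral\<^sup>L M (\<lambda>x. f x / \<psi> x)"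
        using lim by (simp add: vague_conv_def)
      moreover have "integral\<^sup>L (N k) (\<lambda>x. f x / \<psi> x) = integral\<^sup>L (\<mu> k) f" for k
        unfolding N_def using psi(2) psi_neq_0 by (subst integral_density) (auto simp: less_imp_le)
      moreover have "integral\<^sup>L M (\<lambda>x. f x / \<psi> x) = integral\<^sup>L (density M (\<lambda>x. ennreal (1 / \<psi> x))) f"
        using psi(2) by (subst integral_density) (auto simp: less_imp_le)
      ultimately show "(\<lambda>k. integral\<^sup>L (\<mu> (r k)) f) \<longlonglongrightarrow> integral\<^sup>L (density M (\<lambda>x. ennreal (1 / \<psi> x))) f" by simp
    qed
  qed
qed

section \<open>Vague limits of potentials\<close>

lemma integrable_compactly_supported:
  fixes f :: "'a::euclidean_space \<Rightarrow> real"
  assumes f: "compactly_supported f" and rad: "radon_pos \<mu>"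
  shows "integrable \<mu> f"
proof -
  note radon_pos_sets[OF rad, measurable_cong] compactly_supported_measurable[OF f, measurable]
  obtain C where "\<And>x. \<bar>f x\<bar> \<le> C" using compactly_supported_bounded[OF f] by blast
  moreover have "x \<in> closure {x. f x \<noteq> 0} \<or> f x = 0" for x
    using closure_subset[of "{x. f x \<noteq> 0}"] by auto
  ultimately show ?thesis
    using f rad by (intro integrableI_bounded_set[where A="closure {x. f x \<noteq> 0}" and B=C])
      (auto simp: radon_pos_def)
qed

lemma vague_conv_tendsto_nn_integral:
  fixes f :: "'a::euclidean_space \<Rightarrow> real"
  assumes f: "compactly_supported f" "\<And>x. f x \<ge> 0" and rad: "\<And>k. radon_pos (\<mu> k)" "radon_pos M"
    and lim: "vague_conv \<mu> M"
  shows "(\<lambda>k. \<integral>\<^sup>+ x. ennreal (f x) \<partial>\<mu> k) \<longlonglongrightarrow> (\<integral>\<^sup>+ x. ennreal (f x) \<partial>M)"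
  using lim f by (simp add: nn_integral_eq_integral integrable_compactly_supported rad vague_conv_def)

definition cutoff :: "'a::euclidean_space \<Rightarrow> real \<Rightarrow> 'a \<Rightarrow> real" where
  "cutoff x R z = max 0 (min 1 (R - dist x z))"

lemma cutoff_bounds: "0 \<le> cutoff x R z" "cutoff x R z \<le> 1"
  and cutoff_eq_1: "dist x z \<le> R - 1 \<Longrightarrow> cutoff x R z = 1"
  and cutoff_mono: "R \<le> R' \<Longrightarrow> cutoff x R z \<le> cutoff x R' z"
  by (auto simp: cutoff_def)

lemma compactly_supported_cutoff:
  fixes f :: "'a::euclidean_space \<Rightarrow> real"
  assumes "continuous_on UNIV f" shows "compactly_supported (\<lambda>z. f z * cutoff x R z)"
proof
  show "continuous_on UNIV (\<lambda>z. f z * cutoff x R z)"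
    unfolding cutoff_def by (intro continuous_intros assms)
  have "{z. f z * cutoff x R z \<noteq> 0} \<subseteq> cball x R" by (auto simp: cutoff_def)
  then show "compact (closure {z. f z * cutoff x R z \<noteq> 0})"
    by (metis bounded_cball bounded_subset compact_closure)
qed

lemma continuous_on_enn2real:
  assumes "continuous_on S f" "\<And>x. x \<in> S \<Longrightarrow> f x < \<infinity>" shows "continuous_on S (\<lambda>x. enn2real (f x))"
  unfolding continuous_on_def
proof (intro ballI tendsto_enn2real)
  show "(f \<longlongrightarrow> ennreal (enn2real (f x))) (at x within S)" if "x \<in> S" for x
    using assms(1) assms(2)[OF that] that by (simp add: continuous_on_def)
qed simp

context riesz_potential
begin

definition cut_kernel :: "real \<Rightarrow> real \<Rightarrow> 'a \<Rightarrow> 'a \<Rightarrow> real" where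
  "cut_kernel T R x z = enn2real (swept T (x - z)) * cutoff x R z"

lemma cut_kernel_nonneg: "cut_kernel T R x z \<ge> 0"
  by (simp add: cut_kernel_def cutoff_bounds)

lemma ennreal_cut_kernel: "T > 0 \<Longrightarrow> ennreal (cut_kernel T R x z) = swept T (x - z) * ennreal (cutoff x R z)"
  using swept_finite[of T "x - z"] by (simp add: cut_kernel_def ennreal_mult cutoff_bounds)

lemma compactly_supported_cut_kernel: "T > 0 \<Longrightarrow> compactly_supported (cut_kernel T R x)"
  unfolding cut_kernel_def[abs_def]
  by (intro compactly_supported_cutoff continuous_on_enn2real continuous_on_compose2[OF continuous_on_swept]
      continuous_intros swept_finite) auto

lemmas measurable_cut_kernel = compactly_supported_measurable[OF compactly_supported_cut_kernel]

lemma cut_kernel_le_K: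
  assumes "T > 0" shows "ennreal (cut_kernel T R x z) \<le> K (x - z)"
proof -
  have "swept T (x - z) * ennreal (cutoff x R z) \<le> K (x - z) * 1"
    using assms by (intro mult_mono swept_le_K) (simp_all add: cutoff_bounds)
  then show ?thesis by (simp add: ennreal_cut_kernel assms)
qed

lemma cut_kernel_mono:
  "0 < S \<Longrightarrow> S \<le> T \<Longrightarrow> R \<le> R' \<Longrightarrow> ennreal (cut_kernel T R x z) \<le> ennreal (cut_kernel S R' x z)"
  by (auto simp: ennreal_cut_kernel intro!: mult_mono swept_mono_level ennreal_leI cutoff_mono)

lemma K_eq_SUP_cut_kernel: "K (x - z) = (SUP k. ennreal (cut_kernel (1 / real (Suc k)) (real k) x z))"
proof (rule antisym)
  let ?f = "\<lambda>k. ennreal (cut_kernel (1 / real (Suc k)) (real k) x z)"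
  show "(SUP k. ?f k) \<le> K (x - z)" by (intro SUP_least cut_kernel_le_K) simp
  have "swept (1 / real (Suc k)) (x - z) \<le> (SUP k. ?f k)" for k
  proof -
    obtain R :: nat where "dist x z + 1 \<le> real R" using real_arch_simple by blast
    then have "cutoff x (real (max k R)) z = 1" by (intro cutoff_eq_1) auto
    then have eq: "?f (max k R) = swept (1 / real (Suc (max k R))) (x - z)" by (subst ennreal_cut_kernel) simp_all
    have "swept (1 / real (Suc k)) (x - z) \<le> swept (1 / real (Suc (max k R))) (x - z)"
      by (rule swept_mono_level, rule divide_left_mono) simp_all
    also have "\<dots> \<le> (SUP k. ?f k)" unfolding eq[symmetric] by (rule SUP_upper) simp
    finally show ?thesis .
  qed
  then show "K (x - z) \<le> (SUP k. ?f k)" unfolding K_eq_SUP_swept[of "x - z"] by (rule SUP_least)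
qed

lemma potential_eq_SUP_cut_kernel:
  fixes M :: "'a measure"
  assumes "radon_pos M"
  shows "potential \<alpha> M x = (SUP k. \<integral>\<^sup>+ z. ennreal (cut_kernel (1 / real (Suc k)) (real k) x z) \<partial>M)"
proof -
  note radon_pos_sets[OF assms, measurable_cong]
  have [measurable]: "cut_kernel (1 / real (Suc k)) (real k) x \<in> borel_measurable borel" for k
    by (rule measurable_cut_kernel) simp
  have "incseq (\<lambda>k z. ennreal (cut_kernel (1 / real (Suc k)) (real k) x z))"
    by (intro incseq_SucI le_funI cut_kernel_mono) (auto intro: divide_left_mono)
  then show ?thesis
    unfolding potential_eq conv_measure_def K_eq_SUP_cut_kernel
    by (intro nn_integral_monotone_convergence_SUP) measurable
qed

lemma potential_le_liminf_vague:
  fixes \<mu> :: "nat \<Rightarrow> 'a measure"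
  assumes rad: "\<And>k. radon_pos (\<mu> k)" "radon_pos M" and lim: "vague_conv \<mu> M"
  shows "potential \<alpha> M x \<le> liminf (\<lambda>k. potential \<alpha> (\<mu> k) x)"
  unfolding potential_eq_SUP_cut_kernel[OF rad(2)]
proof (rule SUP_least)
  fix j
  let ?f = "cut_kernel (1 / real (Suc j)) (real j) x"
  have "(\<lambda>k. \<integral>\<^sup>+ z. ennreal (?f z) \<partial>\<mu> k) \<longlonglongrightarrow> (\<integral>\<^sup>+ z. ennreal (?f z) \<partial>M)"
    by (intro vague_conv_tendsto_nn_integral compactly_supported_cut_kernel cut_kernel_nonneg rad lim) simp_all
  then have "(\<integral>\<^sup>+ z. ennreal (?f z) \<partial>M) = liminf (\<lambda>k. \<integral>\<^sup>+ z. ennreal (?f z) \<partial>\<mu> k)"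
    by (intro lim_imp_Liminf[symmetric]) auto
  also have "\<dots> \<le> liminf (\<lambda>k. potential \<alpha> (\<mu> k) x)"
    unfolding potential_eq conv_measure_def
    by (intro Liminf_mono always_eventually allI nn_integral_mono cut_kernel_le_K) simp
  finally show "(\<integral>\<^sup>+ z. ennreal (?f z) \<partial>M) \<le> liminf (\<lambda>k. potential \<alpha> (\<mu> k) x)" .
qed

lemma swept_le_cut_kernel:
  obtains D where "\<And>S T x z. S > 0 \<Longrightarrow> T > 0 \<Longrightarrow>
    swept T (x - z) \<le> ennreal (cut_kernel T (sqrt S + 1) x z) + ennreal D * swept S (x - z)"
proof -
  obtain \<kappa> where kappa: "\<kappa> > 0" "\<And>T x. 0 < T \<Longrightarrow> T \<le> (norm x)\<^sup>2 \<Longrightarrow> ennreal \<kappa> * K x \<le> swept T x"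
    using K_le_swept by blast
  have "swept T (x - z) \<le> ennreal (cut_kernel T (sqrt S + 1) x z) + ennreal (1 / \<kappa>) * swept S (x - z)"
    if S: "S > 0" and T: "T > 0" for S T x z
  proof (cases "dist x z \<le> sqrt S")
    case True
    then show ?thesis by (simp add: ennreal_cut_kernel T cutoff_eq_1)
  next
    case False
    then have "sqrt S \<le> norm (x - z)" by (simp add: dist_norm)
    then have "S \<le> (norm (x - z))\<^sup>2" by (rule sqrt_le_D)
    have "swept T (x - z) \<le> K (x - z)" by (rule swept_le_K) (use T in simp)
    also have "\<dots> = ennreal (1 / \<kappa>) * (ennreal \<kappa> * K (x - z))"
      using kappa(1) by (simp add: mult.assoc[symmetric] ennreal_mult[symmetric])
    also have "\<dots> \<le> ennreal (1 / \<kappa>) * swept S (x - z)"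
      by (intro mult_left_mono kappa(2) S \<open>S \<le> _\<close>) simp
    finally show ?thesis by (simp add: add_increasing)
  qed
  then show ?thesis by (rule that)
qed

lemma tendsto_swept_potential_0:
  fixes M :: "'a measure"
  assumes M: "radon_pos M" and fin: "potential \<alpha> M x < \<infinity>"
  shows "(\<lambda>j. conv_measure (swept (real (Suc j))) M x) \<longlonglongrightarrow> 0"
proof -
  note radon_pos_sets[OF M, measurable_cong]
  have "(\<lambda>j. \<integral>\<^sup>+ z. swept (real (Suc j)) (x - z) \<partial>M) \<longlonglongrightarrow> (\<integral>\<^sup>+ z. 0 \<partial>M)"
  proof (rule nn_integral_dominated_convergence)
    show "(\<integral>\<^sup>+ z. K (x - z) \<partial>M) < \<infinity>" using fin by (simp add: potential_eq conv_measure_def)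
    show "AE z in M. swept (real (Suc j)) (x - z) \<le> K (x - z)" for j
      by (intro AE_I2 swept_le_K) simp
    show "AE z in M. (\<lambda>j. swept (real (Suc j)) (x - z)) \<longlonglongrightarrow> 0"
    proof (rule AE_I2, rule tendsto_sandwich[OF _ _ tendsto_const])
      show "(\<lambda>j. ennreal (swept_bound (real (Suc j)))) \<longlonglongrightarrow> 0"
        using tendsto_ennrealI[OF tendsto_swept_bound] by simp
      show "\<forall>\<^sub>F j in sequentially. swept (real (Suc j)) (x - z) \<le> ennreal (swept_bound (real (Suc j)))" for z
        by (intro always_eventually allI swept_le) simp
    qed simp
  qed measurable
  then show ?thesis by (simp add: conv_measure_def)
qed

lemma conv_sweep_potential_radon:
  "radon_pos M \<Longrightarrow> T > 0 \<Longrightarrow> conv (sweep T) (potential \<alpha> M) = conv_measure (swept T) M"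
  unfolding potential_eq by (intro conv_sweep_potential radon_pos_sigma_finite radon_pos_sets)

lemma liminf_swept_potential_le_vague:
  fixes \<mu> :: "nat \<Rightarrow> 'a measure"
  assumes rad: "\<And>k. radon_pos (\<mu> k)" "radon_pos M" and lim: "vague_conv \<mu> M"
    and dom: "radon_pos \<eta>" "\<And>k x. potential \<alpha> (\<mu> k) x \<le> potential \<alpha> \<eta> x" and fin: "potential \<alpha> \<eta> x < \<infinity>"
    and T: "T > 0"
  shows "liminf (\<lambda>k. conv_measure (swept T) (\<mu> k) x) \<le> potential \<alpha> M x"
proof -
  note radon_pos_sets[OF rad(1), measurable_cong] measurable_cut_kernel[OF T, measurable]
  obtain D where split: "\<And>S x z. S > 0 \<Longrightarrow>
      swept T (x - z) \<le> ennreal (cut_kernel T (sqrt S + 1) x z) + ennreal D * swept S (x - z)"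
    using swept_le_cut_kernel T by metis
  have "liminf (\<lambda>k. conv_measure (swept T) (\<mu> k) x) \<le> potential \<alpha> M x + ennreal D * conv_measure (swept S) \<eta> x"
    if S: "S > 0" for S
  proof -
    let ?f = "cut_kernel T (sqrt S + 1) x" and ?c = "ennreal D * conv_measure (swept S) \<eta> x"
    have "conv_measure (swept T) (\<mu> k) x \<le> (\<integral>\<^sup>+ z. ennreal (?f z) \<partial>\<mu> k) + ?c" for k
    proof -
      have "conv_measure (swept T) (\<mu> k) x \<le> (\<integral>\<^sup>+ z. ennreal (?f z) + ennreal D * swept S (x - z) \<partial>\<mu> k)"
        unfolding conv_measure_def by (intro nn_integral_mono split S)
      also have "\<dots> = (\<integral>\<^sup>+ z. ennreal (?f z) \<partial>\<mu> k) + ennreal D * conv_measure (swept S) (\<mu> k) x"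
        by (simp add: nn_integral_add nn_integral_cmult conv_measure_def)
      also have "conv_measure (swept S) (\<mu> k) x \<le> conv_measure (swept S) \<eta> x"
        unfolding conv_sweep_potential_radon[OF rad(1) S, symmetric] conv_sweep_potential_radon[OF dom(1) S, symmetric]
        by (intro conv_mono dom) simp
      finally show ?thesis by (simp add: add_left_mono mult_left_mono)
    qed
    then have "liminf (\<lambda>k. conv_measure (swept T) (\<mu> k) x) \<le> liminf (\<lambda>k. (\<integral>\<^sup>+ z. ennreal (?f z) \<partial>\<mu> k) + ?c)"
      by (intro Liminf_mono always_eventually allI)
    also have "\<dots> = (\<integral>\<^sup>+ z. ennreal (?f z) \<partial>M) + ?c"
      using vague_conv_tendsto_nn_integral[OF compactly_supported_cut_kernel[OF T] cut_kernel_nonneg rad lim]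
      by (intro lim_imp_Liminf tendsto_add tendsto_const) simp_all
    also have "(\<integral>\<^sup>+ z. ennreal (?f z) \<partial>M) \<le> potential \<alpha> M x"
      unfolding potential_eq conv_measure_def by (intro nn_integral_mono cut_kernel_le_K T)
    finally show ?thesis by (simp add: add_right_mono)
  qed
  moreover have "(\<lambda>j. potential \<alpha> M x + ennreal D * conv_measure (swept (real (Suc j))) \<eta> x)
      \<longlonglongrightarrow> potential \<alpha> M x + ennreal D * 0"
    by (intro tendsto_add tendsto_const ennreal_tendsto_cmult tendsto_swept_potential_0 dom fin) simp
  ultimately have "liminf (\<lambda>k. conv_measure (swept T) (\<mu> k) x) \<le> potential \<alpha> M x + ennreal D * 0"
    by (intro LIMSEQ_le_const) auto
  then show ?thesis by simp
qed

lemma potential_vague_limit_eq_SUP: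
  fixes \<mu> :: "nat \<Rightarrow> 'a measure"
  assumes rad: "\<And>k. radon_pos (\<mu> k)" "radon_pos M" and lim: "vague_conv \<mu> M"
    and inc: "\<And>x. incseq (\<lambda>k. potential \<alpha> (\<mu> k) x)"
    and dom: "radon_pos \<eta>" "\<And>k x. potential \<alpha> (\<mu> k) x \<le> potential \<alpha> \<eta> x" and fin: "potential \<alpha> \<eta> x0 < \<infinity>"
  shows "potential \<alpha> M x = (SUP k. potential \<alpha> (\<mu> k) x)"
proof (rule antisym)
  define u where "u = (\<lambda>x. SUP k. potential \<alpha> (\<mu> k) x)"
  have u_lim: "(\<lambda>k. potential \<alpha> (\<mu> k) x) \<longlonglongrightarrow> u x" for x unfolding u_def by (rule LIMSEQ_SUP[OF inc])
  have "liminf (\<lambda>k. potential \<alpha> (\<mu> k) x) = u x" by (rule lim_imp_Liminf) (simp_all add: u_lim)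
  then show "potential \<alpha> M x \<le> (SUP k. potential \<alpha> (\<mu> k) x)"
    using potential_le_liminf_vague[OF rad lim, of x] by (simp add: u_def)
  have lsc_u: "lsc u" unfolding u_def by (intro lsc_SUP superharmonic_lsc superharmonic_potential_radon rad)
  have sweep_le: "conv (sweep T) u x \<le> potential \<alpha> M x" if T: "T > 0" and x: "potential \<alpha> \<eta> x < \<infinity>" for T x
  proof -
    have "incseq (\<lambda>k. conv (sweep T) (potential \<alpha> (\<mu> k)) x)"
      by (intro incseq_SucI conv_mono incseq_SucD[OF inc]) simp
    then have "(\<lambda>k. conv_measure (swept T) (\<mu> k) x) \<longlonglongrightarrow> conv (sweep T) u x"
      unfolding conv_sweep_potential_radon[OF rad(1) T, symmetric] u_def
      using LIMSEQ_SUP by (subst conv_SUP) (auto simp: rad(1) inc)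
    then have "conv (sweep T) u x = liminf (\<lambda>k. conv_measure (swept T) (\<mu> k) x)"
      by (intro lim_imp_Liminf[symmetric]) simp_all
    also have "\<dots> \<le> potential \<alpha> M x" by (rule liminf_swept_potential_le_vague[OF rad lim dom x T])
    finally show ?thesis .
  qed
  have u_le: "u x \<le> potential \<alpha> M x" if x: "potential \<alpha> \<eta> x < \<infinity>" for x
  proof -
    have T: "1 / real (Suc k) > 0" "(\<lambda>k. 1 / real (Suc k)) \<longlonglongrightarrow> 0" for k
      using LIMSEQ_inverse_real_of_nat by (auto simp: divide_inverse)
    have "liminf (\<lambda>k. conv (sweep (1 / real (Suc k))) u x) \<le> liminf (\<lambda>k::nat. potential \<alpha> M x)"
      by (intro Liminf_mono always_eventually allI sweep_le T x)
    then show ?thesis using lsc_le_liminf_conv_sweep[OF lsc_u T, of x] by (simp add: Liminf_const)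
  qed
  have "AE x in lborel. u x \<le> potential \<alpha> M x"
    using superharmonic_AE_finite[OF superharmonic_potential_radon[OF dom(1)] fin] by eventually_elim (rule u_le)
  then have "u x \<le> potential \<alpha> M x"
    by (intro superharmonic_le_of_AE_le[OF lsc_u superharmonic_potential_radon[OF rad(2)]])
  then show "(SUP k. potential \<alpha> (\<mu> k) x) \<le> potential \<alpha> M x" by (simp add: u_def)
qed

lemma vague_compact_dominated_potentials:
  fixes \<mu> :: "nat \<Rightarrow> 'a measure"
  assumes rad: "\<And>k. radon_pos (\<mu> k)" and le: "\<And>k. potential \<alpha> (\<mu> k) x0 \<le> C" and C: "C < \<infinity>"
  obtains r M where "strict_mono (r :: nat \<Rightarrow> nat)" "radon_pos M" "vague_conv (\<lambda>k. \<mu> (r k)) M"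
proof (rule vague_compact_radon[OF rad])
  let ?\<psi> = "\<lambda>z. enn2real (swept 1 (x0 - z))"
  have psi_eq: "ennreal (?\<psi> z) = swept 1 (x0 - z)" for z using swept_finite[of 1] by simp
  show "continuous_on UNIV ?\<psi>"
    by (intro continuous_on_enn2real continuous_on_compose2[OF continuous_on_swept] continuous_intros swept_finite) auto
  show "?\<psi> z > 0" for z
    using swept_finite[of 1 "x0 - z"] swept_neq_0[of 1 "x0 - z"]
    by (simp add: enn2real_positive_iff zero_less_iff_neq_zero)
  have "(\<integral>\<^sup>+ z. swept 1 (x0 - z) \<partial>\<mu> k) \<le> potential \<alpha> (\<mu> k) x0" for k
    unfolding potential_eq conv_measure_def by (intro nn_integral_mono swept_le_K) simp
  then show "(\<integral>\<^sup>+ z. ennreal (?\<psi> z) \<partial>\<mu> k) \<le> ennreal (enn2real C)" for k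
    using le[of k] C by (simp add: psi_eq) (rule order_trans)
qed (auto intro: that)

lemma increasing_potentials_limit:
  fixes \<mu> :: "nat \<Rightarrow> 'a measure"
  assumes rad: "\<And>k. radon_pos (\<mu> k)" and inc: "\<And>x. incseq (\<lambda>k. potential \<alpha> (\<mu> k) x)"
    and dom: "radon_pos \<eta>" "\<And>k x. potential \<alpha> (\<mu> k) x \<le> potential \<alpha> \<eta> x" and fin: "potential \<alpha> \<eta> x0 < \<infinity>"
  obtains r M where "strict_mono (r :: nat \<Rightarrow> nat)" "radon_pos M" "vague_conv (\<lambda>k. \<mu> (r k)) M"
    "\<And>x. potential \<alpha> M x = (SUP k. potential \<alpha> (\<mu> k) x)"
proof -
  obtain r M where r: "strict_mono (r :: nat \<Rightarrow> nat)" and M: "radon_pos M" and lim: "vague_conv (\<lambda>k. \<mu> (r k)) M"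
    by (rule vague_compact_dominated_potentials[OF rad dom(2) fin])
  have inc_r: "incseq (\<lambda>k. potential \<alpha> (\<mu> (r k)) x)" for x
    using inc[of x] strict_mono_mono[OF r] by (simp add: incseq_def mono_def)
  have "potential \<alpha> M x = (SUP k. potential \<alpha> (\<mu> (r k)) x)" for x
    by (rule potential_vague_limit_eq_SUP[OF rad M lim inc_r dom fin])
  moreover have "(SUP k. potential \<alpha> (\<mu> (r k)) x) = (SUP k. potential \<alpha> (\<mu> k) x)" for x
    using LIMSEQ_unique[OF LIMSEQ_SUP[OF inc_r] LIMSEQ_subseq_LIMSEQ[OF LIMSEQ_SUP[OF inc] r, unfolded comp_def]] .
  ultimately show ?thesis using that[OF r M lim] by simp
qed

end

section \<open>Vague convergence from convergence of potentials\<close>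

lemma conv_translate:
  fixes f h :: "'a::euclidean_space \<Rightarrow> ennreal"
  assumes [measurable]: "f \<in> borel_measurable borel" "h \<in> borel_measurable borel"
  shows "conv f (\<lambda>y. h (y - a)) x = conv f h (x - a)"
  using nn_integral_lborel_shift[of "\<lambda>y. f (x - y) * h (y - a)" a] by (simp add: conv_def algebra_simps)

lemma compactly_supported_uminus: "compactly_supported f \<Longrightarrow> compactly_supported (\<lambda>x. - f x)"
  by (auto intro: continuous_intros)

lemma LIMSEQ_of_subsequences:
  fixes X :: "nat \<Rightarrow> 'a::topological_space"
  assumes sub: "\<And>s :: nat \<Rightarrow> nat. strict_mono s \<Longrightarrow> \<exists>r. strict_mono r \<and> (\<lambda>k. X (s (r k))) \<longlonglongrightarrow> l"
  shows "X \<longlonglongrightarrow> l"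
proof (rule topological_tendstoI, rule ccontr)
  fix S assume S: "open S" "l \<in> S" and "\<not> eventually (\<lambda>k. X k \<in> S) sequentially"
  then have "infinite {k. X k \<notin> S}"
    by (simp add: not_eventually frequently_cofinite[symmetric] cofinite_eq_sequentially)
  then obtain s :: "nat \<Rightarrow> nat" where s: "strict_mono s" "\<And>k. X (s k) \<notin> S" using infinite_enumerate by force
  obtain r where "(\<lambda>k. X (s (r k))) \<longlonglongrightarrow> l" using sub[OF s(1)] by blast
  then have "eventually (\<lambda>k. X (s (r k)) \<in> S) sequentially" by (rule topological_tendstoD) (rule S)+
  then show False using s(2) by simp
qed

context riesz_potential
begin

lemma mollified_measures_AE_eq:
  fixes L L' :: "'a measure"
  assumes rad: "radon_pos L" "radon_pos L'" and eq: "potential \<alpha> L = potential \<alpha> L'"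
    and fin: "potential \<alpha> L x0 < \<infinity>" and T: "T > 0"
  shows "AE x in lborel. conv_measure (mollifier T) L x = conv_measure (mollifier T) L' x"
proof -
  have split: "potential \<alpha> M x = conv (sweep T) (potential \<alpha> M) x
      + ennreal (unswept_mass T) * conv_measure (mollifier T) M x"
    if M: "radon_pos M" for M x
  proof -
    note radon_pos_sets[OF M, measurable_cong]
    have "potential \<alpha> M x = (\<integral>\<^sup>+ z. swept T (x - z) + ennreal (unswept_mass T) * mollifier T (x - z) \<partial>M)"
      unfolding potential_eq conv_measure_def by (simp add: K_split[OF T] unswept_eq[OF T] add.commute)
    then show ?thesis
      by (simp add: nn_integral_add nn_integral_cmult conv_sweep_potential_radon[OF M T] conv_measure_def)
  qed
  have "AE x in lborel. potential \<alpha> L x < \<infinity>"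
    by (rule superharmonic_AE_finite[OF superharmonic_potential_radon[OF rad(1)] fin])
  then show ?thesis
  proof eventually_elim
    fix x assume "potential \<alpha> L x < \<infinity>"
    then have "conv (sweep T) (potential \<alpha> L) x \<noteq> \<infinity>"
      using superharmonic_conv_sweep_le[OF superharmonic_potential_radon[OF rad(1)] T, of x]
      by (auto simp: top_unique)
    moreover have "conv (sweep T) (potential \<alpha> L) x + ennreal (unswept_mass T) * conv_measure (mollifier T) L x
        = conv (sweep T) (potential \<alpha> L) x + ennreal (unswept_mass T) * conv_measure (mollifier T) L' x"
      using split[OF rad(1), of x] split[OF rad(2), of x] unfolding eq by metis
    ultimately show "conv_measure (mollifier T) L x = conv_measure (mollifier T) L' x"
      using unswept_mass_pos[OF T] by (auto simp: ennreal_add_left_cancel ennreal_mult_cancel_left)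
  qed
qed

lemma compactly_supported_le_swept:
  fixes f :: "'a \<Rightarrow> real"
  assumes f: "compactly_supported f"
  obtains C where "\<And>z. ennreal (f z) \<le> ennreal C * swept 1 (z - x0)"
proof -
  obtain B where B: "B \<ge> 0" "\<And>x. \<bar>f x\<bar> \<le> B" using compactly_supported_bounded[OF f] by blast
  have "bounded (closure {x. f x \<noteq> 0})" using f by (simp add: compact_imp_bounded)
  then obtain R where R: "\<And>x. x \<in> closure {x. f x \<noteq> 0} \<Longrightarrow> dist x0 x \<le> R" using bounded_any_center[of _ x0] by blast
  obtain e :: 'a where e: "norm e = \<bar>R\<bar>" using vector_choose_size[of "\<bar>R\<bar>"] by auto
  obtain \<kappa> where kappa: "swept 1 e = ennreal \<kappa>" "\<kappa> > 0"
    using swept_finite[of 1 e] swept_neq_0[of 1 e] by (cases "swept 1 e") (auto simp: less_eq_real_def)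
  have "ennreal (f z) \<le> ennreal (B / \<kappa>) * swept 1 (z - x0)" for z
  proof (cases "f z = 0")
    case False
    then have "dist x0 z \<le> R" using R closure_subset[of "{x. f x \<noteq> 0}"] by auto
    then have "swept 1 e \<le> swept 1 (z - x0)" using e
      by (intro swept_antimono) (simp add: dist_norm norm_minus_commute)
    have "ennreal (f z) \<le> ennreal B" using B(2)[of z] by (intro ennreal_leI) simp
    also have "\<dots> = ennreal (B / \<kappa>) * swept 1 e" using B(1) kappa by (simp add: ennreal_mult[symmetric])
    also have "\<dots> \<le> ennreal (B / \<kappa>) * swept 1 (z - x0)" by (rule mult_left_mono) (fact, simp)
    finally show ?thesis .
  qed simp
  then show ?thesis by (rule that)
qed

lemma tendsto_nn_integral_mollifier:
  fixes f :: "'a \<Rightarrow> real" and L :: "'a measure"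
  assumes f: "compactly_supported f" and rad: "radon_pos L" and fin: "potential \<alpha> L x0 < \<infinity>"
  shows "(\<lambda>k. \<integral>\<^sup>+ x. conv (mollifier (1 / real (Suc k))) (\<lambda>x. ennreal (f x)) x \<partial>L) \<longlonglongrightarrow> (\<integral>\<^sup>+ x. ennreal (f x) \<partial>L)"
proof -
  note radon_pos_sets[OF rad, measurable_cong] compactly_supported_measurable[OF f, measurable]
  obtain C where C: "\<And>z. ennreal (f z) \<le> ennreal C * swept 1 (z - x0)"
    using compactly_supported_le_swept[OF f] by blast
  obtain B where B: "\<And>x. \<bar>f x\<bar> \<le> B" using compactly_supported_bounded[OF f] by blast
  have swept_minus_eq: "swept 1 (z - x0) = swept 1 (x0 - z)" for z using swept_minus[of 1 "x0 - z"] by simp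
  show ?thesis
  proof (rule nn_integral_dominated_convergence[where w="\<lambda>z. ennreal C * (2 * swept 1 (x0 - z))"])
    have "(\<integral>\<^sup>+ z. swept 1 (x0 - z) \<partial>L) \<le> potential \<alpha> L x0"
      unfolding potential_eq conv_measure_def by (intro nn_integral_mono swept_le_K) simp
    then have "(\<integral>\<^sup>+ z. swept 1 (x0 - z) \<partial>L) < \<infinity>" using fin by (rule le_less_trans)
    then show "(\<integral>\<^sup>+ z. ennreal C * (2 * swept 1 (x0 - z)) \<partial>L) < \<infinity>"
      by (simp add: nn_integral_cmult ennreal_mult_less_top)
    have "conv (mollifier (1 / real (Suc k))) (\<lambda>x. ennreal (f x)) z \<le> ennreal C * (2 * swept 1 (x0 - z))" for k z
    proof -
      have "conv (mollifier (1 / real (Suc k))) (\<lambda>x. ennreal (f x)) z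
          \<le> conv (mollifier (1 / real (Suc k))) (\<lambda>z. ennreal C * swept 1 (z - x0)) z"
        by (intro conv_mono C) simp
      also have "\<dots> = ennreal C * conv (mollifier (1 / real (Suc k))) (swept 1) (z - x0)"
        by (simp add: conv_cmult_right conv_translate)
      also have "\<dots> \<le> ennreal C * (2 * swept 1 (z - x0))"
        by (intro mult_left_mono conv_mollifier_swept_le) simp_all
      finally show ?thesis by (simp only: swept_minus_eq)
    qed
    then show "AE z in L. conv (mollifier (1 / real (Suc k))) (\<lambda>x. ennreal (f x)) z
        \<le> ennreal C * (2 * swept 1 (x0 - z))" for k
      by (intro AE_I2)
    have "(\<lambda>k. conv (mollifier (1 / real (Suc k))) (\<lambda>x. ennreal (f x)) x) \<longlonglongrightarrow> ennreal (f x)" for x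
      unfolding mollifier_def
    proof (rule tendsto_conv_heat_mixture[OF prob_space_mollifier_law _ AE_mollifier_law_pos])
      show "continuous_on UNIV (\<lambda>x. ennreal (f x))" using f by (intro continuous_on_ennreal) simp
      show "ennreal (f x) \<le> ennreal B" for x using B[of x] by (intro ennreal_leI) simp
      show "(\<lambda>k. 1 / real (Suc k)) \<longlonglongrightarrow> 0" using LIMSEQ_inverse_real_of_nat by (simp add: divide_inverse)
    qed simp_all
    then show "AE x in L. (\<lambda>k. conv (mollifier (1 / real (Suc k))) (\<lambda>x. ennreal (f x)) x) \<longlonglongrightarrow> ennreal (f x)"
      by (intro AE_I2)
  qed measurable
qed

lemma potential_determines_nn_integral:
  fixes L L' :: "'a measure" and f :: "'a \<Rightarrow> real"
  assumes rad: "radon_pos L" "radon_pos L'" and eq: "potential \<alpha> L = potential \<alpha> L'"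
    and fin: "potential \<alpha> L x0 < \<infinity>" and f: "compactly_supported f"
  shows "(\<integral>\<^sup>+ x. ennreal (f x) \<partial>L) = (\<integral>\<^sup>+ x. ennreal (f x) \<partial>L')"
proof -
  note compactly_supported_measurable[OF f, measurable]
  have dual: "(\<integral>\<^sup>+ x. conv (mollifier T) (\<lambda>x. ennreal (f x)) x \<partial>M)
      = (\<integral>\<^sup>+ x. conv_measure (mollifier T) M x * ennreal (f x) \<partial>lborel)" if "radon_pos M" for M T
    using that by (intro nn_integral_conv_dual mollifier_minus radon_pos_sigma_finite radon_pos_sets) simp_all
  have "(\<integral>\<^sup>+ x. conv (mollifier T) (\<lambda>x. ennreal (f x)) x \<partial>L)
      = (\<integral>\<^sup>+ x. conv (mollifier T) (\<lambda>x. ennreal (f x)) x \<partial>L')"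
    if "T > 0" for T
    unfolding dual[OF rad(1)] dual[OF rad(2)]
    by (rule nn_integral_cong_AE, use mollified_measures_AE_eq[OF rad eq fin that] in eventually_elim) simp
  then have "(\<lambda>k. \<integral>\<^sup>+ x. conv (mollifier (1 / real (Suc k))) (\<lambda>x. ennreal (f x)) x \<partial>L)
      \<longlonglongrightarrow> (\<integral>\<^sup>+ x. ennreal (f x) \<partial>L')"
    using tendsto_nn_integral_mollifier[OF f rad(2), of x0] fin by (simp add: eq)
  then show ?thesis by (rule LIMSEQ_unique[OF tendsto_nn_integral_mollifier[OF f rad(1) fin]])
qed

lemma potential_determines_integral:
  fixes L L' :: "'a measure" and f :: "'a \<Rightarrow> real"
  assumes rad: "radon_pos L" "radon_pos L'" and eq: "potential \<alpha> L = potential \<alpha> L'"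
    and fin: "potential \<alpha> L x0 < \<infinity>" and f: "compactly_supported f"
  shows "integral\<^sup>L L f = integral\<^sup>L L' f"
proof -
  have "(\<integral>\<^sup>+ x. ennreal (f x) \<partial>L) = (\<integral>\<^sup>+ x. ennreal (f x) \<partial>L')"
    "(\<integral>\<^sup>+ x. ennreal (- f x) \<partial>L) = (\<integral>\<^sup>+ x. ennreal (- f x) \<partial>L')"
    by (intro potential_determines_nn_integral[OF rad eq fin] compactly_supported_uminus f)+
  then show ?thesis
    by (simp add: real_lebesgue_integral_def integrable_compactly_supported[OF f] rad)
qed

lemma vague_conv_of_increasing_potentials:
  fixes \<mu> :: "nat \<Rightarrow> 'a measure"
  assumes rad: "\<And>k. radon_pos (\<mu> k)" and inc: "\<And>x. incseq (\<lambda>k. potential \<alpha> (\<mu> k) x)"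
    and M: "radon_pos M" "\<And>x. potential \<alpha> M x = (SUP k. potential \<alpha> (\<mu> k) x)" and fin: "potential \<alpha> M x0 < \<infinity>"
  shows "vague_conv \<mu> M"
  unfolding vague_conv_def
proof (intro allI impI, rule LIMSEQ_of_subsequences)
  fix f :: "'a \<Rightarrow> real" and s :: "nat \<Rightarrow> nat"
  assume f: "compactly_supported f" and s: "strict_mono s"
  have inc_s: "incseq (\<lambda>k. potential \<alpha> (\<mu> (s k)) x)" for x
    using inc[of x] strict_mono_mono[OF s] by (simp add: incseq_def mono_def)
  have le: "potential \<alpha> (\<mu> (s k)) x \<le> potential \<alpha> M x" for k x unfolding M(2) by (rule SUP_upper) simp
  obtain r M' where r: "strict_mono r" and M': "radon_pos M'" and lim: "vague_conv (\<lambda>k. \<mu> (s (r k))) M'"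
    and pot: "\<And>x. potential \<alpha> M' x = (SUP k. potential \<alpha> (\<mu> (s k)) x)"
    by (rule increasing_potentials_limit[OF rad inc_s M(1) le fin]) (rule that)
  have "potential \<alpha> M' x = potential \<alpha> M x" for x
    using LIMSEQ_unique[OF LIMSEQ_SUP[OF inc_s] LIMSEQ_subseq_LIMSEQ[OF LIMSEQ_SUP[OF inc] s, unfolded comp_def]]
    by (simp add: pot M(2))
  then have "integral\<^sup>L M' f = integral\<^sup>L M f"
    using fin by (intro potential_determines_integral[OF M' M(1) _ _ f]) auto
  moreover have "(\<lambda>k. integral\<^sup>L (\<mu> (s (r k))) f) \<longlonglongrightarrow> integral\<^sup>L M' f"
    using lim f by (simp add: vague_conv_def)
  ultimately show "\<exists>r. strict_mono r \<and> (\<lambda>k. integral\<^sup>L (\<mu> (s (r k))) f) \<longlonglongrightarrow> integral\<^sup>L M f"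
    using r by auto
qed

end

section \<open>Inner balayage\<close>

lemma Mplus_radon_pos: "\<mu> \<in> Mplus \<alpha> \<Longrightarrow> radon_pos \<mu>"
  by (simp add: Mplus_def)

lemma MplusI: "radon_pos \<mu> \<Longrightarrow> potential \<alpha> \<mu> x < \<infinity> \<Longrightarrow> \<mu> \<in> Mplus \<alpha>"
  by (auto simp: Mplus_def intro!: exI[of _ x])

lemma MplusE:
  assumes "\<mu> \<in> Mplus \<alpha>" obtains x where "potential \<alpha> \<mu> x < \<infinity>"
  using assms by (auto simp: Mplus_def less_top)

lemma nearly_everywhere_on_subset:
  "nearly_everywhere_on \<alpha> B P \<Longrightarrow> A \<subseteq> B \<Longrightarrow> nearly_everywhere_on \<alpha> A P"
  unfolding nearly_everywhere_on_iff by (erule inner_cap_eq_0_mono) auto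

lemma nearly_everywhere_on_always:
  fixes A :: "'a::euclidean_space set"
  assumes "\<And>x. P x" shows "nearly_everywhere_on \<alpha> A P"
  using assms prob_space.AE_False by (subst nearly_everywhere_on_iff_AE) auto

lemma is_balayage_Mplus: "is_balayage \<alpha> \<mu> A \<nu> \<Longrightarrow> \<nu> \<in> Mplus \<alpha>"
  by (simp add: is_balayage_def)

lemma is_balayage_le:
  assumes "is_balayage \<alpha> \<mu> A \<nu>" "\<eta> \<in> Mplus \<alpha>"
    "nearly_everywhere_on \<alpha> A (\<lambda>y. potential \<alpha> \<eta> y \<ge> potential \<alpha> \<mu> y)"
  shows "potential \<alpha> \<nu> x \<le> potential \<alpha> \<eta> x"
  using assms unfolding is_balayage_def by (auto intro!: INF_lower2[of \<eta>])

lemma is_balayage_le_potential: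
  "is_balayage \<alpha> \<mu> A \<nu> \<Longrightarrow> \<mu> \<in> Mplus \<alpha> \<Longrightarrow> potential \<alpha> \<nu> x \<le> potential \<alpha> \<mu> x"
  by (rule is_balayage_le) (auto intro: nearly_everywhere_on_always)

lemma is_balayage_mono:
  assumes \<nu>: "is_balayage \<alpha> \<mu> A \<nu>" and \<nu>': "is_balayage \<alpha> \<mu> B \<nu>'" and "A \<subseteq> B"
  shows "potential \<alpha> \<nu> x \<le> potential \<alpha> \<nu>' x"
proof -
  have "potential \<alpha> \<nu> x \<le> potential \<alpha> \<eta> x"
    if "\<eta> \<in> Mplus \<alpha>" "nearly_everywhere_on \<alpha> B (\<lambda>y. potential \<alpha> \<eta> y \<ge> potential \<alpha> \<mu> y)" for \<eta>
    using that nearly_everywhere_on_subset[OF that(2) \<open>A \<subseteq> B\<close>] by (intro is_balayage_le[OF \<nu>])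
  then show ?thesis using \<nu>' by (auto simp: is_balayage_def intro!: INF_greatest)
qed

lemma incseq_potential_balayage:
  assumes "\<And>k. is_balayage \<alpha> \<mu> (A k) (\<nu> k)" "incseq A"
  shows "incseq (\<lambda>k. potential \<alpha> (\<nu> k) x)"
  by (intro incseq_SucI is_balayage_mono[OF assms(1) assms(1)] incseq_SucD[OF assms(2)])

context riesz_potential
begin

lemma is_balayage_ge_nearly_everywhere:
  fixes \<mu> \<nu> :: "'a measure"
  assumes mu: "\<mu> \<in> Mplus \<alpha>" and bal: "is_balayage \<alpha> \<mu> A \<nu>"
  shows "nearly_everywhere_on \<alpha> A (\<lambda>x. potential \<alpha> \<nu> x \<ge> potential \<alpha> \<mu> x)"
proof -
  define \<Gamma> where "\<Gamma> = {\<eta> \<in> Mplus \<alpha>. nearly_everywhere_on \<alpha> A (\<lambda>y. potential \<alpha> \<eta> y \<ge> potential \<alpha> \<mu> y)}"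
  have nu: "\<nu> \<in> Mplus \<alpha>" and pot: "potential \<alpha> \<nu> = (\<lambda>x. INF g\<in>potential \<alpha> ` \<Gamma>. g x)"
    using bal by (auto simp: is_balayage_def \<Gamma>_def image_image)
  note measurable_potential[OF Mplus_radon_pos[OF nu], measurable]
    measurable_potential[OF Mplus_radon_pos[OF mu], measurable]
  have "\<Gamma> \<noteq> {}"
  proof
    assume "\<Gamma> = {}"
    then have "potential \<alpha> \<nu> x = \<infinity>" for x by (simp add: pot)
    then show False using nu by (simp add: Mplus_def)
  qed
  then have nonempty: "potential \<alpha> ` \<Gamma> \<noteq> {}" by simp
  have super: "superharmonic g" if "g \<in> potential \<alpha> ` \<Gamma>" for g
    using that superharmonic_potential_radon[OF Mplus_radon_pos] by (auto simp: \<Gamma>_def)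
  have meas: "(\<lambda>x. INF g\<in>potential \<alpha> ` \<Gamma>. g x) \<in> borel_measurable borel"
    unfolding pot[symmetric] by measurable
  obtain f :: "nat \<Rightarrow> 'a \<Rightarrow> ennreal" where f: "range f \<subseteq> potential \<alpha> ` \<Gamma>"
    and inf_le: "\<And>\<nu>'. prob_space \<nu>' \<Longrightarrow> sets \<nu>' = sets borel \<Longrightarrow> energy \<alpha> \<nu>' < \<infinity> \<Longrightarrow>
      AE x in \<nu>'. (INF j. f j x) \<le> (INF g\<in>potential \<alpha> ` \<Gamma>. g x)"
    by (rule cartan_countable_subfamily[OF nonempty super meas]) (assumption, rule that)
  have f_ge: "nearly_everywhere_on \<alpha> A (\<lambda>x. f j x \<ge> potential \<alpha> \<mu> x)"
    and [measurable]: "f j \<in> borel_measurable borel" for j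
  proof -
    obtain \<eta> where "\<eta> \<in> \<Gamma>" "f j = potential \<alpha> \<eta>" using f by blast
    then show "nearly_everywhere_on \<alpha> A (\<lambda>x. f j x \<ge> potential \<alpha> \<mu> x)" "f j \<in> borel_measurable borel"
      using measurable_potential[OF Mplus_radon_pos[of \<eta> \<alpha>]] by (simp_all add: \<Gamma>_def)
  qed
  show ?thesis
  proof (subst nearly_everywhere_on_iff_AE, simp, intro allI impI)
    fix \<nu>' :: "'a measure"
    assume nu': "prob_space \<nu>'" "sets \<nu>' = sets borel" "energy \<alpha> \<nu>' < \<infinity>" "AE x in \<nu>'. x \<in> A"
    have "AE x in \<nu>'. potential \<alpha> \<mu> x \<le> f j x" for j
      using f_ge[of j] nu' by (subst (asm) nearly_everywhere_on_iff_AE) auto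
    then have "AE x in \<nu>'. potential \<alpha> \<mu> x \<le> (INF j. f j x)" by (simp add: le_INF_iff AE_all_countable)
    then show "AE x in \<nu>'. potential \<alpha> \<mu> x \<le> potential \<alpha> \<nu> x"
      unfolding pot using inf_le[OF nu'(1-3)] by eventually_elim (rule order_trans)
  qed
qed

lemma potential_balayage_exhaustion:
  fixes \<mu> \<nu> :: "'a measure" and \<nu>k :: "nat \<Rightarrow> 'a measure"
  assumes U: "\<And>k. universally_measurable (U k)" "incseq U" "(\<Union>k. U k) = UNIV"
    and mu: "\<mu> \<in> Mplus \<alpha>" and bal: "is_balayage \<alpha> \<mu> A \<nu>" and balk: "\<And>k. is_balayage \<alpha> \<mu> (A \<inter> U k) (\<nu>k k)"
  shows "potential \<alpha> \<nu> x = (SUP k. potential \<alpha> (\<nu>k k) x)"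
proof -
  note rad = Mplus_radon_pos[OF is_balayage_Mplus]
  have inc: "incseq (\<lambda>k. potential \<alpha> (\<nu>k k) x)" for x
    using U(2) by (intro incseq_potential_balayage[OF balk]) (auto simp: incseq_def)
  have le: "potential \<alpha> (\<nu>k k) x \<le> potential \<alpha> \<nu> x" for k x
    by (rule is_balayage_mono[OF balk bal]) auto
  obtain x0 where x0: "potential \<alpha> \<nu> x0 < \<infinity>" using MplusE[OF is_balayage_Mplus[OF bal]] .
  obtain M where M: "radon_pos M" and pot: "\<And>x. potential \<alpha> M x = (SUP k. potential \<alpha> (\<nu>k k) x)"
    by (rule increasing_potentials_limit[OF rad[OF balk] inc rad[OF bal] le x0]) (rule that)
  have "potential \<alpha> M x0 \<le> potential \<alpha> \<nu> x0" unfolding pot by (intro SUP_least le)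
  then have "M \<in> Mplus \<alpha>" using x0 by (intro MplusI[OF M]) (rule le_less_trans)
  moreover have "nearly_everywhere_on \<alpha> A (\<lambda>x. potential \<alpha> M x \<ge> potential \<alpha> \<mu> x)"
    unfolding nearly_everywhere_on_iff
  proof (rule inner_cap_eq_0_UN[where U=U, OF U(1)])
    fix k
    have "potential \<alpha> (\<nu>k k) x \<le> potential \<alpha> M x" for x unfolding pot by (rule SUP_upper) simp
    then have "{x \<in> A. \<not> potential \<alpha> \<mu> x \<le> potential \<alpha> M x} \<inter> U k
        \<subseteq> {x \<in> A \<inter> U k. \<not> potential \<alpha> \<mu> x \<le> potential \<alpha> (\<nu>k k) x}"
      using order_trans by blast
    then show "inner_cap \<alpha> ({x \<in> A. \<not> potential \<alpha> \<mu> x \<le> potential \<alpha> M x} \<inter> U k) = 0"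
      using is_balayage_ge_nearly_everywhere[OF mu balk] unfolding nearly_everywhere_on_iff
      by (rule inner_cap_eq_0_mono[rotated])
  qed (simp add: U(3))
  ultimately have "potential \<alpha> \<nu> x \<le> potential \<alpha> M x" by (rule is_balayage_le[OF bal])
  then show ?thesis unfolding pot by (intro antisym SUP_least le)
qed

section \<open>Strong convergence\<close>

lemma mutual_energy_commute:
  "radon_pos \<nu> \<Longrightarrow> radon_pos \<eta> \<Longrightarrow> mutual_energy \<alpha> \<nu> \<eta> = mutual_energy \<alpha> \<eta> \<nu>" for \<nu> \<eta> :: "'a measure"
  unfolding mutual_energy_eq
  by (rule kernel_energy_commute) (simp_all add: K_minus radon_pos_sigma_finite radon_pos_sets)

lemma mutual_energy_eq_potential: "mutual_energy \<alpha> \<nu> \<eta> = (\<integral>\<^sup>+ x. potential \<alpha> \<eta> x \<partial>\<nu>)" for \<nu> \<eta> :: "'a measure"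
  by (simp add: mutual_energy_def potential_def)

lemma energy_le_of_potential_le:
  fixes \<nu> \<mu> :: "'a measure"
  assumes rad: "radon_pos \<nu>" "radon_pos \<mu>" and le: "\<And>x. potential \<alpha> \<nu> x \<le> potential \<alpha> \<mu> x"
  shows "energy \<alpha> \<nu> \<le> mutual_energy \<alpha> \<nu> \<mu>" "mutual_energy \<alpha> \<nu> \<mu> \<le> energy \<alpha> \<mu>" "energy \<alpha> \<nu> \<le> energy \<alpha> \<mu>"
proof -
  show le_mutual: "energy \<alpha> \<nu> \<le> mutual_energy \<alpha> \<nu> \<mu>"
    unfolding energy_def mutual_energy_eq_potential by (intro nn_integral_mono le)
  have "mutual_energy \<alpha> \<nu> \<mu> = mutual_energy \<alpha> \<mu> \<nu>" by (rule mutual_energy_commute[OF rad])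
  also have "\<dots> \<le> energy \<alpha> \<mu>" unfolding energy_def mutual_energy_eq_potential by (intro nn_integral_mono le)
  finally show "mutual_energy \<alpha> \<nu> \<mu> \<le> energy \<alpha> \<mu>" .
  with le_mutual show "energy \<alpha> \<nu> \<le> energy \<alpha> \<mu>" by (rule order_trans)
qed

lemma energy_balayage_le:
  fixes \<mu> \<nu> :: "'a measure"
  assumes "\<mu> \<in> Mplus \<alpha>" "is_balayage \<alpha> \<mu> A \<nu>"
  shows "energy \<alpha> \<nu> \<le> energy \<alpha> \<mu>"
  using assms is_balayage_Mplus[OF assms(2)]
  by (intro energy_le_of_potential_le(3) Mplus_radon_pos is_balayage_le_potential)

lemma tendsto_mutual_energy:
  fixes \<mu> :: "nat \<Rightarrow> 'a measure"
  assumes rad: "\<And>k. radon_pos (\<mu> k)" and inc: "\<And>x. incseq (\<lambda>k. potential \<alpha> (\<mu> k) x)"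
    and lim: "\<And>x. potential \<alpha> M x = (SUP k. potential \<alpha> (\<mu> k) x)" and nu: "radon_pos \<nu>"
  shows "(\<lambda>k. mutual_energy \<alpha> \<nu> (\<mu> k)) \<longlonglongrightarrow> mutual_energy \<alpha> \<nu> M"
proof -
  note radon_pos_sets[OF nu, measurable_cong] measurable_potential[OF rad, measurable]
  have "incseq (\<lambda>k. potential \<alpha> (\<mu> k))" using inc by (auto simp: incseq_def le_fun_def)
  then have "mutual_energy \<alpha> \<nu> M = (SUP k. mutual_energy \<alpha> \<nu> (\<mu> k))"
    unfolding mutual_energy_eq_potential lim by (intro nn_integral_monotone_convergence_SUP) auto
  moreover have "incseq (\<lambda>k. mutual_energy \<alpha> \<nu> (\<mu> k))"
    unfolding mutual_energy_eq_potential by (intro incseq_SucI nn_integral_mono incseq_SucD[OF inc])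
  ultimately show ?thesis using LIMSEQ_SUP by simp
qed

lemma tendsto_energy:
  fixes \<mu> :: "nat \<Rightarrow> 'a measure"
  assumes rad: "\<And>k. radon_pos (\<mu> k)" and inc: "\<And>x. incseq (\<lambda>k. potential \<alpha> (\<mu> k) x)"
    and M: "radon_pos M" and lim: "\<And>x. potential \<alpha> M x = (SUP k. potential \<alpha> (\<mu> k) x)"
  shows "(\<lambda>k. energy \<alpha> (\<mu> k)) \<longlonglongrightarrow> energy \<alpha> M"
proof (rule order_tendstoI)
  fix a assume "a < energy \<alpha> M"
  have "(\<lambda>j. mutual_energy \<alpha> (\<mu> j) M) \<longlonglongrightarrow> energy \<alpha> M"
    using tendsto_mutual_energy[OF rad inc lim M] by (simp add: energy_def mutual_energy_commute[OF M rad])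
  then have "\<forall>\<^sub>F j in sequentially. a < mutual_energy \<alpha> (\<mu> j) M"
    using \<open>a < energy \<alpha> M\<close> by (rule order_tendstoD)
  then obtain j where "a < mutual_energy \<alpha> (\<mu> j) M" by (auto simp: eventually_sequentially)
  with tendsto_mutual_energy[OF rad inc lim rad] have "\<forall>\<^sub>F k in sequentially. a < mutual_energy \<alpha> (\<mu> j) (\<mu> k)"
    by (rule order_tendstoD)
  with eventually_ge_at_top[of j] show "\<forall>\<^sub>F k in sequentially. a < energy \<alpha> (\<mu> k)"
  proof eventually_elim
    case (elim k)
    show ?case
      by (rule less_le_trans[OF elim(2) energy_le_of_potential_le(2)[OF rad rad incseqD[OF inc elim(1)]]])
  qed
next
  have "energy \<alpha> (\<mu> k) \<le> energy \<alpha> M" for k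
    by (rule energy_le_of_potential_le(3)[OF rad M]) (auto simp: lim intro: SUP_upper)
  then show "\<forall>\<^sub>F k in sequentially. energy \<alpha> (\<mu> k) < a" if "energy \<alpha> M < a" for a
    using that by (intro always_eventually allI) (rule le_less_trans)
qed

lemma tendsto_energy_dist_0:
  fixes \<mu> :: "nat \<Rightarrow> 'a measure"
  assumes rad: "\<And>k. radon_pos (\<mu> k)" and inc: "\<And>x. incseq (\<lambda>k. potential \<alpha> (\<mu> k) x)"
    and M: "radon_pos M" and lim: "\<And>x. potential \<alpha> M x = (SUP k. potential \<alpha> (\<mu> k) x)" and fin: "energy \<alpha> M < \<infinity>"
  shows "(\<lambda>k. energy_dist \<alpha> (\<mu> k) M) \<longlonglongrightarrow> 0"
proof -
  obtain e where e: "energy \<alpha> M = ennreal e" "e \<ge> 0" using fin by (cases "energy \<alpha> M") auto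
  have "(\<lambda>k. mutual_energy \<alpha> (\<mu> k) M) \<longlonglongrightarrow> ennreal e"
    using tendsto_mutual_energy[OF rad inc lim M]
    by (simp add: energy_def[symmetric] mutual_energy_commute[OF M rad] e)
  then have "(\<lambda>k. enn2real (mutual_energy \<alpha> (\<mu> k) M)) \<longlonglongrightarrow> e" using e(2) by (rule tendsto_enn2real)
  moreover have "(\<lambda>k. enn2real (energy \<alpha> (\<mu> k))) \<longlonglongrightarrow> e"
    using tendsto_energy[OF rad inc M lim, unfolded e(1)] e(2) by (rule tendsto_enn2real)
  ultimately have "(\<lambda>k. energy_dist \<alpha> (\<mu> k) M) \<longlonglongrightarrow> sqrt (e + e - 2 * e)"
    unfolding energy_dist_def e(1) using e(2)
    by (intro tendsto_real_sqrt tendsto_diff tendsto_add tendsto_mult tendsto_const) simp_all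
  then show ?thesis by simp
qed

end

theorem mainTheorem19:
  fixes \<alpha> :: real and A :: "'a::euclidean_space set" and U :: "nat \<Rightarrow> 'a set"
    and \<mu> \<mu>A :: "'a measure" and \<mu>Ak :: "nat \<Rightarrow> 'a measure"
  assumes "DIM('a) \<ge> 3" and "0 < \<alpha>" and "\<alpha> \<le> 2"
    and "\<And>k. universally_measurable (U k)" and "incseq U" and "(\<Union>k. U k) = UNIV"
    and "\<mu> \<in> Mplus \<alpha>"
    and "is_balayage \<alpha> \<mu> A \<mu>A"
    and "\<And>k. is_balayage \<alpha> \<mu> (A \<inter> U k) (\<mu>Ak k)"
  shows "vague_conv \<mu>Ak \<mu>A
    \<and> (\<forall>x. incseq (\<lambda>k. potential \<alpha> (\<mu>Ak k) x)
           \<and> (\<lambda>k. potential \<alpha> (\<mu>Ak k) x) \<longlonglongrightarrow> potential \<alpha> \<mu>A x)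
    \<and> (energy \<alpha> \<mu> < \<infinity> \<longrightarrow>
         energy \<alpha> \<mu>A < \<infinity> \<and> (\<forall>k. energy \<alpha> (\<mu>Ak k) < \<infinity>)
         \<and> (\<lambda>k. energy_dist \<alpha> (\<mu>Ak k) \<mu>A) \<longlonglongrightarrow> 0)"
proof -
  have "\<alpha> < real DIM('a)" using assms(1,3) by linarith
  with assms(2,3) obtain c and K :: "'a \<Rightarrow> ennreal" where "riesz_potential \<alpha> c K"
    by (rule riesz_potential_exists)
  then interpret riesz_potential \<alpha> c K .
  note mu = assms(7) and balayage = assms(8) and balayages = assms(9)
  note rad = Mplus_radon_pos[OF is_balayage_Mplus]
  have inc: "incseq (\<lambda>k. potential \<alpha> (\<mu>Ak k) x)" for x
    using assms(5) by (intro incseq_potential_balayage[OF balayages]) (auto simp: incseq_def)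
  have sup: "potential \<alpha> \<mu>A x = (SUP k. potential \<alpha> (\<mu>Ak k) x)" for x
    by (rule potential_balayage_exhaustion[OF assms(4-9)])
  have energy: "energy \<alpha> \<mu>A \<le> energy \<alpha> \<mu>" "energy \<alpha> (\<mu>Ak k) \<le> energy \<alpha> \<mu>" for k
    by (rule energy_balayage_le[OF mu balayage], rule energy_balayage_le[OF mu balayages])
  obtain x0 where "potential \<alpha> \<mu>A x0 < \<infinity>" using MplusE[OF is_balayage_Mplus[OF balayage]] .
  then have "vague_conv \<mu>Ak \<mu>A"
    by (rule vague_conv_of_increasing_potentials[OF rad[OF balayages] inc rad[OF balayage] sup])
  moreover have "(\<lambda>k. potential \<alpha> (\<mu>Ak k) x) \<longlonglongrightarrow> potential \<alpha> \<mu>A x" for x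
    unfolding sup by (rule LIMSEQ_SUP[OF inc])
  moreover have "(\<lambda>k. energy_dist \<alpha> (\<mu>Ak k) \<mu>A) \<longlonglongrightarrow> 0" if "energy \<alpha> \<mu> < \<infinity>"
    using energy(1) that by (intro tendsto_energy_dist_0[OF rad[OF balayages] inc rad[OF balayage] sup]) (rule le_less_trans)
  ultimately show ?thesis using inc energy[THEN le_less_trans] by simp
qed

end
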